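(* Let $M\ge 2$ and $N\ge 2$, and consider the real compound MISO broadcast channel with $M$ antennas at the transmitter and $N$ single-antenna users, where user $i$ has $J_i\ge M$ possible channel states, $i=1,\dots,N$. Then, almost surely (with respect to the draw of the channel states), the total number of degrees of freedom is $d=\frac{MN}{M+N-1}$.
   Context: Real compound MISO broadcast channel. A transmitter with $M>1$ antennas communicates with $N$ single-antenna receivers. For each user $k\in\{1,\dots,N\}$ there is a finite set of $J_k$ possible channel vectors (states) $\mathbf{h}^{[k]}_{1},\dots,\mathbf{h}^{[k]}_{J_k}\in\mathbb{R}^{1\times M}$. If user $k$ is in state $j_k\in\{1,\dots,J_k\}$, its received signal at time $t$ is $$y^{[k]}_{j_k}(t)=\mathbf{h}^{[k]}_{j_k}\mathbf{x}(t)+z^{[k]}_{j_k}(t),$$ where $\mathbf{x}(t)\in\mathbb{R}^{M\times 1}$ is the transmitted vector, subject to the average power constraint $E(\|\mathbf{x}\|^2)\le P$ (averaged over the codeword), and the noise $z^{[k]}_{j_k}(t)$ is i.i.d. zero-mean unit-variance real Gaussian. The state of each user is fixed throughout the duration of communication. The sets of possible states are known to all nodes and do not depend on $P$; the transmitter does not know which states are realized, while the receivers have perfect channel knowledge. Generic states / almost surely. All the coefficients of all possible states are drawn from a continuous distribution (absolutely continuous with respect to Lebesgue measure), so that almost surely they are algebraically independent over the rationals; "almost surely" refers to this draw. Achievable rates. The transmitter sends independent messages $W^{[k]}$ of rate $R^{[k]}$ to receiver $k$, $k=1,\dots,N$. A rate tuple $(R^{[1]},\dots,R^{[N]})$ is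 achievable at power $P$ if there are codes (encoder not depending on the realized states) of growing block length such that every receiver $k$ decodes $W^{[k]}$ with arbitrarily small error probability, regardless of which state is realized. Degrees of freedom. The total number of degrees of freedom is $$d=\lim_{P\to\infty}\frac{C_\Sigma(P)}{\frac12\log P},$$ where $C_\Sigma(P)$ is the supremum of $R^{[1]}+\cdots+R^{[N]}$ over all rate tuples achievable at power $P$. *)

theory Defs
  imports "HOL-Probability.Probability"
begin

text \<open>
  Antennas are indexed by the finite type \<open>'m\<close>, users by the finite type \<open>'n\<close>. User \<open>k\<close> has the states
  \<open>1, \<dots>, J k\<close>, and \<open>h (k, j)\<close> is its channel vector in state \<open>j\<close>.
\<close>

definition state_index :: "('n \<Rightarrow> nat) \<Rightarrow> ('n \<times> nat) set" where
  "state_index J = (SIGMA k:UNIV. {1..J k})"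

text \<open>Lebesgue measure on the space of all coefficients of all possible states.\<close>

definition state_lebesgue :: "('n \<Rightarrow> nat) \<Rightarrow> ('n \<times> nat \<Rightarrow> real ^ 'm) measure" where
  "state_lebesgue J = PiM (state_index J) (\<lambda>_. lborel)"

definition continuous_draw :: "('n \<Rightarrow> nat) \<Rightarrow> ('n \<times> nat \<Rightarrow> real ^ 'm) measure \<Rightarrow> bool" where
  "continuous_draw J D \<longleftrightarrow>
     prob_space D \<and> sets D = sets (state_lebesgue J) \<and> absolutely_continuous (state_lebesgue J) D"

definition gaussian_noise :: "nat \<Rightarrow> (nat \<Rightarrow> real) measure" where
  "gaussian_noise n = PiM {..<n} (\<lambda>_. density lborel std_normal_density)"

definition received :: "nat \<Rightarrow> real ^ 'm \<Rightarrow> (nat \<Rightarrow> real ^ 'm) \<Rightarrow> (nat \<Rightarrow> real) \<Rightarrow> (nat \<Rightarrow> real)" where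
  "received n g x z = (\<lambda>t\<in>{..<n}. g \<bullet> x t + z t)"

text \<open>
  Messages are independent and uniform: the message tuple is uniform on the product of the sets
  \<open>{..<L k}\<close>.
\<close>

definition message_tuples :: "('n \<Rightarrow> nat) \<Rightarrow> ('n \<Rightarrow> nat) set" where
  "message_tuples L = (\<Pi>\<^sub>E k\<in>UNIV. {..<L k})"

definition average_power ::
    "nat \<Rightarrow> ('n \<Rightarrow> nat) \<Rightarrow> (('n \<Rightarrow> nat) \<Rightarrow> nat \<Rightarrow> real ^ 'm) \<Rightarrow> real" where
  "average_power n L enc =
     (\<Sum>w\<in>message_tuples L. (\<Sum>t<n. (norm (enc w t))\<^sup>2) / real n) / real (card (message_tuples L))"

text \<open>
  Probability that user \<open>k\<close>, having channel vector \<open>g\<close> and applying the decoder \<open>dec\<close> to its received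
  block, does not recover its own message.
\<close>

definition error_prob ::
    "nat \<Rightarrow> ('n \<Rightarrow> nat) \<Rightarrow> (('n \<Rightarrow> nat) \<Rightarrow> nat \<Rightarrow> real ^ 'm) \<Rightarrow> 'n \<Rightarrow> real ^ 'm \<Rightarrow>
       ((nat \<Rightarrow> real) \<Rightarrow> nat) \<Rightarrow> real" where
  "error_prob n L enc k g dec =
     (\<Sum>w\<in>message_tuples L.
        measure (gaussian_noise n)
          {z \<in> space (gaussian_noise n). dec (received n g (enc w) z) \<noteq> w k})
      / real (card (message_tuples L))"

text \<open>
  The encoder may depend on the whole family \<open>h\<close> of possible states but not on the realized ones;
  the decoder \<open>dec k j\<close> may in addition depend on the realized state \<open>j\<close> of user \<open>k\<close>. The states of
  the other users affect neither the transmitted nor the received signal of user \<open>k\<close>, so they are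
  not passed to its decoder.
\<close>

definition is_code ::
    "('n \<Rightarrow> nat) \<Rightarrow> ('n \<times> nat \<Rightarrow> real ^ 'm) \<Rightarrow> real \<Rightarrow> nat \<Rightarrow> ('n \<Rightarrow> nat) \<Rightarrow> real \<Rightarrow>
       (('n \<Rightarrow> nat) \<Rightarrow> nat \<Rightarrow> real ^ 'm) \<Rightarrow> ('n \<Rightarrow> nat \<Rightarrow> (nat \<Rightarrow> real) \<Rightarrow> nat) \<Rightarrow> bool" where
  "is_code J h P n L \<epsilon> enc dec \<longleftrightarrow>
     average_power n L enc \<le> P \<and>
     (\<forall>k. \<forall>j\<in>{1..J k}.
        dec k j \<in> measurable (PiM {..<n} (\<lambda>_. borel)) (count_space UNIV) \<and>
        error_prob n L enc k (h (k, j)) (dec k j) \<le> \<epsilon>)"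

text \<open>Rates are in bits per channel use.\<close>

definition achievable ::
    "('n \<Rightarrow> nat) \<Rightarrow> ('n \<times> nat \<Rightarrow> real ^ 'm) \<Rightarrow> real \<Rightarrow> ('n \<Rightarrow> real) \<Rightarrow> bool" where
  "achievable J h P R \<longleftrightarrow>
     (\<forall>k. 0 \<le> R k) \<and>
     (\<forall>\<epsilon>>0. \<forall>\<^sub>F n in sequentially.
        \<exists>enc dec. is_code J h P n (\<lambda>k. nat \<lceil>2 powr (real n * R k)\<rceil>) \<epsilon> enc dec)"

definition sum_capacity ::
    "('n::finite \<Rightarrow> nat) \<Rightarrow> ('n \<times> nat \<Rightarrow> real ^ 'm) \<Rightarrow> real \<Rightarrow> ereal" where
  "sum_capacity J h P = (SUP R\<in>{R. achievable J h P R}. ereal (\<Sum>k\<in>UNIV. R k))"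

definition has_dof ::
    "('n::finite \<Rightarrow> nat) \<Rightarrow> ('n \<times> nat \<Rightarrow> real ^ 'm) \<Rightarrow> real \<Rightarrow> bool" where
  "has_dof J h d \<longleftrightarrow>
     ((\<lambda>P. sum_capacity J h P / ereal (1 / 2 * log 2 P)) \<longlongrightarrow> ereal d) at_top"

end

theory Submission
  imports Defs "Jordan_Normal_Form.Determinant" "HOL-Real_Asymp.Real_Asymp"
begin

text \<open>
  \<^bold>\<open>Converse.\<close> Take \<open>M\<close> states of one user \<open>k\<close> whose channel vectors form a basis. Up to splitting its noise,
  every received signal is a function of the \<open>M\<close> noisy coordinates of the input in this basis and of independent
  noise. Given the latter, the sets of coordinates that are decoded to different message tuples are disjoint, and
  comparing volumes gives \<open>(\<Sum>l. R l) + (M - 1) * R k \<le> M / 2 * log 2 P + O(1)\<close>. Sum over \<open>k\<close>.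

  \<^bold>\<open>Achievability.\<close> Every user is served by integer symbols that are multiplied with monomials in the channel
  coefficients, chosen so that the interfering monomials coincide at each receiver up to boundary effects (real
  interference alignment). The distance of distinct received signals is controlled by a Diophantine property of
  the monomials, and block codes from the Gilbert--Varshamov bound remove the remaining errors.

  \<^bold>\<open>Diophantine property.\<close> For almost all coefficients the monomials are badly approximable up to an arbitrarily
  small exponent. By Fubini it suffices to see this along translates of a curve on which different monomials become
  polynomials of different degrees. There it follows from Borel--Cantelli and a quantitative non-divergence estimate
  of Kleinbock and Margulis, where flags of lattice subspaces take the place of single short vectors.
\<close>

section \<open>Quantitative non-divergence\<close>

text \<open>The two bounds meet because both count \<open>M + N - 1\<close>. At a receiver the
  desired symbols occupy \<open>M * b ^ G\<close> monomials and the interference of each other user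
  at most \<open>(b + 1) ^ G\<close>, with \<open>G\<close> the number of channel coefficients; the
  desired share tends to \<open>M / (M + N - 1)\<close> as \<open>b\<close> grows. In the outer
  bound user \<open>k\<close> decodes from each of \<open>M\<close> coordinates of the input, so its
  message is counted \<open>M\<close> times and every other message once. An error probability
  involves only the marginal law of the noise at one receiver. The noises of all receivers and
  states may therefore be coupled at will, and disjointness of decoding sets on one probability
  space replaces entropy inequalities. The Diophantine estimate cannot come from a union bound over
  integer vectors: a polynomial of degree \<open>d\<close> is below \<open>\<eta>\<close> on a set
  whose measure decreases only like the \<open>d\<close>-th root of \<open>\<eta>\<close>, too weak
  against the number of vectors. Controlling the covolumes of all lattice subspaces at once gives a
  bound that is geometric in the scale \<open>i\<close> of coefficients up to
  \<open>2 ^ i\<close>.\<close>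

lemma lagrange_interpolation:
  fixes f :: "real poly"
  assumes fin: "finite X" and deg: "degree f < card X"
  shows "poly f x = (\<Sum>a\<in>X. poly f a * (\<Prod>b\<in>X-{a}. (x - b) / (a - b)))"
proof -
  define g where "g = (\<Sum>a\<in>X. Polynomial.smult (poly f a / (\<Prod>b\<in>X-{a}. (a - b))) (\<Prod>b\<in>X-{a}. [:-b, 1:]))"
  have pg: "poly g y = (\<Sum>a\<in>X. poly f a * (\<Prod>b\<in>X-{a}. (y - b) / (a - b)))" for y
    unfolding g_def by (simp add: poly_sum poly_prod prod_dividef)
  have "degree g \<le> card X - 1"
    unfolding g_def
  proof (rule degree_sum_le[OF fin])
    fix a assume a: "a \<in> X"
    have "degree (\<Prod>b\<in>X-{a}. [:-b, 1:]) \<le> (\<Sum>b\<in>X-{a}. degree [:-b, 1:])"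
      using degree_prod_sum_le[of "X-{a}" "\<lambda>b. [:-b, 1:]"] fin by (simp add: o_def)
    also have "\<dots> = card X - 1" using a fin by simp
    finally show "degree (Polynomial.smult (poly f a / (\<Prod>b\<in>X-{a}. (a - b))) (\<Prod>b\<in>X-{a}. [:-b, 1:])) \<le>
      card X - 1"
      using degree_smult_le[of "poly f a / (\<Prod>b\<in>X-{a}. (a - b))" "\<Prod>b\<in>X-{a}. [:-b, 1:]"] by simp
  qed
  then have dg: "degree g < card X" using deg by linarith
  have "poly g y = poly f y" if y: "y \<in> X" for y
  proof -
    have "(\<Prod>b\<in>X-{a}. (y - b) / (a - b)) = 0" if "a \<in> X - {y}" for a
      using that y fin by (intro prod_zero) auto
    moreover have "(\<Prod>b\<in>X-{y}. (y - b) / (y - b)) = 1"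
      by (intro prod.neutral) auto
    moreover have "(\<Sum>a\<in>X-{y}. poly f a * (\<Prod>b\<in>X-{a}. (y - b) / (a - b))) = 0"
      using calculation(1) by (intro sum.neutral) simp
    ultimately show ?thesis unfolding pg sum.remove[OF fin y] by simp
  qed
  then have "g = f" using poly_eqI_degree[of X g f] dg deg by simp
  then show ?thesis using pg[of x] by simp
qed

text \<open>Greedy choice: while at most \<open>D\<close> points are chosen, the intervals of radius
  \<open>\<delta>\<close> around them have total length at most \<open>2 * D * \<delta>\<close> and
  cannot cover \<open>S\<close>.\<close>

lemma spread_points_exist:
  fixes S :: "real set"
  assumes S: "S \<in> lmeasurable" and \<delta>: "2 * real D * \<delta> < measure lebesgue S" "0 < \<delta>"
  shows "k \<le> Suc D \<Longrightarrow> \<exists>X\<subseteq>S. finite X \<and> card X = k \<and> (\<forall>a\<in>X. \<forall>b\<in>X. a \<noteq> b \<longrightarrow> \<delta> \<le> \<bar>a - b\<bar>)"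
proof (induction k)
  case 0
  then show ?case by (intro exI[of _ "{}"]) auto
next
  case (Suc k)
  then obtain X where X: "X \<subseteq> S" "finite X" "card X = k" "\<And>a b. a\<in>X \<Longrightarrow> b\<in>X \<Longrightarrow> a \<noteq> b \<Longrightarrow> \<delta> \<le> \<bar>a - b\<bar>"
    by auto
  have "measure lebesgue (\<Union>a\<in>X. ball a \<delta>) \<le> (\<Sum>a\<in>X. measure lebesgue (ball a \<delta>))"
    by (rule measure_UNION_le) (use X in auto)
  also have "\<dots> = (\<Sum>a\<in>X. 2 * \<delta>)"
    using \<delta> by (intro sum.cong) (auto simp: ball_eq_greaterThanLessThan)
  also have "\<dots> = 2 * real k * \<delta>" using X by simp
  also have "\<dots> \<le> 2 * real D * \<delta>" using Suc.prems \<delta> by (intro mult_right_mono) auto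
  also have "\<dots> < measure lebesgue S" by (rule \<delta>)
  finally have lt: "measure lebesgue (\<Union>a\<in>X. ball a \<delta>) < measure lebesgue S" .
  have "\<not> S \<subseteq> (\<Union>a\<in>X. ball a \<delta>)"
  proof
    assume "S \<subseteq> (\<Union>a\<in>X. ball a \<delta>)"
    then have "measure lebesgue S \<le> measure lebesgue (\<Union>a\<in>X. ball a \<delta>)"
      using fmeasurableD[OF S] X
      by (intro measure_mono_fmeasurable) (auto intro!: fmeasurable.finite_UN)
    with lt show False by simp
  qed
  then obtain y where yS: "y \<in> S" and "y \<notin> (\<Union>a\<in>X. ball a \<delta>)" by blast
  then have y: "y \<in> S" "\<delta> \<le> \<bar>a - y\<bar>" "\<delta> \<le> \<bar>y - a\<bar>" if "a \<in> X" for a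
    using that by (auto simp: dist_real_def not_less abs_minus_commute)
  have "y \<notin> X" using y(2)[of y] \<delta> by auto
  show ?case
  proof (intro exI[of _ "insert y X"] conjI ballI impI)
    show "insert y X \<subseteq> S" "finite (insert y X)" "card (insert y X) = Suc k"
      using X \<open>y \<notin> X\<close> yS by auto
    fix a b assume "a \<in> insert y X" "b \<in> insert y X" "a \<noteq> b"
    then show "\<delta> \<le> \<bar>a - b\<bar>"
      using X(4)[of a b] y(2)[of a] y(3)[of b] by auto
  qed
qed

text \<open>Interpolation at \<open>D + 1\<close> points of the sublevel set expresses
  \<open>poly f y\<close> by values below \<open>\<eta>\<close>. The weights are controlled by the
  spacing of the points, which is proportional to the measure of the set. Since
  \<open>poly f y\<close> has absolute value at least \<open>\<rho>\<close>, the spacing and hence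
  the measure must be small.\<close>

lemma polynomial_sublevel_measure:
  fixes f :: "real poly"
  assumes deg: "degree f \<le> D" and D: "D \<ge> 1" and pos: "0 < \<eta>" "0 < \<rho>"
    and y: "y \<in> ball c R" "\<rho> \<le> \<bar>poly f y\<bar>"
  shows "measure lebesgue {x\<in>ball c R. \<bar>poly f x\<bar> < \<eta>} \<le> 4 * (real D + 1)^2 * (\<eta>/\<rho>) powr (1 / D) * R"
proof -
  define S where "S = {x\<in>ball c R. \<bar>poly f x\<bar> < \<eta>}"
  have R: "R > 0" using y by (metis ball_empty empty_iff not_le)
  have "open {x. \<bar>poly f x\<bar> < \<eta>}"
    by (intro open_Collect_less continuous_intros)
  then have "open (ball c R \<inter> {x. \<bar>poly f x\<bar> < \<eta>})" by (intro open_Int open_ball)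
  also have "ball c R \<inter> {x. \<bar>poly f x\<bar> < \<eta>} = S" unfolding S_def by auto
  finally have "open S" .
  moreover have "bounded S" unfolding S_def by (rule bounded_subset[OF bounded_ball]) auto
  ultimately have Sm: "S \<in> lmeasurable" by (rule lmeasurable_open[rotated])
  show ?thesis
  proof (cases "measure lebesgue S > 0")
    case False
    then have "measure lebesgue S \<le> 0" by simp
    also have "0 \<le> 4 * (real D + 1)^2 * (\<eta>/\<rho>) powr (1 / D) * R" using R by simp
    finally show ?thesis unfolding S_def .
  next
    case True
    \<comment> \<open>The denominator contains \<open>D + 1\<close> instead of \<open>D\<close>, so
      that the total length of \<open>D\<close> intervals stays strictly below the measure of
      \<open>S\<close>.\<close>
    define \<delta> where "\<delta> = measure lebesgue S / (2 * (real D + 1))"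
    have \<delta>0: "0 < \<delta>" using True by (simp add: \<delta>_def)
    have "2 * real D * \<delta> < measure lebesgue S"
      using True by (simp add: \<delta>_def field_simps)
    from  spread_points_exist[OF Sm this \<delta>0, of "Suc D"] obtain X where
      X: "X \<subseteq> S" "finite X" "card X = Suc D" "\<And>a b. a\<in>X \<Longrightarrow> b\<in>X \<Longrightarrow> a \<noteq> b \<Longrightarrow> \<delta> \<le> \<bar>a - b\<bar>"
      by auto
    have "\<rho> \<le> \<bar>poly f y\<bar>" by (rule y)
    also have "\<dots> = \<bar>\<Sum>a\<in>X. poly f a * (\<Prod>b\<in>X-{a}. (y - b) / (a - b))\<bar>"
      using lagrange_interpolation[of X f y] X deg by simp
    also have "\<dots> \<le> (\<Sum>a\<in>X. \<bar>poly f a * (\<Prod>b\<in>X-{a}. (y - b) / (a - b))\<bar>)" by (rule sum_abs)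
    also have "\<dots> \<le> (\<Sum>a\<in>X. \<eta> * (2*R/\<delta>)^D)"
    proof (rule sum_mono)
      fix a assume a: "a \<in> X"
      have "\<bar>\<Prod>b\<in>X-{a}. (y - b) / (a - b)\<bar> = (\<Prod>b\<in>X-{a}. \<bar>y - b\<bar> / \<bar>a - b\<bar>)"
        by (simp add: abs_prod abs_divide)
      also have "\<dots> \<le> (\<Prod>b\<in>X-{a}. 2*R/\<delta>)"
      proof (intro prod_mono conjI)
        fix b assume b: "b \<in> X - {a}"
        then have "b \<in> ball c R" using X S_def by auto
        then have "\<bar>y - b\<bar> \<le> 2 * R" using y(1) by (auto simp: dist_real_def)
        then show "\<bar>y - b\<bar> / \<bar>a - b\<bar> \<le> 2*R/\<delta>"
          using X(4)[of a b] a b \<delta>0 R by (intro frac_le) auto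
      qed auto
      also have "\<dots> = (2*R/\<delta>)^D" using X a by simp
      finally have "\<bar>\<Prod>b\<in>X-{a}. (y - b) / (a - b)\<bar> \<le> (2*R/\<delta>)^D" .
      moreover have "\<bar>poly f a\<bar> \<le> \<eta>" using a X S_def by auto
      ultimately show "\<bar>poly f a * (\<Prod>b\<in>X-{a}. (y - b) / (a - b))\<bar> \<le> \<eta> * (2*R/\<delta>)^D"
        unfolding abs_mult using pos by (intro mult_mono) auto
    qed
    also have "\<dots> = (real D + 1) * \<eta> * (2*R/\<delta>)^D" using X by simp
    finally have 1: "(\<delta>/(2*R))^D \<le> (real D + 1) * (\<eta> / \<rho>)"
      using \<delta>0 R pos by (simp add: field_simps power_divide)
    have "\<delta>/(2*R) = ((\<delta>/(2*R))^D) powr (1/D)"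
      using \<delta>0 R D by (simp add: powr_powr flip: powr_realpow)
    also have "\<dots> \<le> ((real D + 1) * (\<eta> / \<rho>)) powr (1/D)"
      using 1 \<delta>0 R by (intro powr_mono2) auto
    also have "\<dots> = (real D + 1) powr (1/D) * (\<eta> / \<rho>) powr (1/D)"
      using pos by (intro powr_mult) 
    also have "\<dots> \<le> (real D + 1) powr 1 * (\<eta> / \<rho>) powr (1/D)"
      using D by (intro mult_right_mono powr_mono) auto
    finally have "\<delta> \<le> 2 * R * ((real D + 1) * (\<eta> / \<rho>) powr (1/D))"
      using R by (simp add: field_simps)
    then have "2 * (real D + 1) * \<delta> \<le> 2 * (real D + 1) * (2 * R * ((real D + 1) * (\<eta> / \<rho>) powr (1/D)))"
      by (intro mult_left_mono) auto
    moreover have "2 * (real D + 1) * \<delta> = measure lebesgue S" by (simp add: \<delta>_def add_eq_0_iff)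
    ultimately show ?thesis unfolding S_def[symmetric]
      by (simp add: power2_eq_square algebra_simps)
  qed
qed

section \<open>Flags of subspaces with controlled covolumes\<close>

text \<open>The flag argument rests on these properties alone. In the application \<open>P\<close>
  consists of the subspaces spanned by lattice vectors, \<open>\<psi> V\<close> is a squared
  covolume along the curve and \<open>m\<close> is the dimension. \<open>C\<close> will contain a
  small power of \<open>\<eta> / \<rho>\<close>, so all bounds are kept linear in
  \<open>C\<close>.\<close>

locale marking_setup =
  fixes P :: "'v set set" and \<psi> :: "'v set \<Rightarrow> real \<Rightarrow> real" and m :: nat and \<eta> \<rho> C :: real
  assumes chain_bound: "\<And>F. F \<subseteq> P \<Longrightarrow> \<forall>V\<in>F. \<forall>W\<in>F. V \<subseteq> W \<or> W \<subseteq> V \<Longrightarrow> finite F \<and> card F \<le> m"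
    and cont: "\<And>V. V \<in> P \<Longrightarrow> continuous_on UNIV (\<psi> V)"
    and good: "\<And>V c R y. V \<in> P \<Longrightarrow> y \<in> ball c R \<Longrightarrow> \<rho> \<le> \<psi> V y \<Longrightarrow>
                 measure lebesgue {x\<in>ball c R. \<psi> V x < \<eta>} \<le> C * R"
    and C_nonneg: "0 \<le> C"
begin

definition chain :: "'v set set \<Rightarrow> bool" where
  "chain F \<longleftrightarrow> (\<forall>V\<in>F. \<forall>W\<in>F. V \<subseteq> W \<or> W \<subseteq> V)"

definition comparable :: "'v set set \<Rightarrow> 'v set set" where
  "comparable F = {V\<in>P. V \<notin> F \<and> (\<forall>W\<in>F. V \<subseteq> W \<or> W \<subseteq> V)}"

text \<open>The values on \<open>F\<close> are left free: the induction moves a subspace into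
  \<open>F\<close> once its small values are controlled by other means, and the final application
  has \<open>F = {}\<close>. On \<open>E\<close> both ends of the window matter later: the lower end
  when a vector generates a flag member, the upper end when the covolume of a flag member is divided
  out.\<close>

definition marked :: "'v set set \<Rightarrow> real \<Rightarrow> bool" where
  "marked F x \<longleftrightarrow> (\<exists>E\<subseteq>P. chain (F \<union> E) \<and> (\<forall>V\<in>E. \<eta> \<le> \<psi> V x \<and> \<psi> V x \<le> \<rho>) \<and>
      (\<forall>V\<in>comparable (F \<union> E). \<rho> \<le> \<psi> V x))"

text \<open>The factor 20 is the 5 of the Vitali covering lemma times 4: the shrunken balls are
  disjoint inside a ball of radius \<open>2 * R\<close>, which has length
  \<open>4 * R\<close>.\<close>

fun mark_const :: "nat \<Rightarrow> real" where
  "mark_const 0 = 0"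
| "mark_const (Suc n) = 20 * (mark_const n + C)"

lemma mark_const_nonneg: "0 \<le> mark_const n"
  by (induction n) (use C_nonneg in auto)

text \<open>At an unmarked point some comparable \<open>V\<close> is below \<open>\<rho>\<close>. On
  a nearly maximal ball around the point where such a \<open>V\<close> stays below
  \<open>\<rho>\<close>, the points with \<open>\<psi> V\<close> under \<open>\<eta>\<close> are few
  by \<open>good\<close>, and at the other points a marking of \<open>insert V F\<close> is also a
  marking of \<open>F\<close>. The doubled ball is large enough for \<open>good\<close> and for the
  induction hypothesis.\<close>

lemma unmarked_local:
  assumes F: "F \<subseteq> P" "chain F" and R: "R > 0"
    and sup: "\<And>V. V \<in> comparable F \<Longrightarrow> \<exists>y\<in>ball c R. \<rho> \<le> \<psi> V y"
    and IH: "\<And>V x r. V \<in> comparable F \<Longrightarrow> r > 0 \<Longrightarrow>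
        (\<And>W. W \<in> comparable (insert V F) \<Longrightarrow> \<exists>y\<in>ball x r. \<rho> \<le> \<psi> W y) \<Longrightarrow>
        \<exists>U\<in>lmeasurable. {y\<in>ball x r. \<not> marked (insert V F) y} \<subseteq> U \<and> measure lebesgue U \<le> B * r"
    and x: "x \<in> ball c R" "\<not> marked F x"
  shows "\<exists>r U. 0 < r \<and> r \<le> 2 * R \<and> U \<in> lmeasurable \<and> {y\<in>ball x r. \<not> marked F y} \<subseteq> U \<and>
           measure lebesgue U \<le> (B + C) * (2 * r)"
proof -
  \<comment> \<open>\<open>T\<close> is bounded by \<open>2 * R\<close>: a larger ball around
    \<open>x\<close> contains \<open>ball c R\<close>, where every comparable subspace reaches
    \<open>\<rho>\<close>.\<close>
  define T where "T = {r. 0 < r \<and> (\<exists>V\<in>comparable F. \<forall>y\<in>ball x r. \<psi> V y < \<rho>)}"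
  have Tb: "r \<le> 2 * R" if r: "r \<in> T" for r
  proof (rule ccontr)
    assume nr: "\<not> r \<le> 2 * R"
    obtain V where V: "V \<in> comparable F" "\<forall>y\<in>ball x r. \<psi> V y < \<rho>" using r T_def by auto
    obtain y where y: "y \<in> ball c R" "\<rho> \<le> \<psi> V y" using sup[OF V(1)] by auto
    have "y \<in> ball x r" using y(1) x(1) nr by (auto simp: dist_real_def)
    with V(2) y(2) show False by fastforce
  qed
  have bdd: "bdd_above T" using Tb by (auto simp: bdd_above_def)
  have "\<not> (\<forall>V\<in>comparable (F \<union> {}). \<rho> \<le> \<psi> V x)"
    using x(2) F(2) unfolding marked_def by (metis ball_empty empty_subsetI sup_bot.right_neutral empty_iff)
  then obtain V0 where V0: "V0 \<in> comparable F" "\<psi> V0 x < \<rho>" by (auto simp: not_le)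
  have "open {y. \<psi> V0 y < \<rho>}"
    using V0 cont[of V0] by (intro open_Collect_less) (auto simp: comparable_def)
  then obtain r0 where "r0 > 0" "ball x r0 \<subseteq> {y. \<psi> V0 y < \<rho>}"
    using V0(2) by (meson mem_Collect_eq openE)
  then have r0: "r0 \<in> T" using V0 by (auto simp: T_def)
  then have "0 < Sup T" using cSup_upper[OF r0 bdd] by (auto simp: T_def)
  then have "Sup T / 2 < Sup T" by simp
  \<comment> \<open>More than half of the supremum: \<open>r\<close> lies in \<open>T\<close> but
    \<open>2 * r\<close> does not, so on the doubled ball every comparable subspace reaches
    \<open>\<rho>\<close>.\<close>
  then obtain r where r: "r \<in> T" "Sup T / 2 < r"
    using less_cSup_iff[of T "Sup T / 2"] r0 bdd by auto
  then obtain V where V: "V \<in> comparable F" "\<And>y. y\<in>ball x r \<Longrightarrow> \<psi> V y < \<rho>" and rpos: "r > 0"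
    by (auto simp: T_def)
  have "2 * r \<notin> T"
    using cSup_upper[OF _ bdd, of "2 * r"] r(2) by auto
  then have sup2: "\<exists>y\<in>ball x (2 * r). \<rho> \<le> \<psi> W y" if "W \<in> comparable F" for W
    using that rpos by (auto simp: T_def not_less)
  have sub: "comparable (insert V F) \<subseteq> comparable F" by (auto simp: comparable_def)
  obtain U where U: "U \<in> lmeasurable" "{y\<in>ball x (2*r). \<not> marked (insert V F) y} \<subseteq> U"
      "measure lebesgue U \<le> B * (2 * r)"
    using IH[OF V(1), of "2*r" x] sup2 sub rpos by auto
  define U' where "U' = {y\<in>ball x (2*r). \<psi> V y < \<eta>}"
  have VP: "V \<in> P" using V(1) by (auto simp: comparable_def)
  have "open (ball x (2*r) \<inter> {y. \<psi> V y < \<eta>})"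
    using cont[OF VP] by (intro open_Int open_ball open_Collect_less) auto
  also have "ball x (2*r) \<inter> {y. \<psi> V y < \<eta>} = U'" by (auto simp: U'_def)
  finally have U'm: "U' \<in> lmeasurable"
    by (intro lmeasurable_open bounded_subset[OF bounded_ball[of x "2*r"]]) (auto simp: U'_def)
  have U'b: "measure lebesgue U' \<le> C * (2 * r)"
    using good[OF VP] sup2[OF V(1)] unfolding U'_def by blast
  have "{y\<in>ball x r. \<not> marked F y} \<subseteq> U \<union> U'"
  proof
    fix y assume y: "y \<in> {y\<in>ball x r. \<not> marked F y}"
    then have y2: "y \<in> ball x (2 * r)" using rpos by auto
    show "y \<in> U \<union> U'"
    proof (cases "\<psi> V y < \<eta>")
      case True then show ?thesis using y2 by (auto simp: U'_def)
    next
      case False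
      have "\<not> marked (insert V F) y"
      proof
        assume "marked (insert V F) y"
        then obtain E where E: "E \<subseteq> P" "chain (insert V F \<union> E)" "\<forall>V\<in>E. \<eta> \<le> \<psi> V y \<and> \<psi> V y \<le> \<rho>"
            "\<forall>W\<in>comparable (insert V F \<union> E). \<rho> \<le> \<psi> W y"
          unfolding marked_def by auto
        \<comment> \<open>At \<open>y\<close> the value of \<open>V\<close> lies between
          \<open>\<eta>\<close> and \<open>\<rho>\<close>, so \<open>V\<close> may pass from the
          flag \<open>F\<close> to the controlled part \<open>E\<close>.\<close>
        have eq: "F \<union> insert V E = insert V F \<union> E" by auto
        have "marked F y" unfolding marked_def
          using E VP False V(2)[of y] y by (intro exI[of _ "insert V E"]) (auto simp: eq)
        with y show False by auto
      qed
      then show ?thesis using U(2) y2 by auto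
    qed
  qed
  moreover have "measure lebesgue (U \<union> U') \<le> (B + C) * (2 * r)"
  proof -
    have "measure lebesgue (U \<union> U') \<le> measure lebesgue U + measure lebesgue U'"
      using U(1) U'm by (intro measure_Un_le) (simp_all add: fmeasurableD)
    then show ?thesis using U(3) U'b by (simp add: distrib_right)
  qed
  ultimately show ?thesis
    using rpos Tb[OF r(1)] U(1) U'm by (intro exI[of _ r] exI[of _ "U \<union> U'"]) auto
qed

text \<open>Induction on the number \<open>n\<close> of members that \<open>F\<close> lacks to the
  maximal length. A flag of length \<open>m\<close> admits no comparable subspace, so every point is
  marked. Otherwise the local estimate provides a ball around each unmarked point, and Vitali's
  lemma selects countably many of them with controlled total length.\<close>

lemma unmarked_measure:
  assumes "F \<subseteq> P" "chain F" "card F + n = m" "R > 0"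
    and "\<And>V. V \<in> comparable F \<Longrightarrow> \<exists>y\<in>ball c R. \<rho> \<le> \<psi> V y"
  shows "\<exists>U\<in>lmeasurable. {x\<in>ball c R. \<not> marked F x} \<subseteq> U \<and> measure lebesgue U \<le> mark_const n * R"
  using assms
proof (induction n arbitrary: F c R)
  case 0
  have "comparable F = {}"
  proof (rule ccontr)
    assume "comparable F \<noteq> {}"
    then obtain V where V: "V \<in> P" "V \<notin> F" "\<forall>W\<in>F. V \<subseteq> W \<or> W \<subseteq> V" by (auto simp: comparable_def)
    have "finite (insert V F) \<and> card (insert V F) \<le> m"
      using V 0 by (intro chain_bound) (auto simp: chain_def)
    then show False using V 0 by auto
  qed
  then have "marked F x" for x
    using 0 unfolding marked_def by (intro exI[of _ "{}"]) auto
  then show ?case by (intro bexI[of _ "{}"]) auto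
next
  case (Suc n)
  let ?S = "{x\<in>ball c R. \<not> marked F x}"
  have finF: "finite F" using chain_bound[of F] Suc.prems by (auto simp: chain_def)
  have IH: "\<exists>U\<in>lmeasurable. {y\<in>ball x r. \<not> marked (insert V F) y} \<subseteq> U \<and> measure lebesgue U \<le> mark_const n * r"
    if "V \<in> comparable F" "r > 0" "\<And>W. W \<in> comparable (insert V F) \<Longrightarrow> \<exists>y\<in>ball x r. \<rho> \<le> \<psi> W y" for V x r
    using that Suc.prems finF by (intro Suc.IH) (auto simp: comparable_def chain_def)
  define good where "good x p \<longleftrightarrow> 0 < fst p \<and> fst p \<le> 2 * R \<and> snd p \<in> lmeasurable \<and>
      {y\<in>ball x (fst p). \<not> marked F y} \<subseteq> snd p \<and>
      measure lebesgue (snd p) \<le> (mark_const n + C) * (2 * fst p)" for x :: real and p :: "real \<times> real set"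
  have "\<exists>p. good x p" if x: "x \<in> ?S" for x
  proof -
    from x have "x \<in> ball c R" "\<not> marked F x" by auto
    from unmarked_local[OF Suc.prems(1,2,4,5) IH this] obtain r' U' where
      "0 < r' \<and> r' \<le> 2 * R \<and> U' \<in> lmeasurable \<and> {y\<in>ball x r'. \<not> marked F y} \<subseteq> U' \<and>
           measure lebesgue U' \<le> (mark_const n + C) * (2 * r')" by blast
    then show ?thesis unfolding good_def by (intro exI[of _ "(r', U')"]) simp
  qed
  then obtain f where f: "\<And>x. x \<in> ?S \<Longrightarrow> good x (f x)" by metis
  define r where "r x = fst (f x)" for x
  define U where "U x = snd (f x)" for x
  have rU: "0 < r x" "r x \<le> 2 * R" "U x \<in> lmeasurable" "{y\<in>ball x (r x). \<not> marked F y} \<subseteq> U x"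
           "measure lebesgue (U x) \<le> (mark_const n + C) * (2 * r x)" if "x \<in> ?S" for x
    using f[OF that] by (auto simp: good_def r_def U_def)
  obtain D where D: "countable D" "D \<subseteq> ?S"
     "pairwise (\<lambda>i j. disjnt (ball i (r i / 5)) (ball j (r j / 5))) D"
     "?S \<subseteq> (\<Union>i\<in>D. ball i (5 * (r i / 5)))"
  proof -
    have 1: "?S \<subseteq> (\<Union>i\<in>?S. ball i (r i / 5))" using rU(1) by force
    have 2: "0 < r i / 5 \<and> r i / 5 \<le> 2 * R / 5" if "i \<in> ?S" for i using rU(1,2)[OF that] by auto
    show ?thesis
      by (rule Vitali_covering_lemma_balls[where S="?S" and K="?S" and a="\<lambda>x. x" and r="\<lambda>x. r x / 5", OF 1 2])
         (assumption, rule that)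
  qed
  \<comment> \<open>A bound that is uniform over the finite subfamilies passes to the countable
    union.\<close>
  have UB: "measure lebesgue (\<Union>x\<in>D'. U x) \<le> mark_const (Suc n) * R" if D': "D' \<subseteq> D" "finite D'" for D'
  proof -
    have "(\<Sum>x\<in>D'. 2 * (r x / 5)) = (\<Sum>x\<in>D'. measure lebesgue (ball x (r x / 5)))"
      using rU(1) D'(1) D(2) by (intro sum.cong) (force simp: ball_eq_greaterThanLessThan)+
    also have "\<dots> = measure lebesgue (\<Union>x\<in>D'. ball x (r x / 5))"
      using D' D(3) by (intro measure_UNION'[symmetric]) (auto simp: pairwise_def)
    also have "\<dots> \<le> measure lebesgue (ball c (2 * R))"
    proof (rule measure_mono_fmeasurable)
      show "(\<Union>x\<in>D'. ball x (r x / 5)) \<subseteq> ball c (2 * R)"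
      proof clarify
        fix x y assume x: "x \<in> D'" and y: "y \<in> ball x (r x / 5)"
        then have xS: "x \<in> ?S" using D D' by auto
        then have "dist c x < R" by auto
        moreover have "dist x y < R" using rU(2)[OF xS] y Suc.prems(4) by auto
        ultimately show "y \<in> ball c (2 * R)" using dist_triangle[of c y x] by auto
      qed
    qed (use D' in \<open>auto intro!: sets.finite_UN\<close>)
    also have "\<dots> = 4 * R" using Suc.prems by (auto simp: ball_eq_greaterThanLessThan)
    finally have s: "(\<Sum>x\<in>D'. 2 * r x) \<le> 20 * R" by (simp add: sum_divide_distrib[symmetric])
    have "measure lebesgue (\<Union>x\<in>D'. U x) \<le> (\<Sum>x\<in>D'. measure lebesgue (U x))"
      using rU(3) D(2) D' by (intro measure_UNION_le) (auto intro!: fmeasurableD)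
    also have "\<dots> \<le> (\<Sum>x\<in>D'. (mark_const n + C) * (2 * r x))"
      using rU(5) D(2) D' by (intro sum_mono) blast
    also have "\<dots> = (mark_const n + C) * (\<Sum>x\<in>D'. 2 * r x)" by (simp add: sum_distrib_left)
    also have "\<dots> \<le> (mark_const n + C) * (20 * R)"
      using s mark_const_nonneg[of n] C_nonneg by (intro mult_left_mono) auto
    finally show ?thesis by (simp add: algebra_simps)
  qed
  have Um: "U x \<in> lmeasurable" if "x \<in> D" for x using rU(3) D(2) that by blast
  have "(\<Union>x\<in>D. U x) \<in> lmeasurable \<and> measure lebesgue (\<Union>x\<in>D. U x) \<le> mark_const (Suc n) * R"
    using fmeasurable_UN_bound[OF D(1) Um UB] measure_UN_bound[OF D(1) Um UB] by auto
  moreover have "?S \<subseteq> (\<Union>x\<in>D. U x)"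
  proof
    fix y assume y: "y \<in> ?S"
    then obtain x where "x \<in> D" "y \<in> ball x (r x)" using D(4) by auto
    then show "y \<in> (\<Union>x\<in>D. U x)" using y rU(4)[of x] D(2) by blast
  qed
  ultimately show ?case by blast
qed

end

section \<open>Gram determinants\<close>

text \<open>The squared volume of the parallelepiped spanned by \<open>L\<close>. Lists and matrices
  whose dimension is a term allow the number of vectors to vary within one type.\<close>

definition gram_det :: "'a::real_inner list \<Rightarrow> real" where
  "gram_det L = Determinant.det (mat (length L) (length L) (\<lambda>(i, j). inner (L ! i) (L ! j)))"

lemma gram_det_Nil: "gram_det [] = 1"
  by (simp add: gram_det_def)

text \<open>This is how discreteness of the lattice enters: a positive Gram determinant of lattice
  vectors is a positive integer, hence at least 1.\<close>

lemma gram_det_Ints: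
  assumes "\<And>v w. v \<in> set L \<Longrightarrow> w \<in> set L \<Longrightarrow> inner v w \<in> \<int>"
  shows "gram_det L \<in> \<int>"
proof -
  let ?n = "length L"
  define G where "G = mat ?n ?n (\<lambda>(i, j). \<lfloor>inner (L ! i) (L ! j)\<rfloor>)"
  have "map_mat real_of_int G = mat ?n ?n (\<lambda>(i, j). inner (L ! i) (L ! j))"
    using assms by (intro eq_matI) (auto simp: G_def of_int_floor_cancel)
  then have "gram_det L = real_of_int (Determinant.det G)"
    by (simp add: gram_det_def flip: of_int_hom.hom_det)
  then show ?thesis by simp
qed

lemma span_set_conv_nth:
  fixes L :: "'a::real_vector list"
  assumes "w \<in> span (set L)"
  obtains c where "w = (\<Sum>i<length L. c i *\<^sub>R L ! i)"
  using assms
proof (induction L arbitrary: w thesis)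
  case Nil
  then show ?case by (intro Nil(1)[of "\<lambda>_. 0"]) auto
next
  case (Cons a L)
  from Cons.prems(2) obtain k where "w - k *\<^sub>R a \<in> span (set L)" by (auto simp: span_insert)
  with Cons.IH obtain c where c: "w - k *\<^sub>R a = (\<Sum>i<length L. c i *\<^sub>R L ! i)" by metis
  show ?case
    by (rule Cons.prems(1)[of "\<lambda>i. case i of 0 \<Rightarrow> k | Suc i \<Rightarrow> c i"])
       (use c in \<open>simp add: sum.lessThan_Suc_shift algebra_simps del: sum.lessThan_Suc\<close>)
qed

text \<open>The first row of the Gram matrix of \<open>v # L\<close> is a combination of the other rows plus
  \<open>(inner e e, 0, \<dots>, 0)\<close>.\<close>

lemma gram_det_Cons:
  fixes L :: "'a::real_inner list"
  assumes w: "w \<in> span (set L)" and orth: "\<And>x. x \<in> set L \<Longrightarrow> inner (v - w) x = 0"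
  shows "gram_det (v # L) = inner (v - w) (v - w) * gram_det L"
proof -
  let ?n = "length L"
  define e where "e = v - w"
  obtain c where c: "w = (\<Sum>i<?n. c i *\<^sub>R L ! i)" using span_set_conv_nth[OF w] .
  define A where "A = mat (Suc ?n) (Suc ?n) (\<lambda>(i, j). inner ((v # L) ! i) ((v # L) ! j))"
  have A: "A \<in> carrier_mat (Suc ?n) (Suc ?n)" by (simp add: A_def)
  have ew: "inner e w = 0" unfolding c inner_sum_right using orth by (auto simp: e_def)
  have row0: "A $$ (0, j) = (if j = 0 then inner e e else 0) + (\<Sum>i<?n. c i * A $$ (Suc i, j))" if "j < Suc ?n"
    for j
  proof -
    have "A $$ (0, j) = inner (e + w) ((v # L) ! j)" using that by (simp add: A_def e_def)
    also have "\<dots> = inner e ((v # L) ! j) + (\<Sum>i<?n. c i * inner (L ! i) ((v # L) ! j))"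
      by (simp add: inner_add_left c inner_sum_left)
    also have "inner e ((v # L) ! j) = (if j = 0 then inner e e else 0)"
      using that orth ew by (auto simp: e_def[symmetric] nth_Cons inner_diff_right[of e v w, folded e_def] split: nat.split)
    finally show ?thesis using that by (simp add: A_def)
  qed
  \<comment> \<open>The entries of one row paired with the cofactors of another sum to zero; the sum
    is an off-diagonal entry of \<open>A * adj_mat A\<close>.\<close>
  have zero: "(\<Sum>j<Suc ?n. A $$ (Suc i, j) * cofactor A 0 j) = 0" if i: "i < ?n" for i
  proof -
    have "(A * adj_mat A) $$ (Suc i, 0) = (Determinant.det A \<cdot>\<^sub>m 1\<^sub>m (Suc ?n)) $$ (Suc i, 0)"
      using adj_mat(2)[OF A] by simp
    also have "\<dots> = 0" using i by simp
    also have "(A * adj_mat A) $$ (Suc i, 0) = (\<Sum>j<Suc ?n. A $$ (Suc i, j) * cofactor A 0 j)"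
      using i A by (simp add: scalar_prod_def adj_mat_def atLeast0LessThan)
    finally show ?thesis .
  qed
  have "Determinant.det A = (\<Sum>j<Suc ?n. A $$ (0, j) * cofactor A 0 j)"
    using laplace_expansion_row[OF A, of 0] by simp
  also have "\<dots> = (\<Sum>j<Suc ?n. (if j = 0 then inner e e else 0) * cofactor A 0 j +
      (\<Sum>i<?n. c i * (A $$ (Suc i, j) * cofactor A 0 j)))"
    by (intro sum.cong refl) (subst row0, auto simp: distrib_right sum_distrib_right mult.assoc)
  also have "\<dots> = (\<Sum>j<Suc ?n. (if j = 0 then inner e e else 0) * cofactor A 0 j) +
      (\<Sum>i<?n. c i * (\<Sum>j<Suc ?n. A $$ (Suc i, j) * cofactor A 0 j))"
    unfolding sum.distrib sum_distrib_left by (subst sum.swap[of _ "{..<?n}"]) (rule refl)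
  also have "(\<Sum>i<?n. c i * (\<Sum>j<Suc ?n. A $$ (Suc i, j) * cofactor A 0 j)) = 0"
    using zero by (intro sum.neutral) simp
  also have "(\<Sum>j<Suc ?n. (if j = 0 then inner e e else 0) * cofactor A 0 j) = inner e e * cofactor A 0 0"
    by (subst sum.remove[of _ 0]) auto
  also have "cofactor A 0 0 = gram_det L"
  proof -
    have "mat_delete A 0 0 = mat ?n ?n (\<lambda>(i, j). inner (L ! i) (L ! j))"
      by (rule eq_matI) (auto simp: mat_delete_def A_def)
    then show ?thesis by (simp add: cofactor_def gram_det_def)
  qed
  finally show ?thesis by (simp add: gram_det_def A_def e_def)
qed

section \<open>Orthonormal systems and orthogonal projection\<close>

definition orthonormal :: "'a::real_inner set \<Rightarrow> bool" where
  "orthonormal U \<longleftrightarrow> finite U \<and> (\<forall>u\<in>U. \<forall>w\<in>U. inner u w = (if u = w then 1 else 0))"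

lemma orthonormal_inner:
  assumes "orthonormal U" "u \<in> U" "w \<in> U" shows "inner u w = (if u = w then 1 else 0)"
  using assms by (auto simp: orthonormal_def)

lemma orthonormal_independent: "orthonormal U \<Longrightarrow> independent U"
  by (intro pairwise_orthogonal_independent)
     (force simp: orthonormal_def pairwise_def Linear_Algebra.orthogonal_def)+

lemma inner_normalized_self: "x \<noteq> 0 \<Longrightarrow> inner (x /\<^sub>R norm x) (x /\<^sub>R norm x) = 1"
  by (simp add: dot_square_norm power2_eq_square)

lemma orthonormal_basis_exists:
  fixes S :: "'a::real_inner set"
  assumes "finite S" obtains U where "orthonormal U" "span U = span S"
proof -
  obtain C where C: "finite C" "span C = span S" "pairwise Linear_Algebra.orthogonal C"
    using basis_orthogonal[OF assms] by auto
  define U where "U = (\<lambda>x. x /\<^sub>R norm x) ` (C - {0})"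
  have "orthonormal U"
    unfolding orthonormal_def
  proof (intro conjI ballI)
    show "finite U" using C by (simp add: U_def)
    fix a b assume "a \<in> U" "b \<in> U"
    then obtain u w where uw: "u \<in> C" "w \<in> C" "u \<noteq> 0" "w \<noteq> 0" "a = u /\<^sub>R norm u" "b = w /\<^sub>R norm w"
      by (auto simp: U_def)
    show "inner a b = (if a = b then 1 else 0)"
    proof (cases "u = w")
      case True then show ?thesis using uw inner_normalized_self[of u] by simp
    next
      case False
      then have "inner a b = 0" using uw C(3) by (auto simp: pairwise_def Linear_Algebra.orthogonal_def)
      moreover have "inner a a = 1" using uw inner_normalized_self[of u] by simp
      ultimately show ?thesis by auto
    qed
  qed
  moreover have "span U = span C"
  proof
    show "span U \<subseteq> span C"
      by (intro span_minimal) (auto simp: U_def intro!: span_scale intro: span_base)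
    show "span C \<subseteq> span U"
    proof (intro span_minimal subsetI subspace_span)
      fix x assume x: "x \<in> C"
      show "x \<in> span U"
      proof (cases "x = 0")
        case True then show ?thesis by (simp add: span_zero)
      next
        case False
        then have "norm x *\<^sub>R (x /\<^sub>R norm x) \<in> span U"
          using x by (intro span_scale span_base) (auto simp: U_def)
        then show ?thesis using False by simp
      qed
    qed
  qed
  ultimately show ?thesis using that C by auto
qed

definition proj :: "'a::real_inner set \<Rightarrow> 'a \<Rightarrow> 'a" where
  "proj U x = (\<Sum>u\<in>U. inner x u *\<^sub>R u)"

lemma proj_in_span: "proj U x \<in> span U"
  unfolding proj_def by (intro span_sum span_scale span_base)

lemma proj_orthogonal:
  assumes U: "orthonormal U" and y: "y \<in> span U" shows "inner (x - proj U x) y = 0"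
proof -
  have "inner (x - proj U x) u = 0" if u: "u \<in> U" for u
  proof -
    have "(\<Sum>w\<in>U. inner x w * inner w u) = (\<Sum>w\<in>U. if w = u then inner x u else 0)"
      using orthonormal_inner[OF U _ u] by (intro sum.cong) auto
    also have "\<dots> = inner x u" using U u by (simp add: orthonormal_def)
    finally show ?thesis by (simp add: proj_def inner_diff_left inner_sum_left)
  qed
  then have "span U \<subseteq> {y. inner (x - proj U x) y = 0}"
    by (intro span_minimal) (auto simp: subspace_def inner_add_right)
  then show ?thesis using y by auto
qed

lemma proj_inner_self: "inner x (proj U x) = (\<Sum>u\<in>U. (inner x u)^2)"
  by (simp add: proj_def inner_sum_right power2_eq_square)

text \<open>The difference of the two projections lies in the common span and is orthogonal to it.
  Sums of squared coordinates therefore do not depend on the basis, which later frees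
  \<open>\<psi>\<close> from the choice made in \<open>onb\<close>.\<close>

lemma proj_unique:
  assumes "orthonormal U" "orthonormal W" "span U = span W"
  shows "proj U x = proj W x"
proof -
  let ?d = "proj U x - proj W x"
  have d: "?d \<in> span U" using proj_in_span[of U x] proj_in_span[of W x] assms(3) by (auto intro: span_diff)
  have "inner ?d ?d = inner (x - proj W x) ?d - inner (x - proj U x) ?d"
    by (simp add: inner_diff_left)
  also have "\<dots> = 0" using proj_orthogonal[OF assms(1) d] proj_orthogonal[OF assms(2), of ?d] d assms(3)
    by simp
  finally show ?thesis by simp
qed

lemma Cauchy_Schwarz_proj:
  assumes "orthonormal U" "w \<in> span U"
  shows "(inner x w)^2 \<le> (\<Sum>u\<in>U. (inner x u)^2) * inner w w"
proof -
  have "inner x w = inner (proj U x) w"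
    using proj_orthogonal[OF assms, of x] by (simp add: inner_diff_left)
  moreover have "inner (proj U x) (proj U x) = (\<Sum>u\<in>U. (inner x u)^2)"
    using proj_orthogonal[OF assms(1) proj_in_span, of x x]
      by (simp add: inner_diff_left flip: proj_inner_self)
  ultimately show ?thesis using Cauchy_Schwarz_ineq[of "proj U x" w] by simp
qed

lemma orthonormal_insert:
  assumes U: "orthonormal U" and v: "v \<notin> span U"
  defines "e \<equiv> v - proj U v"
  shows "e \<noteq> 0" "orthonormal (insert (e /\<^sub>R norm e) U)" "span (insert (e /\<^sub>R norm e) U) = span (insert v U)"
    "e /\<^sub>R norm e \<notin> U"
proof -
  show e0: "e \<noteq> 0" using v proj_in_span[of U v] by (auto simp: e_def)
  have o: "inner e u = 0" if "u \<in> U" for u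
    unfolding e_def using that by (intro proj_orthogonal[OF U] span_base)
  show nin: "e /\<^sub>R norm e \<notin> U"
  proof
    assume "e /\<^sub>R norm e \<in> U"
    then have "inner e (e /\<^sub>R norm e) = 0" by (rule o)
    then show False using e0 by simp
  qed
  show "orthonormal (insert (e /\<^sub>R norm e) U)"
    unfolding orthonormal_def
  proof (intro conjI ballI)
    show "finite (insert (e /\<^sub>R norm e) U)" using U by (simp add: orthonormal_def)
    fix a b assume "a \<in> insert (e /\<^sub>R norm e) U" "b \<in> insert (e /\<^sub>R norm e) U"
    then consider "a = e /\<^sub>R norm e" "b = e /\<^sub>R norm e" | "a = e /\<^sub>R norm e" "b \<in> U"
      | "a \<in> U" "b = e /\<^sub>R norm e" | "a \<in> U" "b \<in> U" by auto
    then show "inner a b = (if a = b then 1 else 0)"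
    proof cases
      case 1 then show ?thesis using inner_normalized_self[OF e0] by simp
    next
      case 2 then show ?thesis using o[of b] nin by auto
    next
      case 3 then show ?thesis using o[of a] nin by (auto simp: inner_commute[of a e])
    next
      case 4 then show ?thesis using U by (auto simp: orthonormal_def)
    qed
  qed
  have ev: "e \<in> span (insert v U)"
    unfolding e_def using proj_in_span[of U v] span_mono[of U "insert v U"]
    by (intro span_diff) (auto intro: span_base)
  have "norm e *\<^sub>R (e /\<^sub>R norm e) \<in> span (insert (e /\<^sub>R norm e) U)"
    by (intro span_scale span_base) auto
  then have ein: "e \<in> span (insert (e /\<^sub>R norm e) U)" using e0 by simp
  have "v = e + proj U v" by (simp add: e_def)
  moreover have "proj U v \<in> span (insert (e /\<^sub>R norm e) U)"
    using proj_in_span[of U v] span_mono[of U "insert (e /\<^sub>R norm e) U"] by auto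
  ultimately have "v \<in> span (insert (e /\<^sub>R norm e) U)" using ein span_add by metis
  then have 1: "span (insert v U) \<subseteq> span (insert (e /\<^sub>R norm e) U)"
    by (intro span_minimal) (auto intro: span_base)
  have 2: "span (insert (e /\<^sub>R norm e) U) \<subseteq> span (insert v U)"
    using ev by (intro span_minimal) (auto intro: span_base span_scale)
  show "span (insert (e /\<^sub>R norm e) U) = span (insert v U)" using 1 2 by blast
qed

section \<open>Covolumes of lattice subspaces along a curve\<close>

text \<open>\<open>Lat\<close> stands for integer coefficient vectors, and
  \<open>inner (p s) v\<close> is the linear combination that has to stay away from zero.
  Discreteness of the lattice is expressed by integral inner products. The parameters
  \<open>A\<close> and \<open>Q\<close> weigh the value of the linear form against the size of the
  coefficients.\<close>

locale lattice_curve =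
  fixes B :: "'a::real_inner set" and Lat :: "'a set" and p :: "real \<Rightarrow> 'a" and d :: nat and A Q :: real
  assumes B: "finite B"
    and Lat_span: "Lat \<subseteq> span B"
    and Lat_Ints: "\<And>v w. v \<in> Lat \<Longrightarrow> w \<in> Lat \<Longrightarrow> inner v w \<in> \<int>"
    and p_poly: "\<And>u. \<exists>f::real poly. degree f \<le> d \<and> (\<forall>s. inner (p s) u = poly f s)"
    and A: "0 \<le> A" and Q: "0 < Q" and d: "1 \<le> d"
begin

text \<open>Positivity of the Gram determinant expresses linear independence of \<open>L\<close>.
  The zero subspace is excluded here and added by hand where the bottom of a flag is
  required.\<close>

definition subspaces :: "'a set set" where
  "subspaces = {V. \<exists>L. set L \<subseteq> Lat \<and> L \<noteq> [] \<and> gram_det L > 0 \<and> V = span (set L)}"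

text \<open>An infimum over all independent lists of lattice vectors that span \<open>V\<close>, so
  that no basis of the lattice in \<open>V\<close> has to be constructed.\<close>

definition covolume_sq :: "'a set \<Rightarrow> real" where
  "covolume_sq V = Inf {gram_det L | L. set L \<subseteq> Lat \<and> span (set L) = V \<and> gram_det L > 0}"

definition onb :: "'a set \<Rightarrow> 'a set" where
  "onb V = (SOME U. orthonormal U \<and> span U = V)"

definition height_sq :: "real \<Rightarrow> 'a \<Rightarrow> real" where
  "height_sq s v = (A * (inner (p s) v)^2 + inner v v) / Q^2"

text \<open>\<open>\<psi> V s\<close> is the squared covolume of the lattice points of \<open>V\<close> for the quadratic form \<open>height_sq s\<close>.\<close>

definition \<psi> :: "'a set \<Rightarrow> real \<Rightarrow> real" where
  "\<psi> V s = covolume_sq V * (1 + A * (\<Sum>u\<in>onb V. (inner (p s) u)^2)) / Q ^ (2 * card (onb V))"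

lemma onb: assumes "finite S" shows "orthonormal (onb (span S))" "span (onb (span S)) = span S"
proof -
  have "\<exists>U. orthonormal U \<and> span U = span S" using orthonormal_basis_exists[OF assms] by metis
  then show "orthonormal (onb (span S))" "span (onb (span S)) = span S"
    unfolding onb_def by (metis (mono_tags, lifting) someI_ex)+
qed

lemma sum_inner_basis_indep:
  assumes "orthonormal U" "orthonormal W" "span U = span W"
  shows "(\<Sum>u\<in>U. (inner x u)^2) = (\<Sum>u\<in>W. (inner x u)^2)"
  using proj_unique[OF assms, of x] by (metis proj_inner_self)

lemma card_orthonormal_le:
  assumes "orthonormal U" "orthonormal W" "span U \<subseteq> span W"
  shows "card U \<le> card W"
  using independent_span_bound[OF _ orthonormal_independent[OF assms(1)], of W] assms
  by (auto simp: orthonormal_def intro: span_base)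

lemma gram_det_ge_1:
  assumes "set L \<subseteq> Lat" "gram_det L > 0" shows "gram_det L \<ge> 1"
proof -
  have "gram_det L \<in> \<int>" using assms Lat_Ints by (intro gram_det_Ints) auto
  then obtain n where "gram_det L = of_int n" by (auto elim: Ints_cases)
  then show ?thesis using assms(2) by simp
qed

lemma covolume_sq_le:
  assumes "set L \<subseteq> Lat" "gram_det L > 0" shows "covolume_sq (span (set L)) \<le> gram_det L"
  unfolding covolume_sq_def using assms by (intro cInf_lower) (auto intro!: bdd_belowI[of _ 0])

lemma covolume_sq_greatest:
  assumes "V = span (set L0)" "set L0 \<subseteq> Lat" "gram_det L0 > 0"
    and "\<And>L. set L \<subseteq> Lat \<Longrightarrow> span (set L) = V \<Longrightarrow> gram_det L > 0 \<Longrightarrow> z \<le> gram_det L"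
  shows "z \<le> covolume_sq V"
  unfolding covolume_sq_def using assms by (intro cInf_greatest) auto

lemma covolume_sq_ge_1:
  assumes "set L \<subseteq> Lat" "gram_det L > 0" shows "1 \<le> covolume_sq (span (set L))"
  by (rule covolume_sq_greatest[OF refl assms]) (rule gram_det_ge_1)

lemma gram_det_extend:
  assumes L: "span (set L) = span U" "orthonormal U"
  shows "gram_det (v # L) = inner (v - proj U v) (v - proj U v) * gram_det L"
  using proj_in_span[of U v] proj_orthogonal[OF L(2), of _ v] L span_base[of _ "set L"]
  by (intro gram_det_Cons) auto

text \<open>A new vector multiplies a covolume by its distance from the old subspace, hence at most
  by its length. For the form \<open>height_sq s\<close> this is carried out explicitly: up to the
  scaling by \<open>Q\<close>, the factor \<open>1 + A * ...\<close> in \<open>\<psi>\<close> is the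
  determinant of the identity plus \<open>A\<close> times the rank one form given by the projected
  curve point.\<close>

lemma \<psi>_insert_le:
  assumes L: "set L \<subseteq> Lat" "gram_det L > 0" and v: "v \<in> Lat" "v \<notin> span (set L)"
  shows "gram_det (v # L) > 0"
    "\<psi> (span (set (v # L))) s \<le> \<psi> (span (set L)) s * height_sq s v"
proof -
  define V where "V = span (set L)"
  define U where "U = onb V"
  have U: "orthonormal U" "span U = V" unfolding U_def V_def using onb[of "set L"] by auto
  define e where "e = v - proj U v"
  define e1 where "e1 = e /\<^sub>R norm e"
  have vU: "v \<notin> span U" using v U by (simp add: V_def)
  note ins = orthonormal_insert[OF U(1) vU, folded e_def, folded e1_def]
  have gd: "gram_det (v # L') = inner e e * gram_det L'" if "span (set L') = V" for L'
    using gram_det_extend[of L' U v] U that by (simp add: e_def)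
  have ee: "inner e e > 0" using ins(1) by simp
  show "gram_det (v # L) > 0" using gd[of L] ee L(2) by (simp add: V_def)
  define V' where "V' = span (set (v # L))"
  define W where "W = onb V'"
  have W: "orthonormal W" "span W = V'" unfolding W_def V'_def using onb[of "set (v # L)"] by auto
  have "V' = span (insert v U)" unfolding V'_def using U(2) V_def
    by (simp add: span_insert)
  then have sp: "span W = span (insert e1 U)" using ins(3) W by simp
  have sumW: "(\<Sum>u\<in>W. (inner x u)^2) = (inner x e1)^2 + (\<Sum>u\<in>U. (inner x u)^2)" for x
    using sum_inner_basis_indep[OF W(1) ins(2) sp, of x] ins(4) U(1) by (simp add: orthonormal_def)
  have cardW: "card W = Suc (card U)"
    using card_orthonormal_le[OF W(1) ins(2)] card_orthonormal_le[OF ins(2) W(1)] sp ins(4) U(1)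
    by (simp add: orthonormal_def)
  \<comment> \<open>It suffices to extend each list of \<open>V\<close> by \<open>v\<close>; the
    Gram determinant of the extension carries the factor \<open>inner e e\<close>.\<close>
  have cov: "covolume_sq V' \<le> inner e e * covolume_sq V"
  proof -
    have "covolume_sq V' / inner e e \<le> covolume_sq V"
    proof (rule covolume_sq_greatest[OF V_def L])
      fix L' assume L': "set L' \<subseteq> Lat" "span (set L') = V" "gram_det L' > 0"
      have "V' = span (set (v # L'))" unfolding V'_def using L'(2) V_def by (simp add: span_insert)
      then have "covolume_sq V' \<le> gram_det (v # L')"
        using covolume_sq_le[of "v # L'"] L' v gd[of L'] ee by auto
      then show "covolume_sq V' / inner e e \<le> gram_det L'"
        using gd[OF L'(2)] ee by (simp add: field_simps)
    qed
    then show ?thesis using ee by (simp add: field_simps)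
  qed
  define a2 where "a2 = (\<Sum>u\<in>U. (inner (p s) u)^2)"
  define b where "b = inner (p s) e1"
  define w where "w = proj U v"
  define c where "c = inner (p s) w"
  define \<delta> where "\<delta> = norm e"
  have d2: "inner e e = \<delta>^2" by (simp add: \<delta>_def power2_norm_eq_inner)
  have \<delta>0: "\<delta> > 0" using ins(1) by (simp add: \<delta>_def)
  have a20: "a2 \<ge> 0" by (simp add: a2_def sum_nonneg)
  have "v = w + \<delta> *\<^sub>R e1" using \<delta>0 by (simp add: w_def e1_def e_def \<delta>_def)
  then have pv: "inner (p s) v = c + \<delta> * b" by (simp add: inner_add_right c_def b_def)
  have "inner e w = 0" unfolding e_def w_def by (intro proj_orthogonal[OF U(1)] proj_in_span)
  then have vv: "inner v v = inner w w + \<delta>^2"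
    unfolding d2[symmetric] by (simp add: e_def w_def[symmetric] inner_diff_left inner_diff_right inner_commute)
  have cw: "c^2 \<le> a2 * inner w w"
    unfolding c_def a2_def w_def by (intro Cauchy_Schwarz_proj U(1) proj_in_span)
  \<comment> \<open>The determinant inequality for \<open>v = w + \<delta> *\<^sub>R e1\<close>.
    After common terms cancel and \<open>c^2 \<le> a2 * inner w w\<close> is used, what remains is
    the square \<open>(c + A * a2 * (c + \<delta> * b))^2 / a2\<close>; the case
    \<open>a2 = 0\<close> forces \<open>c = 0\<close>.\<close>
  have key: "\<delta>^2 * (1 + A * (a2 + b^2)) \<le> (1 + A * a2) * (A * (c + \<delta> * b)^2 + (inner w w + \<delta>^2))"
  proof -
    have "\<delta>^2 * A * b^2 \<le> (1 + A * a2) * (A * (c + \<delta> * b)^2 + inner w w)"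
    proof -
      have "0 \<le> A * ((c + A * a2 * (c + \<delta> * b)) ^2)" using A by simp
      have 1: "A * a2 * inner w w \<ge> A * c^2" using cw A by (simp add: mult_left_mono mult.assoc)
      have "(1 + A * a2) * (A * (c + \<delta> * b)^2 + inner w w) - \<delta>^2 * A * b^2 \<ge>
         (1 + A * a2) * (A * (c + \<delta> * b)^2) + inner w w + A * c^2 - A * (\<delta> * b)^2"
        using 1 by (simp add: algebra_simps power_mult_distrib)
      moreover have "(1 + A * a2) * (A * (c + \<delta> * b)^2) + inner w w + A * c^2 - A * (\<delta> * b)^2 \<ge> 0"
      proof (cases "a2 = 0")
        case True
        then have "c = 0" using cw by simp
        then show ?thesis using True by simp
      next
        case False
        then have a2p: "a2 > 0" using a20 by simp
        have wl: "c^2 / a2 \<le> inner w w" using cw a2p by (simp add: field_simps)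
        have "0 \<le> (c + A * a2 * (c + \<delta> * b) )^2 / a2" using a2p by simp
        also have "\<dots> = c^2 / a2 + 2 * A * c * (c + \<delta> * b) + A^2 * a2 * (c + \<delta> * b)^2"
          using a2p by (simp add: field_simps power2_eq_square)
        also have "\<dots> \<le> inner w w + 2 * A * c * (c + \<delta> * b) + A^2 * a2 * (c + \<delta> * b)^2"
          using wl by simp
        also have "\<dots> = (1 + A * a2) * (A * (c + \<delta> * b)^2) + inner w w + A * c^2 - A * (\<delta> * b)^2"
          by (simp add: algebra_simps power2_eq_square)
        finally show ?thesis .
      qed
      ultimately show ?thesis by linarith
    qed
    then show ?thesis by (simp add: algebra_simps)
  qed
  have c1: "0 \<le> covolume_sq V" using covolume_sq_ge_1[OF L] by (simp add: V_def)
  have "\<psi> V' s = covolume_sq V' * (1 + A * (a2 + b^2)) / Q ^ (2 * Suc (card U))"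
    unfolding \<psi>_def W_def[symmetric] sumW cardW by (simp add: a2_def b_def add.commute)
  also have "\<dots> \<le> (\<delta>^2 * covolume_sq V) * (1 + A * (a2 + b^2)) / Q ^ (2 * Suc (card U))"
    using cov A a20 Q by (intro divide_right_mono mult_right_mono) (auto simp: d2)
  also have "\<dots> = covolume_sq V * (\<delta>^2 * (1 + A * (a2 + b^2))) / Q ^ (2 * Suc (card U))" by simp
  also have "\<dots> \<le> covolume_sq V * ((1 + A * a2) * (A * (c + \<delta> * b)^2 +
    (inner w w + \<delta>^2))) / Q ^ (2 * Suc (card U))"
    using key c1 Q by (intro divide_right_mono mult_left_mono) auto
  also have "\<dots> = \<psi> V s * height_sq s v"
    unfolding \<psi>_def U_def[symmetric] a2_def[symmetric] height_sq_def pv vv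
    by (simp add: a2_def[symmetric] power_add power2_eq_square mult.commute mult.left_commute)
  finally show "\<psi> (span (set (v # L))) s \<le> \<psi> (span (set L)) s * height_sq s v"
    by (simp add: V_def V'_def)
qed

lemma subspacesE:
  assumes "V \<in> subspaces"
  obtains L where "set L \<subseteq> Lat" "L \<noteq> []" "gram_det L > 0" "V = span (set L)"
    "orthonormal (onb V)" "span (onb V) = V"
  using assms onb[of "set _"] unfolding subspaces_def by auto

lemma subspaces_insert:
  assumes "V \<in> insert {0} subspaces" "v \<in> Lat" "v \<notin> V"
  shows "span (insert v V) \<in> subspaces" "\<psi> (span (insert v V)) s \<le> \<psi> V s * height_sq s v"
proof -
  obtain L where L: "set L \<subseteq> Lat" "gram_det L > 0" "V = span (set L)"
  proof (cases "V = {0}")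
    case True then show ?thesis by (intro that[of "[]"]) (auto simp: gram_det_Nil)
  next
    case False then show ?thesis using assms(1) that by (auto elim: subspacesE)
  qed
  have "span (insert v V) = span (set (v # L))" using L(3) by (simp add: span_insert span_span)
  then show "span (insert v V) \<in> subspaces" "\<psi> (span (insert v V)) s \<le> \<psi> V s * height_sq s v"
    using \<psi>_insert_le(1)[OF L(1,2), of v] \<psi>_insert_le(2)[OF L(1,2), of v s] assms L unfolding subspaces_def
    by (auto intro!: exI[of _ "v # L"])
qed

lemma card_onb_less:
  assumes "V \<in> subspaces" "W \<in> subspaces" "V \<subset> W" shows "card (onb V) < card (onb W)"
proof -
  obtain V': "orthonormal (onb V)" "span (onb V) = V" using assms(1) by (auto elim: subspacesE)
  obtain W': "orthonormal (onb W)" "span (onb W) = W" using assms(2) by (auto elim: subspacesE)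
  obtain w where w: "w \<in> W" "w \<notin> V" using assms(3) by auto
  have "independent (insert w (onb V))"
    using orthonormal_independent[OF V'(1)] w V'(2) by (auto simp: independent_insert)
  moreover have "insert w (onb V) \<subseteq> span (onb W)"
    using w W'(2) assms(3) V'(2) span_superset[of "onb V"] by auto
  ultimately have "card (insert w (onb V)) \<le> card (onb W)"
    using independent_span_bound[of "onb W"] W' by (auto simp: orthonormal_def)
  moreover have "w \<notin> onb V" using w V'(2) span_base by metis
  ultimately show ?thesis using V'(1) by (simp add: orthonormal_def)
qed

lemma card_onb_bounds:
  assumes "V \<in> subspaces" shows "1 \<le> card (onb V)" "card (onb V) \<le> card B"
proof -
  obtain L where L: "set L \<subseteq> Lat" "L \<noteq> []" "gram_det L > 0" "V = span (set L)"
    and V': "orthonormal (onb V)" "span (onb V) = V" using assms by (auto elim: subspacesE)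
  have "onb V \<noteq> {}"
  proof
    assume "onb V = {}"
    then have V0: "V = {0}" using V'(2) by simp
    obtain a L' where L': "L = a # L'" using L(2) by (cases L) auto
    have "set L \<subseteq> {0}" using V0 L(4) span_superset by metis
    then have "a = 0" using L' by auto
    then have "gram_det L = 0"
      using gram_det_Cons[of 0 L' 0] L' by (simp add: span_zero)
    then show False using L(3) by simp
  qed
  then show "1 \<le> card (onb V)" using V'(1) by (simp add: orthonormal_def Suc_le_eq card_gt_0_iff)
  have "onb V \<subseteq> span B"
    using V'(2) span_superset[of "onb V"] L(1,4) Lat_span span_minimal[of "set L" "span B"] by auto
  then show "card (onb V) \<le> card B"
    using independent_span_bound[OF B orthonormal_independent[OF V'(1)]] by simp
qed

text \<open>Dimension increases strictly along proper inclusion, so it embeds a chain into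
  \<open>{1..card B}\<close>.\<close>

lemma chain_finite:
  assumes F: "F \<subseteq> subspaces" and ch: "\<forall>V\<in>F. \<forall>W\<in>F. V \<subseteq> W \<or> W \<subseteq> V"
  shows "finite F \<and> card F \<le> card B"
proof -
  have inj: "inj_on (\<lambda>V. card (onb V)) F"
  proof (rule inj_onI)
    fix V W assume VW: "V \<in> F" "W \<in> F" "card (onb V) = card (onb W)"
    then show "V = W" using card_onb_less[of V W] card_onb_less[of W V] F ch
      by (metis less_irrefl psubsetI subsetD)
  qed
  have sub: "(\<lambda>V. card (onb V)) ` F \<subseteq> {1..card B}" using card_onb_bounds F by auto
  have "card F \<le> card {1..card B}" by (rule card_inj_on_le[OF inj sub]) simp
  moreover have "finite F" by (rule inj_on_finite[OF inj sub]) simp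
  ultimately show ?thesis by simp
qed

lemma \<psi>_poly:
  assumes "V \<in> subspaces" shows "\<exists>f. degree f \<le> 2 * d \<and> \<psi> V = poly f"
proof -
  obtain V': "orthonormal (onb V)" using assms by (auto elim: subspacesE)
  obtain f where f: "\<And>u. degree (f u) \<le> d" "\<And>u s. inner (p s) u = poly (f u) s"
    using p_poly by metis
  define g where "g = Polynomial.smult (covolume_sq V / Q ^ (2 * card (onb V))) (1 +
    Polynomial.smult A (\<Sum>u\<in>onb V. (f u)^2))"
  have "degree (\<Sum>u\<in>onb V. (f u)^2) \<le> 2 * d"
  proof (rule degree_sum_le)
    show "finite (onb V)" using V' by (simp add: orthonormal_def)
    show "degree ((f u)^2) \<le> 2 * d" for u
      using degree_power_le[of "f u" 2] f(1)[of u] by linarith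
  qed
  then have "degree g \<le> 2 * d" unfolding g_def
    by (intro order_trans[OF degree_smult_le] degree_add_le) auto
  moreover have "\<psi> V = poly g"
    by (rule ext) (simp add: g_def \<psi>_def poly_sum f(2))
  ultimately show ?thesis by blast
qed

lemma \<psi>_nonneg: "V \<in> subspaces \<Longrightarrow> 0 \<le> \<psi> V s"
  using covolume_sq_ge_1 Q A unfolding \<psi>_def
  by (elim subspacesE) (force intro!: divide_nonneg_pos mult_nonneg_nonneg add_nonneg_nonneg sum_nonneg)

lemma \<psi>_zero: "0 \<le> \<psi> {0} s" "\<psi> {0} s \<le> 1"
proof -
  have o: "orthonormal (onb {0})" "span (onb {0}) = {0}" using onb[of "{}"] by auto
  have "u = 0" if "u \<in> onb {0}" for u using o(2) that span_base by force
  then have "onb {0} = {}" using o(1) by (force simp: orthonormal_def)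
  then have "\<psi> {0} s = covolume_sq {0}" by (simp add: \<psi>_def)
  moreover have "covolume_sq {0} \<le> 1" "0 \<le> covolume_sq {0}"
    using covolume_sq_le[of "[]"] covolume_sq_ge_1[of "[]"] by (auto simp: gram_det_Nil)
  ultimately show "0 \<le> \<psi> {0} s" "\<psi> {0} s \<le> 1" by auto
qed

text \<open>At a marked point every nonzero lattice vector \<open>v\<close> is long. Let
  \<open>V\<close> be the largest flag member, or \<open>{0}\<close>, that misses \<open>v\<close>.
  The span of \<open>V\<close> and \<open>v\<close> fits into the flag, so its value is at least
  \<open>\<eta>\<close>; by submultiplicativity it is at most
  \<open>\<psi> V s * height_sq s v\<close>, and \<open>\<psi> V s \<le> 1\<close>. The unmarked
  points are covered by the flag argument.\<close>

theorem nondivergence: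
  assumes R: "R > 0" and \<eta>: "0 < \<eta>" "\<eta> \<le> \<rho>" "\<rho> \<le> 1" and Q1: "1 \<le> Q" and AQ: "A = Q ^ (2 * card B)"
    and sup: "\<And>u. u \<in> span B \<Longrightarrow> norm u = 1 \<Longrightarrow> \<exists>y\<in>ball c R. \<rho> \<le> (inner (p y) u)^2"
  shows "\<exists>U\<in>lmeasurable. {s\<in>ball c R. \<exists>v\<in>Lat - {0}. height_sq s v < \<eta>} \<subseteq> U \<and>
     measure lebesgue U \<le> 40 ^ card B * (4 * (2 * real d + 1)^2) * (\<eta>/\<rho>) powr (1 / (2 * real d)) * R"
proof -
  define C where "C = 4 * (2 * real d + 1)^2 * (\<eta>/\<rho>) powr (1 / (2 * real d))"
  interpret marking_setup subspaces \<psi> "card B" \<eta> \<rho> C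
  proof
    fix F assume "F \<subseteq> subspaces" "\<forall>V\<in>F. \<forall>W\<in>F. V \<subseteq> W \<or> W \<subseteq> V"
    then show "finite F \<and> card F \<le> card B" by (rule chain_finite)
  next
    fix V assume "V \<in> subspaces"
    then obtain f where "\<psi> V = poly f" using \<psi>_poly by blast
    then show "continuous_on UNIV (\<psi> V)" by (simp add: continuous_intros)
  next
    fix V c R y assume V: "V \<in> subspaces" and y: "y \<in> ball c R" "\<rho> \<le> \<psi> V y"
    obtain f where f: "degree f \<le> 2 * d" "\<psi> V = poly f" using \<psi>_poly[OF V] by blast
    have "{x\<in>ball c R. \<psi> V x < \<eta>} = {x\<in>ball c R. \<bar>poly f x\<bar> < \<eta>}"
      using \<psi>_nonneg[OF V] f(2) by auto
    also have "measure lebesgue \<dots> \<le> 4 * (real (2*d) + 1)^2 * (\<eta>/\<rho>) powr (1 / real (2*d)) * R"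
      using y f \<eta> d by (intro polynomial_sublevel_measure[of f _ _ _ y]) auto
    finally show "measure lebesgue {x\<in>ball c R. \<psi> V x < \<eta>} \<le> C * R" by (simp add: C_def)
  next
    show "0 \<le> C" by (simp add: C_def)
  qed
  \<comment> \<open>The choice \<open>A = Q ^ (2 * card B)\<close> lets \<open>A\<close> dominate
    the denominator of \<open>\<psi>\<close> in every dimension at once. A single unit vector of
    \<open>V\<close> at which the curve is large then suffices, since covolumes are at least
    1.\<close>
  have supV: "\<exists>y\<in>ball c R. \<rho> \<le> \<psi> V y" if "V \<in> comparable {}" for V
  proof -
    have V: "V \<in> subspaces" using that by (simp add: comparable_def)
    obtain L where L: "set L \<subseteq> Lat" "gram_det L > 0" "V = span (set L)"
      and V': "orthonormal (onb V)" "span (onb V) = V" using V by (auto elim: subspacesE)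
    obtain u where u: "u \<in> onb V" using card_onb_bounds(1)[OF V] by fastforce
    have "norm u = 1" using u V'(1) by (auto simp: orthonormal_def norm_eq_1)
    moreover have "u \<in> span B"
      using u V'(2) span_superset[of "onb V"] L(1,3) Lat_span span_minimal[of "set L" "span B"] by auto
    ultimately obtain y where y: "y \<in> ball c R" "\<rho> \<le> (inner (p y) u)^2" using sup by blast
    have "(inner (p y) u)^2 \<le> (\<Sum>u\<in>onb V. (inner (p y) u)^2)"
      using u V'(1) by (intro member_le_sum) (auto simp: orthonormal_def)
    then have "\<rho> \<le> (\<Sum>u\<in>onb V. (inner (p y) u)^2)" (is "_ \<le> ?S") using y by simp
    also have "?S = 1 * (0 + Q ^ (2 * card (onb V)) * ?S) / Q ^ (2 * card (onb V))"
      using Q by simp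
    also have "\<dots> \<le> \<psi> V y" unfolding \<psi>_def
    proof (intro divide_right_mono mult_mono add_mono)
      show "1 \<le> covolume_sq V" using covolume_sq_ge_1[OF L(1,2)] L(3) by simp
      then show "0 \<le> covolume_sq V" by simp
      show "Q ^ (2 * card (onb V)) \<le> A" unfolding AQ
        using Q1 card_onb_bounds(2)[OF V] by (intro power_increasing) auto
      show "0 \<le> 0 + Q ^ (2 * card (onb V)) * ?S" using Q by (auto intro!: mult_nonneg_nonneg sum_nonneg)
    qed (use Q A in \<open>auto intro!: sum_nonneg\<close>)
    finally show ?thesis using y by auto
  qed
  have "chain {}" by (simp add: chain_def)
  then obtain U where U: "U \<in> lmeasurable" "{x\<in>ball c R. \<not> marked {} x} \<subseteq> U"
      "measure lebesgue U \<le> mark_const (card B) * R"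
    using unmarked_measure[of "{}" "card B" R c] supV R by auto
  \<comment> \<open>The summand -1 absorbs the \<open>C\<close> that the recursion adds in each
    step.\<close>
  have mc: "mark_const n \<le> C * (40 ^ n - 1)" for n
  proof (induction n)
    case (Suc n)
    have "mark_const (Suc n) \<le> 20 * (C * (40 ^ n - 1) + C)" using Suc by simp
    also have "\<dots> = C * (20 * 40 ^ n)" by (simp add: algebra_simps)
    also have "\<dots> \<le> C * (40 ^ Suc n - 1)"
    proof (rule mult_left_mono)
      have "(1::real) \<le> 40 ^ n" by simp
      then show "20 * 40 ^ n \<le> (40::real) ^ Suc n - 1" unfolding power_Suc by linarith
    qed (rule C_nonneg)
    finally show ?case .
  qed simp
  have hs: "\<eta> \<le> height_sq s v" if mk: "marked {} s" and v: "v \<in> Lat - {0}" for s v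
  proof -
    obtain E where E: "E \<subseteq> subspaces" "chain E" "\<forall>V\<in>E. \<eta> \<le> \<psi> V s \<and> \<psi> V s \<le> \<rho>"
        "\<forall>V\<in>comparable E. \<rho> \<le> \<psi> V s"
      using mk unfolding marked_def by auto
    have finE: "finite E" using chain_finite[of E] E by (auto simp: chain_def)
    define X where "X = {W \<in> insert {0} E. v \<notin> W}"
    have "finite X" "{0} \<in> X" using finE v by (auto simp: X_def)
    then obtain V where V: "V \<in> X" "\<And>W. W \<in> X \<Longrightarrow> V \<subseteq> W \<Longrightarrow> V = W"
      using finite_has_maximal[of X] by blast
    have subsp: "subspace W" if "W \<in> insert {0} E" for W
      using that E(1) by (auto elim!: subspacesE intro: subspace_span subspace_single_0)
    have V0: "V \<in> insert {0} subspaces" "v \<notin> V" using V(1) E(1) by (auto simp: X_def)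
    note ins = subspaces_insert(1)[OF V0(1) _ V0(2)] subspaces_insert(2)[OF V0(1) _ V0(2), of s]
    define V' where "V' = span (insert v V)"
    have V'P: "V' \<in> subspaces" and V'le: "\<psi> V' s \<le> \<psi> V s * height_sq s v"
      using ins v by (auto simp: V'_def)
    \<comment> \<open>Flag members that contain \<open>v\<close> contain \<open>V\<close> and hence
      \<open>V'\<close>; the others lie below \<open>V\<close> by maximality.\<close>
    have cmp: "V' \<subseteq> W \<or> W \<subseteq> V'" if W: "W \<in> E" for W
    proof -
      have VW: "V \<subseteq> W \<or> W \<subseteq> V"
      proof (cases "V = {0}")
        case True then show ?thesis using subspace_0[OF subsp, of W] W by auto
      next
        case False then show ?thesis using V(1) W E(2) by (auto simp: X_def chain_def)
      qed
      show ?thesis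
      proof (cases "v \<in> W")
        case True
        then have "V \<subseteq> W" using VW V0(2) by auto
        then have "V' \<subseteq> W" unfolding V'_def using True subsp[of W] W by (intro span_minimal) auto
        then show ?thesis ..
      next
        case False
        then have "W \<subseteq> V" using VW V(2)[of W] W by (auto simp: X_def)
        moreover have "V \<subseteq> V'" unfolding V'_def using span_superset by blast
        ultimately show ?thesis by blast
      qed
    qed
    have "\<eta> \<le> \<psi> V' s"
    proof (cases "V' \<in> E")
      case True then show ?thesis using E(3) by auto
    next
      case False
      then have "V' \<in> comparable E" using V'P cmp by (auto simp: comparable_def)
      then show ?thesis using E(4) \<eta> by force
    qed
    also have "\<dots> \<le> \<psi> V s * height_sq s v" by (rule V'le)
    also have "\<dots> \<le> 1 * height_sq s v"
    proof (rule mult_right_mono)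
      show "\<psi> V s \<le> 1" using V(1) E(3) \<eta> \<psi>_zero by (fastforce simp: X_def)
      show "0 \<le> height_sq s v" using A by (simp add: height_sq_def)
    qed
    finally show ?thesis by simp
  qed
  have "{s\<in>ball c R. \<exists>v\<in>Lat - {0}. height_sq s v < \<eta>} \<subseteq> {x\<in>ball c R. \<not> marked {} x}"
    using hs by (force simp: not_le[symmetric])
  then have sub: "{s\<in>ball c R. \<exists>v\<in>Lat - {0}. height_sq s v < \<eta>} \<subseteq> U" using U(2) by blast
  have "mark_const (card B) * R \<le> C * 40 ^ card B * R"
    using mc[of "card B"] C_nonneg R by (intro mult_right_mono order_trans[OF mc] mult_left_mono) auto
  then have "measure lebesgue U \<le> 40 ^ card B * (4 * (2 * real d + 1)^2) * (\<eta>/\<rho>) powr (1 / (2 * real d)) * R"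
    using U(3) by (simp add: C_def mult.commute mult.left_commute)
  then show ?thesis using U(1) sub by blast
qed

end

section \<open>Diophantine approximation by monomials\<close>

text \<open>The number of monomials is a term that varies within the proof, so no single type
  \<open>real ^ 'm\<close> holds all coefficient vectors. Finitely supported sequences form one
  inner product space that contains every finite dimension.\<close>

typedef fin_seq = "{f :: nat \<Rightarrow> real. finite {i. f i \<noteq> 0}}" morphisms coord Fin_seq
  by (intro exI[of _ "\<lambda>_. 0"]) simp

lemma finite_coord: "finite {i. coord x i \<noteq> 0}"
  using coord by auto

lemma coord_Fin_seq: "finite {i. f i \<noteq> 0} \<Longrightarrow> coord (Fin_seq f) = f"
  by (simp add: Fin_seq_inverse)

lemma fin_seq_eqI: "(\<And>i. coord x i = coord y i) \<Longrightarrow> x = y"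
  by (metis coord_inject ext)

instantiation fin_seq :: real_inner
begin

definition "0 = Fin_seq (\<lambda>_. 0)"
definition "x + y = Fin_seq (\<lambda>i. coord x i + coord y i)"
definition "- x = Fin_seq (\<lambda>i. - coord x i)"
definition "x - y = Fin_seq (\<lambda>i. coord x i - coord y i)"
definition "c *\<^sub>R x = Fin_seq (\<lambda>i. c * coord x i)"
definition "inner x y = (\<Sum>i | coord x i \<noteq> 0. coord x i * coord y i)"
definition "norm (x::fin_seq) = sqrt (inner x x)"
definition "dist (x::fin_seq) y = norm (x - y)"
definition "sgn (x::fin_seq) = Fin_seq (\<lambda>i. inverse (norm x) * coord x i)"
definition [code del]: "(uniformity :: (fin_seq \<times> fin_seq) filter) =
  (INF e\<in>{0 <..}. principal {(x, y). dist x y < e})"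
definition [code del]: "open (U :: fin_seq set) = (\<forall>x\<in>U. eventually (\<lambda>(x', y). x' = x \<longrightarrow> y \<in> U) uniformity)"

lemma coord_simps [simp]:
  "coord 0 i = 0" "coord (x + y) i = coord x i + coord y i" "coord (- x) i = - coord x i"
  "coord (x - y) i = coord x i - coord y i" "coord (c *\<^sub>R x) i = c * coord x i"
proof -
  have "finite {i. coord x i + coord y i \<noteq> 0}" "finite {i. coord x i - coord y i \<noteq> 0}"
    by (rule finite_subset[OF _ finite_UnI[OF finite_coord[of x] finite_coord[of y]]], force)+
  moreover have "finite {i. - coord x i \<noteq> 0}" "finite {i. c * coord x i \<noteq> 0}"
    by (rule finite_subset[OF _ finite_coord[of x]], force)+
  ultimately show "coord 0 i = 0" "coord (x + y) i = coord x i + coord y i" "coord (- x) i = - coord x i"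
  "coord (x - y) i = coord x i - coord y i" "coord (c *\<^sub>R x) i = c * coord x i"
    unfolding zero_fin_seq_def plus_fin_seq_def uminus_fin_seq_def minus_fin_seq_def scaleR_fin_seq_def
    by (subst coord_Fin_seq; simp)+
qed

lemma inner_fin_seq_superset:
  assumes "finite I" "\<And>i. i \<notin> I \<Longrightarrow> coord x i = 0"
  shows "inner x y = (\<Sum>i\<in>I. coord x i * coord y i)"
  unfolding inner_fin_seq_def using assms by (intro sum.mono_neutral_left) auto

instance
proof
  fix a b c :: fin_seq and r s :: real
  show "a + b + c = a + (b + c)" "a + b = b + a" "0 + a = a" "- a + a = 0" "a - b = a + - b"
    "r *\<^sub>R (a + b) = r *\<^sub>R a + r *\<^sub>R b" "(r + s) *\<^sub>R a = r *\<^sub>R a + s *\<^sub>R a"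
    "r *\<^sub>R s *\<^sub>R a = (r * s) *\<^sub>R a" "1 *\<^sub>R a = a"
    by (rule fin_seq_eqI, simp add: algebra_simps)+
  show "dist a b = norm (a - b)" "sgn a = inverse (norm a) *\<^sub>R a" "norm a = sqrt (inner a a)"
    by (simp_all add: dist_fin_seq_def sgn_fin_seq_def norm_fin_seq_def scaleR_fin_seq_def)
  show "uniformity = (INF e\<in>{0 <..}. principal {(x::fin_seq, y). dist x y < e})"
    by (rule uniformity_fin_seq_def)
  show "open U = (\<forall>x\<in>U. eventually (\<lambda>(x', y). x' = x \<longrightarrow> y \<in> U) uniformity)" for U :: "fin_seq set"
    by (rule open_fin_seq_def)
  let ?I = "{i. coord a i \<noteq> 0} \<union> {i. coord b i \<noteq> 0}"
  have I: "finite ?I" using finite_coord by simp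
  have ex: "inner x y = (\<Sum>i\<in>?I. coord x i * coord y i)"
    if "\<And>i. coord a i = 0 \<Longrightarrow> coord b i = 0 \<Longrightarrow> coord x i = 0" for x y
    using that by (intro inner_fin_seq_superset I) auto
  show "inner a b = inner b a" by (subst (1 2) ex) (auto simp: mult.commute)
  show "inner (a + b) c = inner a c + inner b c"
    by (subst (1 2 3) ex) (auto simp: distrib_right sum.distrib)
  show "inner (r *\<^sub>R a) b = r * inner a b"
    by (subst (1 2) ex) (auto simp: sum_distrib_left mult.assoc)
  show "0 \<le> inner a a" by (auto simp: inner_fin_seq_def intro: sum_nonneg)
  show "inner a a = 0 \<longleftrightarrow> a = 0"
  proof
    assume "inner a a = 0"
    then have "\<forall>i\<in>{i. coord a i \<noteq> 0}. coord a i * coord a i = 0"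
      unfolding inner_fin_seq_def using finite_coord by (subst (asm) sum_nonneg_eq_0_iff) auto
    then show "a = 0" by (intro fin_seq_eqI) auto
  qed (simp add: inner_fin_seq_def)
qed

end

section \<open>Linear combinations of polynomials of distinct degrees\<close>

text \<open>The coefficient is a divided difference: interpolation at \<open>N + 1\<close> fixed
  points of the ball makes it a fixed linear combination of values of \<open>f\<close>.\<close>

lemma leading_coeff_bound:
  assumes R: "R > 0"
  shows "\<exists>K\<ge>0. \<forall>f S. degree f \<le> N \<longrightarrow> (\<forall>y\<in>ball c R. \<bar>poly f y\<bar> \<le> S) \<longrightarrow> \<bar>coeff f N\<bar> \<le> K * (S::real)"
proof -
  have "infinite (ball c R)" using R by (simp add: ball_eq_greaterThanLessThan infinite_Ioo)
  then obtain X where X: "X \<subseteq> ball c R" "finite X" "card X = Suc N"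
    using infinite_arbitrarily_large by blast
  define w where "w a = (\<Prod>b\<in>X-{a}. (a - b))" for a
  have "\<bar>coeff f N\<bar> \<le> (\<Sum>a\<in>X. 1 / \<bar>w a\<bar>) * S"
    if f: "degree f \<le> N" "\<forall>y\<in>ball c R. \<bar>poly f y\<bar> \<le> S" for f S
  proof -
    define g where "g = (\<Sum>a\<in>X. Polynomial.smult (poly f a / w a) (\<Prod>b\<in>X-{a}. [:-b, 1:]))"
    have deg: "degree (\<Prod>b\<in>X-{a}. [:-b, 1:]) = N" if "a \<in> X" for a
      using X that by (subst degree_prod_eq_sum_degree) auto
    have dg: "degree g \<le> N" unfolding g_def using deg X
      by (intro degree_sum_le) (auto intro: order_trans[OF degree_smult_le])
    have "f = g"
    proof (rule poly_eqI_degree[of X])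
      fix x assume "x \<in> X"
      then show "poly f x = poly g x"
        using lagrange_interpolation[of X f x] X f
        by (simp add: g_def poly_sum poly_prod prod_dividef w_def)
    qed (use X f dg in auto)
    then have "coeff f N = coeff g N" by simp
    moreover have "coeff (\<Prod>b\<in>X-{a}. [:-b, 1:]) N = 1" if "a \<in> X" for a
      using lead_coeff_prod[of "\<lambda>b. [:-b, 1:]" "X-{a}"] deg[OF that] by simp
    ultimately have "coeff f N = (\<Sum>a\<in>X. poly f a / w a)"
      by (simp add: g_def coeff_sum)
    also have "\<bar>\<dots>\<bar> \<le> (\<Sum>a\<in>X. \<bar>poly f a / w a\<bar>)" by (rule sum_abs)
    also have "\<dots> \<le> (\<Sum>a\<in>X. 1 / \<bar>w a\<bar> * S)"
      using X f by (intro sum_mono) (auto simp: abs_divide intro!: divide_right_mono)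
    finally show ?thesis by (simp add: sum_distrib_right)
  qed
  then show ?thesis by (intro exI[of _ "\<Sum>a\<in>X. 1 / \<bar>w a\<bar>"]) (auto intro!: sum_nonneg)
qed

text \<open>Quantitative linear independence, by removal of the summand of largest degree: its
  coefficient is visible in the leading coefficient of the whole sum, and subtracting it leaves a
  sum of the same kind whose bound has grown by a constant factor.\<close>

lemma coefficient_bound_distinct_degrees:
  fixes pp :: "'b \<Rightarrow> real poly"
  assumes R: "R > 0" and X: "finite X" "inj_on (\<lambda>i. degree (pp i)) X" "\<And>i. i \<in> X \<Longrightarrow> pp i \<noteq> 0"
  shows "\<exists>K\<ge>0. \<forall>u S. (\<forall>y\<in>ball c R. \<bar>\<Sum>i\<in>X. u i * poly (pp i) y\<bar> \<le> S) \<longrightarrow> (\<forall>i\<in>X. \<bar>u i\<bar> \<le> K * S)"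
  using X
proof (induction X rule: finite_ranking_induct[where f = "\<lambda>i. degree (pp i)"])
  case empty
  then show ?case by auto
next
  case (insert x X)
  show ?case
  proof (cases "x \<in> X")
    case True then show ?thesis using insert by (simp add: insert_absorb)
  next
    case False
    define N where "N = degree (pp x)"
    from insert obtain K where K: "K \<ge> 0"
      "\<And>u S. (\<forall>y\<in>ball c R. \<bar>\<Sum>i\<in>X. u i * poly (pp i) y\<bar> \<le> S) \<Longrightarrow> (\<forall>i\<in>X. \<bar>u i\<bar> \<le> K * S)" by auto
    obtain K1 where K1: "K1 \<ge> 0"
      "\<And>f S. degree f \<le> N \<Longrightarrow> (\<forall>y\<in>ball c R. \<bar>poly f y\<bar> \<le> S) \<Longrightarrow> \<bar>coeff f N\<bar> \<le> K1 * S"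
      using leading_coeff_bound[OF R, of N c] by blast
    have "bounded (poly (pp x) ` cball c R)"
      by (intro compact_imp_bounded compact_continuous_image continuous_intros) simp
    then obtain M where M: "M > 0" "\<And>y. y \<in> cball c R \<Longrightarrow> \<bar>poly (pp x) y\<bar> \<le> M"
      by (auto simp: bounded_pos)
    define l where "l = lead_coeff (pp x)"
    have l0: "l \<noteq> 0" using insert by (simp add: l_def)
    define K2 where "K2 = K1 / \<bar>l\<bar>"
    have lt: "degree (pp i) < N" if "i \<in> X" for i
      using insert.hyps(2)[OF that] insert.prems(1) that False
      by (auto simp: N_def order.order_iff_strict inj_on_def)
    have main: "\<bar>u x\<bar> \<le> K2 * S \<and> (\<forall>i\<in>X. \<bar>u i\<bar> \<le> K * (1 + K2 * M) * S)"
      if S: "\<forall>y\<in>ball c R. \<bar>\<Sum>i\<in>insert x X. u i * poly (pp i) y\<bar> \<le> S" for u S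
    proof -
      define f where "f = (\<Sum>i\<in>insert x X. Polynomial.smult (u i) (pp i))"
      have pf: "poly f y = (\<Sum>i\<in>insert x X. u i * poly (pp i) y)" for y
        by (simp add: f_def poly_sum)
      have "degree f \<le> N" unfolding f_def
        by (intro degree_sum_le order_trans[OF degree_smult_le])
           (use insert.hyps lt in \<open>auto simp: N_def less_imp_le\<close>)
      then have "\<bar>coeff f N\<bar> \<le> K1 * S" using S by (intro K1) (auto simp: pf)
      moreover have "coeff f N = u x * l"
      proof -
        have "(\<Sum>i\<in>X. u i * coeff (pp i) N) = 0"
          using lt by (intro sum.neutral) (auto simp: coeff_eq_0)
        then show ?thesis using False insert.hyps by (simp add: f_def coeff_sum l_def N_def)
      qed
      ultimately have ux: "\<bar>u x\<bar> \<le> K2 * S" using l0 by (simp add: K2_def abs_mult field_simps)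
      have "\<bar>\<Sum>i\<in>X. u i * poly (pp i) y\<bar> \<le> (1 + K2 * M) * S" if y: "y \<in> ball c R" for y
      proof -
        have "\<bar>u x * poly (pp x) y\<bar> \<le> (K2 * S) * M"
          unfolding abs_mult using ux M(2)[of y] y M(1) by (intro mult_mono) auto
        moreover have "\<bar>u x * poly (pp x) y + (\<Sum>i\<in>X. u i * poly (pp i) y)\<bar> \<le> S"
          using S y False insert.hyps by simp
        ultimately show ?thesis by (simp add: algebra_simps)
      qed
      then have "\<forall>i\<in>X. \<bar>u i\<bar> \<le> K * ((1 + K2 * M) * S)" by (intro K(2)) auto
      then show ?thesis using ux by (simp add: mult.assoc)
    qed
    have K20: "K2 \<ge> 0" using K1 by (simp add: K2_def)
    show ?thesis
    proof (intro exI[of _ "K2 + K * (1 + K2 * M)"] conjI allI impI ballI)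
      have k2: "0 \<le> K * (1 + K2 * M)" using K K20 M by simp
      then show "0 \<le> K2 + K * (1 + K2 * M)" using K20 by simp
      fix u S i assume S: "\<forall>y\<in>ball c R. \<bar>\<Sum>i\<in>insert x X. u i * poly (pp i) y\<bar> \<le> S" and i: "i \<in> insert x X"
      have "0 \<le> \<bar>\<Sum>i\<in>insert x X. u i * poly (pp i) c\<bar>" by simp
      also have "\<dots> \<le> S" using S R by force
      finally have S0: "0 \<le> S" .
      have "K2 * S \<le> (K2 + K * (1 + K2 * M)) * S" "K * (1 + K2 * M) * S \<le> (K2 + K * (1 + K2 * M)) * S"
        using k2 K20 S0 by (intro mult_right_mono; simp)+
      then show "\<bar>u i\<bar> \<le> (K2 + K * (1 + K2 * M)) * S" using main[OF S] i by fastforce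
    qed
  qed
qed

definition unit_seq :: "nat \<Rightarrow> fin_seq" where
  "unit_seq i = Fin_seq (\<lambda>j. if j = i then 1 else 0)"

lemma coord_unit_seq [simp]: "coord (unit_seq i) j = (if j = i then 1 else 0)"
  unfolding unit_seq_def by (subst coord_Fin_seq) auto

lemma coord_sum: "coord (\<Sum>i\<in>I. f i) j = (\<Sum>i\<in>I. coord (f i) j)"
  by (induction I rule: infinite_finite_induct) auto

lemma fin_seq_expand:
  assumes "\<And>i. i \<ge> m \<Longrightarrow> coord v i = 0"
  shows "v = (\<Sum>i<m. coord v i *\<^sub>R unit_seq i)"
proof (rule fin_seq_eqI)
  fix j
  have "coord (\<Sum>i<m. coord v i *\<^sub>R unit_seq i) j = (\<Sum>i<m. if i = j then coord v j else 0)"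
    unfolding coord_sum by (intro sum.cong) auto
  also have "\<dots> = coord v j" using assms[of j] by auto
  finally show "coord v j = coord (\<Sum>i<m. coord v i *\<^sub>R unit_seq i) j" by simp
qed

lemma span_unit_seq:
  assumes "v \<in> span (unit_seq ` {..<m})" shows "i \<ge> m \<Longrightarrow> coord v i = 0"
proof -
  have "span (unit_seq ` {..<m}) \<subseteq> {v. \<forall>i\<ge>m. coord v i = 0}"
    by (intro span_minimal) (auto simp: subspace_def)
  then show "i \<ge> m \<Longrightarrow> coord v i = 0" using assms by auto
qed

lemma inner_fin_seq_lessThan:
  assumes "\<And>i. i \<ge> m \<Longrightarrow> coord v i = 0"
  shows "inner v w = (\<Sum>i<m. coord v i * coord w i)"
  using assms by (intro inner_fin_seq_superset) auto

definition poly_curve :: "nat \<Rightarrow> (nat \<Rightarrow> real poly) \<Rightarrow> real \<Rightarrow> fin_seq" where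
  "poly_curve m pp s = (\<Sum>i<m. poly (pp i) s *\<^sub>R unit_seq i)"

lemma inner_poly_curve: "inner (poly_curve m pp s) v = (\<Sum>i<m. coord v i * poly (pp i) s)"
proof -
  have c: "coord (poly_curve m pp s) i = (if i < m then poly (pp i) s else 0)" for i
  proof -
    have "coord (poly_curve m pp s) i = (\<Sum>j<m. if j = i then poly (pp i) s else 0)"
      unfolding poly_curve_def coord_sum by (intro sum.cong) auto
    then show ?thesis by simp
  qed
  show ?thesis by (subst inner_fin_seq_lessThan[of m]) (auto simp: c mult.commute)
qed

definition int_points :: "nat \<Rightarrow> fin_seq set" where
  "int_points m = {v. (\<forall>i. coord v i \<in> \<int>) \<and> (\<forall>i\<ge>m. coord v i = 0)}"

lemma lattice_curve_poly_curve:
  assumes "0 \<le> A" "0 < Q" "1 \<le> d" "\<And>i. i < m \<Longrightarrow> degree (pp i) \<le> d"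
  shows "lattice_curve (unit_seq ` {..<m}) (int_points m) (poly_curve m pp) d A Q"
proof
  show "finite (unit_seq ` {..<m})" by simp
  show "int_points m \<subseteq> span (unit_seq ` {..<m})"
  proof
    fix v assume "v \<in> int_points m"
    then have "v = (\<Sum>i<m. coord v i *\<^sub>R unit_seq i)"
      by (intro fin_seq_expand) (simp add: int_points_def)
    also have "\<dots> \<in> span (unit_seq ` {..<m})" by (intro span_sum span_scale span_base) auto
    finally show "v \<in> span (unit_seq ` {..<m})" .
  qed
  show "inner v w \<in> \<int>" if "v \<in> int_points m" "w \<in> int_points m" for v w
    using that by (subst inner_fin_seq_lessThan[of m]) (auto simp: int_points_def)
  show "\<exists>f::real poly. degree f \<le> d \<and> (\<forall>s. inner (poly_curve m pp s) u = poly f s)" for u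
    by (intro exI[of _ "\<Sum>i<m. Polynomial.smult (coord u i) (pp i)"])
       (use assms in \<open>auto simp: inner_poly_curve poly_sum intro!: degree_sum_le order_trans[OF degree_smult_le]\<close>)
qed (use assms in auto)

lemma card_unit_seq: "card (unit_seq ` {..<m}) = m"
proof -
  have "inj_on unit_seq {..<m}"
    by (rule inj_onI) (metis coord_unit_seq zero_neq_one)
  then show ?thesis by (simp add: card_image)
qed

text \<open>Small values on the whole ball would force every coordinate of \<open>u\<close> to be at
  most \<open>K * sqrt \<rho>\<close>, and \<open>\<rho>\<close> is chosen so that this contradicts
  norm 1. The lemma supplies the hypothesis \<open>sup\<close> of
  \<open>nondivergence\<close>.\<close>

lemma unit_functional_lower_bound:
  assumes R: "R > 0" and pp: "inj_on (\<lambda>i. degree (pp i)) {..<m}" "\<And>i. i < m \<Longrightarrow> pp i \<noteq> 0"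
  shows "\<exists>\<rho>>0. \<rho> \<le> 1 \<and> (\<forall>u \<in> span (unit_seq ` {..<m}). norm u = 1 \<longrightarrow>
    (\<exists>y\<in>ball c R. \<rho> \<le> (inner (poly_curve m pp y) u)^2))"
proof -
  obtain K where K: "K \<ge> 0" "\<And>u S. (\<forall>y\<in>ball c R. \<bar>\<Sum>i<m. u i * poly (pp i) y\<bar> \<le> S) \<Longrightarrow> (\<forall>i<m. \<bar>u i\<bar> \<le> K * S)"
    using coefficient_bound_distinct_degrees[OF R, of "{..<m}" pp c] pp by auto
  define \<rho> where "\<rho> = 1 / (real m * K^2 + 1)"
  have den: "real m * K^2 + 1 > 0" by (simp add: add_nonneg_pos)
  have \<rho>0: "\<rho> > 0" "\<rho> \<le> 1" using den by (auto simp: \<rho>_def)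
  moreover have "\<exists>y\<in>ball c R. \<rho> \<le> (inner (poly_curve m pp y) u)^2"
    if u: "u \<in> span (unit_seq ` {..<m})" "norm u = 1" for u
  proof (rule ccontr)
    assume "\<not> ?thesis"
    then have "\<bar>inner (poly_curve m pp y) u\<bar> \<le> sqrt \<rho>" if "y \<in> ball c R" for y
      using that by (intro real_le_rsqrt) (auto simp: not_le less_imp_le)
    then have "\<forall>y\<in>ball c R. \<bar>\<Sum>i<m. coord u i * poly (pp i) y\<bar> \<le> sqrt \<rho>"
      by (simp add: inner_poly_curve)
    then have ci: "\<forall>i<m. \<bar>coord u i\<bar> \<le> K * sqrt \<rho>" by (rule K(2))
    have "1 = inner u u" using u(2) by (simp add: norm_eq_1)
    also have "\<dots> = (\<Sum>i<m. (coord u i)^2)"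
      by (subst inner_fin_seq_lessThan[OF span_unit_seq[OF u(1)]]) (auto simp: power2_eq_square)
    also have "\<dots> \<le> (\<Sum>i<m. K^2 * \<rho>)"
    proof (rule sum_mono)
      fix i assume "i \<in> {..<m}"
      then have "\<bar>coord u i\<bar>^2 \<le> (K * sqrt \<rho>)^2" using ci by (intro power_mono) auto
      then show "(coord u i)^2 \<le> K^2 * \<rho>" using \<rho>0 by (simp add: power_mult_distrib)
    qed
    also have "\<dots> = (real m * K^2) / (real m * K^2 + 1)" by (simp add: \<rho>_def)
    also have "\<dots> < 1" using den by simp
    finally show False by simp
  qed
  ultimately show ?thesis by blast
qed

text \<open>The exceptional set of one dyadic scale. The quadratic form is balanced so that a
  coefficient vector of size \<open>2 ^ i\<close> with an exceptionally small value has a height of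
  order \<open>2 powr (- 2 * i * \<gamma>)\<close>, and non-divergence turns this into a measure
  bound that is geometric in \<open>i\<close>.\<close>

lemma small_values_measure:
  assumes m: "m \<ge> 1" and R: "R > 0"
    and pp: "inj_on (\<lambda>i. degree (pp i)) {..<m}" "\<And>i. i < m \<Longrightarrow> pp i \<noteq> 0" and e: "e > 0"
  shows "\<exists>K \<theta> i0 U. 0 < \<theta> \<and> \<theta> < 1 \<and> (\<forall>i\<ge>i0. U i \<in> lmeasurable \<and> measure lebesgue (U i) \<le> K * \<theta> ^ i \<and>
     (\<forall>s\<in>ball c R. \<forall>q::nat \<Rightarrow> int. (\<exists>j<m. q j \<noteq> 0) \<longrightarrow> (\<forall>j<m. \<bar>q j\<bar> \<le> 2 ^ i) \<longrightarrow>
        \<bar>\<Sum>j<m. real_of_int (q j) * poly (pp j) s\<bar> < 2 powr (- real i * (real m - 1 + e)) \<longrightarrow> s \<in> U i))"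
proof -
  obtain \<rho> where \<rho>: "0 < \<rho>" "\<rho> \<le> 1"
    "\<And>u. u \<in> span (unit_seq ` {..<m}) \<Longrightarrow> norm u = 1 \<Longrightarrow> (\<exists>y\<in>ball c R. \<rho> \<le> (inner (poly_curve m pp y) u)^2)"
    using unit_functional_lower_bound[OF R pp, of c] by blast
  define d where "d = Suc (Max (insert 0 ((\<lambda>i. degree (pp i)) ` {..<m})))"
  have d: "d \<ge> 1" "\<And>i. i < m \<Longrightarrow> degree (pp i) \<le> d" by (auto simp: d_def intro!: le_SucI Max_ge)
  \<comment> \<open>With \<open>m * \<gamma> = e\<close> the scaled value
    \<open>Q ^ (m - 1) * 2 powr (- i * (m - 1 + e))\<close> and the scaled coefficient size
    \<open>2 ^ i / Q\<close> are both equal to \<open>2 powr (- i * \<gamma>)\<close>. The ratio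
    \<open>\<theta>\<close> comes from the \<open>2 * d\<close>-th root of the square of this
    decay.\<close>
  define \<gamma> where "\<gamma> = e / real m"
  have \<gamma>: "\<gamma> > 0" using m e by (simp add: \<gamma>_def)
  define \<theta> where "\<theta> = 2 powr (- \<gamma> / real d)"
  define Q where "Q i = 2 powr (real i * (1 + \<gamma>))" for i :: nat
  \<comment> \<open>The coefficients contribute \<open>m\<close> and the value of the form
    contributes 1; \<open>m + 2\<close> makes the comparison strict.\<close>
  define \<eta> where "\<eta> i = (real m + 2) * 2 powr (- 2 * real i * \<gamma>)" for i :: nat
  have \<theta>: "0 < \<theta>" "\<theta> < 1" using \<gamma> d by (auto simp: \<theta>_def powr_less_one divide_neg_pos)
  define K where "K = 40 ^ m * (4 * (2 * real d + 1)^2) * ((real m + 2)/\<rho>) powr (1 / (2 * real d)) * R"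
  have "filterlim (\<lambda>i. (real m + 2) * 2 powr (- 2 * real i * \<gamma>)) (nhds 0) sequentially"
    using \<gamma> by real_asymp
  then have "\<forall>\<^sub>F i in sequentially. \<eta> i < \<rho>"
    unfolding \<eta>_def using \<rho>(1) by (rule order_tendstoD)
  then obtain i0 where i0: "\<And>i. i \<ge> i0 \<Longrightarrow> \<eta> i < \<rho>" by (auto simp: eventually_sequentially)
  define P where "P i U \<longleftrightarrow> U \<in> lmeasurable \<and> measure lebesgue U \<le> K * \<theta> ^ i \<and>
     (\<forall>s\<in>ball c R. \<forall>q::nat \<Rightarrow> int. (\<exists>j<m. q j \<noteq> 0) \<longrightarrow> (\<forall>j<m. \<bar>q j\<bar> \<le> 2 ^ i) \<longrightarrow>
        \<bar>\<Sum>j<m. real_of_int (q j) * poly (pp j) s\<bar> < 2 powr (- real i * (real m - 1 + e)) \<longrightarrow> s \<in> U)" for i U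
  have ex: "\<exists>U. P i U" if i: "i \<ge> i0" for i
  proof -
    have Q1: "1 \<le> Q i" using \<gamma> by (simp add: Q_def ge_one_powr_ge_zero)
    have \<eta>0: "0 < \<eta> i" by (simp add: \<eta>_def)
    interpret lattice_curve "unit_seq ` {..<m}" "int_points m" "poly_curve m pp" d "Q i ^ (2 * m)" "Q i"
      using Q1 d by (intro lattice_curve_poly_curve) auto
    have AQ: "Q i ^ (2 * m) = Q i ^ (2 * card (unit_seq ` {..<m}))" by (simp add: card_unit_seq)
    have "\<exists>U\<in>lmeasurable. {s\<in>ball c R. \<exists>v\<in>int_points m - {0}. height_sq s v < \<eta> i} \<subseteq> U \<and>
      measure lebesgue U \<le> 40 ^ m * (4 * (2 * real d + 1)^2) * (\<eta> i/\<rho>) powr (1 / (2 * real d)) * R"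
      by (rule nondivergence[OF R \<eta>0 less_imp_le[OF i0[OF i]] \<rho>(2) Q1 AQ, unfolded card_unit_seq]) (rule \<rho>(3))
    then obtain U where U: "U \<in> lmeasurable"
      "{s\<in>ball c R. \<exists>v\<in>int_points m - {0}. height_sq s v < \<eta> i} \<subseteq> U"
      "measure lebesgue U \<le> 40 ^ m * (4 * (2 * real d + 1)^2) * (\<eta> i/\<rho>) powr (1 / (2 * real d)) * R"
      by (elim bexE conjE)
    have "(\<eta> i/\<rho>) powr (1 / (2 * real d)) =
      ((real m + 2)/\<rho>) powr (1 / (2 * real d)) * (2 powr (- 2 * real i * \<gamma>)) powr (1 / (2 * real d))"
      using \<rho>(1) by (simp add: \<eta>_def flip: powr_mult)
    also have "(2 powr (- 2 * real i * \<gamma>)) powr (1 / (2 * real d)) = \<theta> ^ i"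
      using d by (simp add: \<theta>_def powr_powr field_simps flip: powr_realpow)
    finally have mu: "measure lebesgue U \<le> K * \<theta> ^ i" using U(3) by (simp add: K_def mult_ac)
    have "s \<in> U" if s: "s \<in> ball c R" and q: "\<exists>j<m. q j \<noteq> 0" "\<forall>j<m. \<bar>q j\<bar> \<le> 2 ^ i"
      and sm: "\<bar>\<Sum>j<m. real_of_int (q j) * poly (pp j) s\<bar> < 2 powr (- real i * (real m - 1 + e))" for s
        and q :: "nat \<Rightarrow> int"
    proof -
      define v where "v = (\<Sum>j<m. real_of_int (q j) *\<^sub>R unit_seq j)"
      have cv: "coord v j = (if j < m then real_of_int (q j) else 0)" for j
      proof -
        have "coord v j = (\<Sum>k<m. if k = j then real_of_int (q j) else 0)"
          unfolding v_def coord_sum by (intro sum.cong) auto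
        then show ?thesis by simp
      qed
      have v: "v \<in> int_points m - {0}"
      proof -
        obtain j where "j < m" "q j \<noteq> 0" using q(1) by blast
        then have "coord v j \<noteq> coord 0 j" by (simp add: cv)
        then have "v \<noteq> 0" by auto
        then show ?thesis by (auto simp: int_points_def cv)
      qed
      have pv: "inner (poly_curve m pp s) v = (\<Sum>j<m. real_of_int (q j) * poly (pp j) s)"
        by (simp add: inner_poly_curve cv)
      have vv: "inner v v \<le> real m * (2 ^ i)^2"
      proof -
        have "inner v v = (\<Sum>j<m. (real_of_int (q j))^2)"
          by (subst inner_fin_seq_lessThan[of m]) (auto simp: cv power2_eq_square)
        also have "\<dots> \<le> (\<Sum>j<m. (2 ^ i)^2)"
        proof (rule sum_mono)
          fix j assume "j \<in> {..<m}"
          then have "\<bar>real_of_int (q j)\<bar> \<le> 2 ^ i"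
            using q(2) by (metis lessThan_iff of_int_abs of_int_le_iff of_int_numeral of_int_power)
          then have "\<bar>real_of_int (q j)\<bar>^2 \<le> (2 ^ i)^2" by (intro power_mono) auto
          then show "(real_of_int (q j))^2 \<le> (2 ^ i)^2" by simp
        qed
        finally show ?thesis by simp
      qed
      have Qp: "Q i ^ k = 2 powr (real k * (real i * (1 + \<gamma>)))" for k
        unfolding Q_def by (simp add: powr_realpow[symmetric] powr_powr mult_ac)
      have two: "(2::real) ^ i = 2 powr real i" by (simp add: powr_realpow)
      have mg: "real m * \<gamma> = e" using m by (simp add: \<gamma>_def)
      have "height_sq s v < \<eta> i"
      proof -
        have "(inner (poly_curve m pp s) v)^2 \<le> (2 powr (- real i * (real m - 1 + e)))^2"
          using sm unfolding pv by (intro power2_le_iff_abs_le[THEN iffD2]) auto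
        also have "\<dots> = 2 powr (- 2 * real i * (real m - 1 + e))"
          by (simp add: power2_eq_square mult.assoc flip: powr_add)
        finally have "Q i ^ (2 * m) * (inner (poly_curve m pp s) v)^2 / Q i ^ 2 \<le>
            Q i ^ (2 * m) * 2 powr (- 2 * real i * (real m - 1 + e)) / Q i ^ 2"
          using Q1 by (intro divide_right_mono mult_left_mono) auto
        also have "\<dots> = 2 powr (2 * real m * (real i * (1 + \<gamma>)) - 2 * real i * (real m - 1 +
          e) - 2 * (real i * (1 + \<gamma>)))"
          unfolding Qp by (simp add: powr_diff powr_minus divide_simps flip: powr_add)
        also have "2 * real m * (real i * (1 + \<gamma>)) - 2 * real i * (real m - 1 + e) - 2 * (real i * (1 + \<gamma>)) =
          - 2 * real i * \<gamma>"
          unfolding mg[symmetric] by (simp add: algebra_simps)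
        finally have 1: "Q i ^ (2 * m) * (inner (poly_curve m pp s) v)^2 / Q i ^ 2 \<le>
          2 powr (- 2 * real i * \<gamma>)" .
        have "inner v v / Q i ^ 2 \<le> real m * (2 ^ i)^2 / Q i ^ 2"
          using vv Q1 by (intro divide_right_mono) auto
        also have "\<dots> = real m * 2 powr (2 * real i - 2 * (real i * (1 + \<gamma>)))"
          unfolding Qp two by (simp add: powr_diff power2_eq_square flip: powr_add)
        also have "2 * real i - 2 * (real i * (1 + \<gamma>)) = - 2 * real i * \<gamma>" by (simp add: algebra_simps)
        finally have 2: "inner v v / Q i ^ 2 \<le> real m * 2 powr (- 2 * real i * \<gamma>)" .
        have "height_sq s v \<le> (real m + 1) * 2 powr (- 2 * real i * \<gamma>)"
          using 1 2 unfolding height_sq_def by (simp add: add_divide_distrib algebra_simps)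
        also have "\<dots> < \<eta> i" by (simp add: \<eta>_def)
        finally show ?thesis .
      qed
      then show ?thesis using U(2) s v by blast
    qed
    then have "P i U" using U(1) mu unfolding P_def by (intro conjI ballI allI impI)
    then show ?thesis ..
  qed
  define U where "U i = (SOME U. P i U)" for i
  have "P i (U i)" if "i \<ge> i0" for i unfolding U_def by (rule someI_ex[OF ex[OF that]])
  then have "\<forall>i\<ge>i0. P i (U i)" by blast
  then show ?thesis using \<theta> unfolding P_def
    by - (rule exI[of _ K], rule exI[of _ \<theta>], rule exI[of _ i0], rule exI[of _ U], intro conjI)
qed

section \<open>Badly approximable tuples\<close>

definition badly_approximable :: "'b set \<Rightarrow> ('b \<Rightarrow> real) \<Rightarrow> real \<Rightarrow> bool" where
  "badly_approximable B x e \<longleftrightarrow> (\<exists>c>0. \<forall>Q\<ge>1. \<forall>q::'b \<Rightarrow> int.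
     (\<exists>b\<in>B. q b \<noteq> 0) \<longrightarrow> (\<forall>b\<in>B. real_of_int \<bar>q b\<bar> \<le> Q) \<longrightarrow>
     c * Q powr (- (real (card B) - 1) - e) \<le> \<bar>\<Sum>b\<in>B. real_of_int (q b) * x b\<bar>)"

text \<open>With \<open>E = card B - 1 + e\<close>, rounding \<open>Q\<close> up to a power of two
  costs at most one factor \<open>2 powr E\<close>, and raising the scale by \<open>i0\<close> to
  make it admissible costs \<open>i0\<close> more; hence the \<open>Suc i0\<close> in the
  constant.\<close>

lemma badly_approximableI_dyadic:
  assumes B: "finite B" "B \<noteq> {}" and e: "e > 0"
    and i0: "\<And>i q. i \<ge> (i0::nat) \<Longrightarrow> (\<exists>b\<in>B. (q::'b\<Rightarrow>int) b \<noteq> 0) \<Longrightarrow> (\<forall>b\<in>B. \<bar>q b\<bar> \<le> 2 ^ i) \<Longrightarrow>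
       2 powr (- real i * (real (card B) - 1 + e)) \<le> \<bar>\<Sum>b\<in>B. real_of_int (q b) * x b\<bar>"
  shows "badly_approximable B x e"
  unfolding badly_approximable_def
proof (intro exI[of _ "2 powr (- real (Suc i0) * (real (card B) - 1 + e))"] conjI allI impI)
  have card: "card B \<ge> 1" using B by (simp add: Suc_le_eq card_gt_0_iff)
  define E where "E = real (card B) - 1 + e"
  have E: "E > 0" using card e by (simp add: E_def)
  fix Q :: real and q :: "'b \<Rightarrow> int"
  assume Q: "1 \<le> Q" and q: "\<exists>b\<in>B. q b \<noteq> 0" "\<forall>b\<in>B. real_of_int \<bar>q b\<bar> \<le> Q"
  define k where "k = nat \<lceil>log 2 Q\<rceil>"
  have l0: "0 \<le> log 2 Q" using Q by simp
  have k1: "log 2 Q \<le> real k" "real k \<le> log 2 Q + 1" using l0 unfolding k_def by linarith+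
  have Qk: "Q \<le> 2 ^ k" using k1(1) Q by (simp add: log_le_iff powr_realpow)
  have "2 powr (- real (k + i0) * E) \<le> \<bar>\<Sum>b\<in>B. real_of_int (q b) * x b\<bar>" unfolding E_def
  proof (rule i0[OF _ q(1)])
    show "\<forall>b\<in>B. \<bar>q b\<bar> \<le> 2 ^ (k + i0)"
    proof
      fix b assume "b \<in> B"
      then have "real_of_int \<bar>q b\<bar> \<le> Q" using q(2) by blast
      also have "\<dots> \<le> 2 ^ k" by (rule Qk)
      also have "\<dots> \<le> 2 ^ (k + i0)" by (intro power_increasing) auto
      finally have "real_of_int \<bar>q b\<bar> \<le> real_of_int (2 ^ (k + i0))" by simp
      then show "\<bar>q b\<bar> \<le> 2 ^ (k + i0)" by (simp only: of_int_le_iff)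
    qed
  qed simp
  moreover have "2 powr (- real (Suc i0) * E) * Q powr (- E) \<le> 2 powr (- real (k + i0) * E)"
  proof -
    have "Q powr (- E) = 2 powr (log 2 Q * (- E))" using Q by (simp add: powr_def log_def)
    then have "2 powr (- real (Suc i0) * E) * Q powr (- E) = 2 powr (- (real (Suc i0) + log 2 Q) * E)"
      by (simp add: algebra_simps flip: powr_add)
    also have "\<dots> \<le> 2 powr (- real (k + i0) * E)"
      using k1(2) E by (intro powr_mono mult_right_mono) auto
    finally show ?thesis .
  qed
  ultimately show "2 powr (- real (Suc i0) * (real (card B) - 1 + e)) * Q powr (- (real (card B) - 1) - e) \<le>
    \<bar>\<Sum>b\<in>B. real_of_int (q b) * x b\<bar>"
    by (simp add: E_def algebra_simps)
qed simp

text \<open>On each ball the exceptional sets of the scales \<open>2 ^ i\<close> have summable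
  measure, so by Borel-Cantelli almost every parameter avoids all but finitely many of them. Balls
  of integer radius exhaust the line.\<close>

lemma AE_poly_badly_approximable_nat:
  fixes pp :: "nat \<Rightarrow> real poly"
  assumes m: "m \<ge> 1" and pp: "inj_on (\<lambda>i. degree (pp i)) {..<m}" "\<And>i. i < m \<Longrightarrow> pp i \<noteq> 0" and e: "e > 0"
  shows "AE s in lborel. badly_approximable {..<m} (\<lambda>i. poly (pp i) s) e"
proof -
  have ball: "AE s in lborel. s \<in> ball 0 (real (Suc n)) \<longrightarrow> badly_approximable {..<m} (\<lambda>i. poly (pp i) s) e"
    for n
  proof -
    have R: "0 < real (Suc n)" by simp
    have "\<exists>K \<theta> i0 U. 0 < \<theta> \<and> \<theta> < 1 \<and> (\<forall>i\<ge>i0. U i \<in> lmeasurable \<and> measure lebesgue (U i) \<le> K * \<theta> ^ i \<and>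
     (\<forall>s\<in>ball 0 (real (Suc n)). \<forall>q::nat \<Rightarrow> int. (\<exists>j<m. q j \<noteq> 0) \<longrightarrow> (\<forall>j<m. \<bar>q j\<bar> \<le> 2 ^ i) \<longrightarrow>
        \<bar>\<Sum>j<m. real_of_int (q j) * poly (pp j) s\<bar> < 2 powr (- real i * (real m - 1 + e)) \<longrightarrow> s \<in> U i))"
      by (rule small_values_measure[OF m R pp(1) _ e, of 0]) (rule pp(2))
    then obtain K \<theta> i0 U where \<theta>: "0 < \<theta>" "\<theta> < 1" and *:
      "(\<forall>i\<ge>i0. U i \<in> lmeasurable \<and> measure lebesgue (U i) \<le> K * \<theta> ^ i \<and>
     (\<forall>s\<in>ball 0 (real (Suc n)). \<forall>q::nat \<Rightarrow> int. (\<exists>j<m. q j \<noteq> 0) \<longrightarrow> (\<forall>j<m. \<bar>q j\<bar> \<le> 2 ^ i) \<longrightarrow>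
        \<bar>\<Sum>j<m. real_of_int (q j) * poly (pp j) s\<bar> < 2 powr (- real i * (real m - 1 + e)) \<longrightarrow> s \<in> U i))"
      by (elim exE conjE)
    have U: "U i \<in> lmeasurable" "measure lebesgue (U i) \<le> K * \<theta> ^ i"
        "s\<in>ball 0 (real (Suc n)) \<Longrightarrow> (\<exists>j<m. q j \<noteq> 0) \<Longrightarrow> (\<forall>j<m. \<bar>q j\<bar> \<le> 2 ^ i) \<Longrightarrow>
        \<bar>\<Sum>j<m. real_of_int (q j) * poly (pp j) s\<bar> < 2 powr (- real i * (real m - 1 + e)) \<Longrightarrow> s \<in> U i"
      if "i \<ge> i0" for i s and q :: "nat \<Rightarrow> int"
      using *[rule_format, OF that] by blast+
    define A where "A i = (if i \<ge> i0 then U i else {})" for i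
    have "AE s in lebesgue. eventually (\<lambda>i. s \<in> space lebesgue - A i) sequentially"
    proof (rule borel_cantelli_AE1)
      show "A i \<in> sets lebesgue" for i using U(1) by (auto simp: A_def fmeasurableD)
      show "emeasure lebesgue (A i) < \<infinity>" for i using U(1)[of i] by (auto simp: A_def fmeasurable_def)
      show "summable (\<lambda>i. measure lebesgue (A i))"
      proof (rule summable_comparison_test')
        show "summable (\<lambda>i. \<bar>K\<bar> * \<theta> ^ i)" using \<theta> by (intro summable_mult summable_geometric) auto
        show "norm (measure lebesgue (A i)) \<le> \<bar>K\<bar> * \<theta> ^ i" if "i \<ge> 0" for i
        proof (cases "i \<ge> i0")
          case True
          have "K * \<theta> ^ i \<le> \<bar>K\<bar> * \<theta> ^ i" using \<theta> by (intro mult_right_mono) auto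
          then show ?thesis using U(2)[OF True] True by (simp add: A_def)
        next
          case False then show ?thesis using \<theta> by (simp add: A_def)
        qed
      qed
    qed
    then have "AE s in lborel. eventually (\<lambda>i. s \<in> space lebesgue - A i) sequentially"
      by (simp only: AE_completion_iff)
    then show ?thesis
    proof (rule AE_mp, intro AE_I2 impI)
      fix s assume ev: "eventually (\<lambda>i. s \<in> space lebesgue - A i) sequentially" and s:
        "s \<in> ball 0 (real (Suc n))"
      obtain i1 where i1: "\<And>i. i \<ge> i1 \<Longrightarrow> s \<notin> A i" using ev by (auto simp: eventually_sequentially)
      show "badly_approximable {..<m} (\<lambda>i. poly (pp i) s) e"
      proof (rule badly_approximableI_dyadic[of _ _ "max i0 i1"])
        fix i and q :: "nat \<Rightarrow> int"
        assume i: "max i0 i1 \<le> i" and q: "\<exists>b\<in>{..<m}. q b \<noteq> 0" "\<forall>b\<in>{..<m}. \<bar>q b\<bar> \<le> 2 ^ i"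
        have "s \<notin> U i" using i1[of i] i by (simp add: A_def)
        then have "\<not> \<bar>\<Sum>j<m. real_of_int (q j) * poly (pp j) s\<bar> < 2 powr (- real i * (real m - 1 + e))"
          using U(3)[of i s q] i s q by auto
        then show "2 powr (- real i * (real (card {..<m}) - 1 + e)) \<le>
          \<bar>\<Sum>b<m. real_of_int (q b) * poly (pp b) s\<bar>"
          by simp
      qed (use m e in \<open>auto simp: lessThan_empty_iff\<close>)
    qed
  qed
  have "AE s in lborel. \<forall>n. s \<in> ball 0 (real (Suc n)) \<longrightarrow> badly_approximable {..<m} (\<lambda>i. poly (pp i) s) e"
    using ball by (subst AE_all_countable) auto
  then show ?thesis
  proof (rule AE_mp, intro AE_I2 impI)
    fix s assume *: "\<forall>n. s \<in> ball 0 (real (Suc n)) \<longrightarrow> badly_approximable {..<m} (\<lambda>i. poly (pp i) s) e"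
    obtain n where "\<bar>s\<bar> < real n" using reals_Archimedean2 by blast
    then have "s \<in> ball 0 (real (Suc n))" by simp
    with * show "badly_approximable {..<m} (\<lambda>i. poly (pp i) s) e" by blast
  qed
qed

lemma badly_approximable_reindex:
  assumes f: "bij_betw f A B" and x: "badly_approximable A (\<lambda>a. x (f a)) e"
  shows "badly_approximable B x e"
proof -
  have c: "card A = card B" using f by (rule bij_betw_same_card)
  obtain c0 where c0: "c0 > 0" "\<And>Q q. Q \<ge> 1 \<Longrightarrow> (\<exists>a\<in>A. (q::_\<Rightarrow>int) a \<noteq> 0) \<Longrightarrow> (\<forall>a\<in>A. real_of_int \<bar>q a\<bar> \<le> Q) \<Longrightarrow>
     c0 * Q powr (- (real (card A) - 1) - e) \<le> \<bar>\<Sum>a\<in>A. real_of_int (q a) * x (f a)\<bar>"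
    using x unfolding badly_approximable_def by blast
  show ?thesis unfolding badly_approximable_def
  proof (intro exI[of _ c0] conjI allI impI)
    fix Q :: real and q :: "_ \<Rightarrow> int"
    assume Q: "1 \<le> Q" and q: "\<exists>b\<in>B. q b \<noteq> 0" "\<forall>b\<in>B. real_of_int \<bar>q b\<bar> \<le> Q"
    have "(\<Sum>b\<in>B. real_of_int (q b) * x b) = (\<Sum>a\<in>A. real_of_int (q (f a)) * x (f a))"
      using sum.reindex_bij_betw[OF f, of "\<lambda>b. real_of_int (q b) * x b"] by simp
    moreover have "\<exists>a\<in>A. q (f a) \<noteq> 0" "\<forall>a\<in>A. real_of_int \<bar>q (f a)\<bar> \<le> Q"
      using q f unfolding bij_betw_def by auto
    ultimately show "c0 * Q powr (- (real (card B) - 1) - e) \<le> \<bar>\<Sum>b\<in>B. real_of_int (q b) * x b\<bar>"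
      using c0(2)[OF Q, of "\<lambda>a. q (f a)"] c by simp
  qed (rule c0)
qed

lemma AE_poly_badly_approximable:
  assumes B: "finite B" "B \<noteq> {}" and pp: "inj_on (\<lambda>b. degree (pp b)) B" "\<And>b. b \<in> B \<Longrightarrow> pp b \<noteq> 0" and e: "e > 0"
  shows "AE s in lborel. badly_approximable B (\<lambda>b. poly (pp b) s) e"
proof -
  obtain f where f: "bij_betw f {..<card B} B"
    using ex_bij_betw_nat_finite[OF B(1)] by (auto simp: atLeast0LessThan)
  have "AE s in lborel. badly_approximable {..<card B} (\<lambda>i. poly (pp (f i)) s) e"
  proof (rule AE_poly_badly_approximable_nat[OF _ _ _ e, of "card B" "\<lambda>i. pp (f i)"])
    show "1 \<le> card B" using B by (simp add: Suc_le_eq card_gt_0_iff)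
    show "inj_on (\<lambda>i. degree (pp (f i))) {..<card B}"
      using comp_inj_on[of f "{..<card B}" "\<lambda>b. degree (pp b)"] f pp(1) by (simp add: bij_betw_def o_def)
    show "pp (f i) \<noteq> 0" if "i < card B" for i using that f pp(2) by (auto simp: bij_betw_def)
  qed
  then show ?thesis by (rule AE_mp) (auto intro!: AE_I2 badly_approximable_reindex[OF f])
qed

text \<open>Only countable quantifiers remain: reciprocals of naturals for the constant, natural
  bounds, and extensional integer tuples. This form yields the measurability that the Fubini
  argument requires.\<close>

lemma badly_approximable_countable:
  assumes B: "finite B" "B \<noteq> {}" and e: "e > 0"
  shows "badly_approximable B x e \<longleftrightarrow>
    (\<exists>k::nat. \<forall>Q::nat. \<forall>q\<in>(\<Pi>\<^sub>E b\<in>B. (UNIV::int set)).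
      1 \<le> Q \<longrightarrow> (\<exists>b\<in>B. q b \<noteq> 0) \<longrightarrow> (\<forall>b\<in>B. \<bar>q b\<bar> \<le> int Q) \<longrightarrow>
      1 / (real k + 1) * real Q powr (- (real (card B) - 1) - e) \<le> \<bar>\<Sum>b\<in>B. real_of_int (q b) * x b\<bar>)"
    (is "_ \<longleftrightarrow> (\<exists>k::nat. ?P k)")
proof
  have card: "card B \<ge> 1" using B by (simp add: Suc_le_eq card_gt_0_iff)
  {
    assume "badly_approximable B x e"
    then obtain c where c: "c > 0" "\<And>Q q. Q \<ge> 1 \<Longrightarrow> (\<exists>a\<in>B. (q::_\<Rightarrow>int) a \<noteq> 0) \<Longrightarrow> (\<forall>a\<in>B. real_of_int \<bar>q a\<bar> \<le> Q) \<Longrightarrow>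
     c * Q powr (- (real (card B) - 1) - e) \<le> \<bar>\<Sum>a\<in>B. real_of_int (q a) * x a\<bar>"
      unfolding badly_approximable_def by blast
    obtain k where k: "inverse (real (Suc k)) < c" using reals_Archimedean[OF c(1)] by blast
    have "?P k"
    proof (intro allI ballI impI)
      fix Q :: nat and q
      assume q: "1 \<le> Q" "\<exists>b\<in>B. q b \<noteq> (0::int)" "\<forall>b\<in>B. \<bar>q b\<bar> \<le> int Q"
      have "\<forall>a\<in>B. real_of_int \<bar>q a\<bar> \<le> real Q"
      proof
        fix a assume "a \<in> B"
        then have "\<bar>q a\<bar> \<le> int Q" using q by blast
        then have "real_of_int \<bar>q a\<bar> \<le> real_of_int (int Q)" by (simp only: of_int_le_iff)
        then show "real_of_int \<bar>q a\<bar> \<le> real Q" by simp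
      qed
      then have "c * real Q powr (- (real (card B) - 1) - e) \<le> \<bar>\<Sum>a\<in>B. real_of_int (q a) * x a\<bar>"
        using c(2)[of "real Q" q] q by simp
      moreover have "1 / (real k + 1) * real Q powr (- (real (card B) - 1) - e) \<le>
        c * real Q powr (- (real (card B) - 1) - e)"
        using k by (intro mult_right_mono) (auto simp: inverse_eq_divide add.commute)
      ultimately show "1 / (real k + 1) * real Q powr (- (real (card B) - 1) - e) \<le>
        \<bar>\<Sum>b\<in>B. real_of_int (q b) * x b\<bar>"
        by linarith
    qed
    then show "\<exists>k. ?P k" ..
  next
    assume "\<exists>k. ?P k"
    then obtain k where k: "?P k" ..
    show "badly_approximable B x e" unfolding badly_approximable_def
    proof (intro exI[of _ "1 / (real k + 1)"] conjI allI impI)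
      fix Q :: real and q :: "_ \<Rightarrow> int"
      assume Q: "1 \<le> Q" and q: "\<exists>b\<in>B. q b \<noteq> 0" "\<forall>b\<in>B. real_of_int \<bar>q b\<bar> \<le> Q"
      define Q' where "Q' = nat \<lfloor>Q\<rfloor>"
      have Q': "1 \<le> Q'" "real Q' \<le> Q" using Q by (auto simp: Q'_def le_nat_iff le_floor_iff)
      have qQ: "\<forall>b\<in>B. \<bar>q b\<bar> \<le> int Q'"
      proof
        fix b assume "b \<in> B"
        then have "\<bar>q b\<bar> \<le> \<lfloor>Q\<rfloor>" using q(2) le_floor_iff by blast
        then show "\<bar>q b\<bar> \<le> int Q'" using Q by (simp add: Q'_def)
      qed
      have "1 / (real k + 1) * real Q' powr (- (real (card B) - 1) - e) \<le>
        \<bar>\<Sum>b\<in>B. real_of_int (restrict q B b) * x b\<bar>"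
        using k[rule_format, of "restrict q B" Q'] q(1) qQ Q'(1) by auto
      also have "(\<Sum>b\<in>B. real_of_int (restrict q B b) * x b) = (\<Sum>b\<in>B. real_of_int (q b) * x b)"
        by (intro sum.cong) auto
      finally have "1 / (real k + 1) * real Q' powr (- (real (card B) - 1) - e) \<le>
        \<bar>\<Sum>b\<in>B. real_of_int (q b) * x b\<bar>" .
      moreover have "Q powr (- (real (card B) - 1) - e) \<le> real Q' powr (- (real (card B) - 1) - e)"
        using Q' card e by (intro powr_mono2') auto
      then have "1 / (real k + 1) * Q powr (- (real (card B) - 1) - e) \<le>
        1 / (real k + 1) * real Q' powr (- (real (card B) - 1) - e)"
        by (intro mult_left_mono) auto
      ultimately show "1 / (real k + 1) * Q powr (- (real (card B) - 1) - e) \<le>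
        \<bar>\<Sum>b\<in>B. real_of_int (q b) * x b\<bar>"
        by linarith
    qed simp
  }
qed

lemma measurable_badly_approximable:
  assumes B: "finite B" "B \<noteq> {}" and e: "e > 0"
    and f [measurable]: "\<And>b. b \<in> B \<Longrightarrow> f b \<in> borel_measurable M"
  shows "{h\<in>space M. badly_approximable B (\<lambda>b. f b h) e} \<in> sets M"
proof -
  have c: "countable (\<Pi>\<^sub>E b\<in>B. (UNIV::int set))" using B by (intro countable_PiE) auto
  have [measurable]: "(\<lambda>h. \<Sum>b\<in>B. real_of_int (q b) * f b h) \<in> borel_measurable M" for q :: "_ \<Rightarrow> int"
    using f by (intro borel_measurable_sum borel_measurable_times) auto
  show ?thesis unfolding badly_approximable_countable[OF B e]
    by (intro sets.sets_Collect_countable_Ex sets.sets_Collect_countable_All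
          sets.sets_Collect_countable_All'[OF _ c] sets.sets_Collect_imp sets.sets_Collect_const) measurable
qed

section \<open>From curves to almost all coefficients\<close>

text \<open>Digits in base \<open>E + 1\<close> at the positions \<open>k i\<close>: at the lowest
  position where two expansions differ, the difference of the digits would be divisible by the
  base.\<close>

lemma digits_unique:
  fixes a b :: "'i \<Rightarrow> nat"
  assumes I: "finite I" and k: "inj_on k I" and ab: "\<And>i. i \<in> I \<Longrightarrow> a i \<le> E" "\<And>i. i \<in> I \<Longrightarrow> b i \<le> E"
    and eq: "(\<Sum>i\<in>I. a i * Suc E ^ k i) = (\<Sum>i\<in>I. b i * Suc E ^ k i)" and i: "i \<in> I"
  shows "a i = b i"
proof (rule ccontr)
  assume "a i \<noteq> b i"
  define X where "X = {i\<in>I. a i \<noteq> b i}"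
  have "finite X" "X \<noteq> {}" using I i \<open>a i \<noteq> b i\<close> by (auto simp: X_def)
  then obtain j where j: "j \<in> X" "\<And>i. i \<in> X \<Longrightarrow> k j \<le> k i"
    using ex_min_if_finite[of "k ` X"] by (metis (no_types, lifting) arg_min_if_finite(1) arg_min_least)
  define B where "B = int (Suc E)"
  have B0: "B > 0" by (simp add: B_def)
  have "(\<Sum>i\<in>I. (int (a i) - int (b i)) * B ^ k i) = 0"
    using arg_cong[OF eq, of int] by (simp add: B_def left_diff_distrib sum_subtractf)
  also have "(\<Sum>i\<in>I. (int (a i) - int (b i)) * B ^ k i) = (\<Sum>i\<in>X. (int (a i) - int (b i)) * B ^ k i)"
    using I by (intro sum.mono_neutral_right) (auto simp: X_def)
  also have "\<dots> = (int (a j) - int (b j)) * B ^ k j + (\<Sum>i\<in>X-{j}. (int (a i) - int (b i)) * B ^ k i)"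
    using j(1) \<open>finite X\<close> by (rule sum.remove[rotated])
  finally have "(int (a j) - int (b j)) * B ^ k j = - (\<Sum>i\<in>X-{j}. (int (a i) - int (b i)) * B ^ k i)" by simp
  moreover have "B ^ Suc (k j) dvd (\<Sum>i\<in>X-{j}. (int (a i) - int (b i)) * B ^ k i)"
  proof (rule dvd_sum)
    fix i assume i: "i \<in> X - {j}"
    then have "k j < k i" using j(2)[of i] j(1) k by (auto simp: X_def inj_on_def order.order_iff_strict)
    then show "B ^ Suc (k j) dvd (int (a i) - int (b i)) * B ^ k i"
      by (intro dvd_mult le_imp_power_dvd) simp
  qed
  ultimately have "B ^ k j * B dvd B ^ k j * (int (a j) - int (b j))"
    by (simp add: mult.commute)
  then have "B dvd int (a j) - int (b j)" using B0 by simp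
  moreover have "\<bar>int (a j) - int (b j)\<bar> < B" using ab(1)[of j] ab(2)[of j] j(1) by (auto simp: B_def X_def)
  ultimately have "int (a j) - int (b j) = 0" using zdvd_not_zless[of "\<bar>int (a j) - int (b j)\<bar>" B] by auto
  then show False using j(1) by (simp add: X_def)
qed

text \<open>Boxes determine the product measure, and on a box the claim is translation invariance in
  each factor.\<close>

lemma PiM_lborel_translate:
  assumes I: "finite I"
  shows "distr (PiM I (\<lambda>_. lborel :: 'a::euclidean_space measure)) (PiM I (\<lambda>_. lborel)) (\<lambda>y. \<lambda>i\<in>I. y i +
    c i) = PiM I (\<lambda>_. lborel)"
proof -
  interpret product_sigma_finite "\<lambda>_. lborel :: 'a measure" by standard
  let ?T = "\<lambda>y. \<lambda>i\<in>I. y i + c i"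
  have T: "?T \<in> measurable (PiM I (\<lambda>_. lborel)) (PiM I (\<lambda>_. lborel :: 'a measure))"
    by measurable
  show ?thesis
  proof (rule PiM_eqI[OF I])
    fix A assume A: "\<And>i. i \<in> I \<Longrightarrow> A i \<in> sets (lborel :: 'a measure)"
    have tr: "emeasure lborel ((\<lambda>x. x + c i) -` A i) = emeasure lborel (A i)"
      "(\<lambda>x. x + c i) -` A i \<in> sets lborel" if "i \<in> I" for i
    proof -
      have "emeasure lborel (A i) = emeasure (distr lborel borel (\<lambda>x. c i + x)) (A i)"
        by (simp only: lborel_distr_plus)
      also have "\<dots> = emeasure lborel ((\<lambda>x. c i + x) -` A i)"
        using A[OF that] by (subst emeasure_distr) auto
      finally show "emeasure lborel ((\<lambda>x. x + c i) -` A i) = emeasure lborel (A i)" by (simp add: add.commute)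
      have "(\<lambda>x. x + c i) -` A i \<inter> space lborel \<in> sets lborel"
        by (rule measurable_sets) (use A[OF that] in auto)
      then show "(\<lambda>x. x + c i) -` A i \<in> sets lborel" by simp
    qed
    have "emeasure (distr (PiM I (\<lambda>_. lborel)) (PiM I (\<lambda>_. lborel)) ?T) (Pi\<^sub>E I A) =
        emeasure (PiM I (\<lambda>_. lborel)) (?T -` Pi\<^sub>E I A \<inter> space (PiM I (\<lambda>_. lborel)))"
      using A I by (intro emeasure_distr T sets_PiM_I_finite) auto
    also have "?T -` Pi\<^sub>E I A \<inter> space (PiM I (\<lambda>_. lborel)) = Pi\<^sub>E I (\<lambda>i. (\<lambda>x. x + c i) -` A i)"
      by (auto simp: space_PiM PiE_iff extensional_def)
    also have "emeasure (PiM I (\<lambda>_. lborel)) \<dots> = (\<Prod>i\<in>I. emeasure lborel (A i))"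
      using tr I by (subst emeasure_PiM) auto
    finally show "emeasure (distr (PiM I (\<lambda>_. lborel)) (PiM I (\<lambda>_. lborel)) ?T) (Pi\<^sub>E I A) =
      (\<Prod>i\<in>I. emeasure lborel (A i))" .
  qed simp
qed

text \<open>Fubini in the family of all translates of the curve.\<close>

lemma null_set_of_curves:
  fixes \<gamma> :: "real \<Rightarrow> 'i \<Rightarrow> 'a::euclidean_space"
  assumes I: "finite I" and \<gamma> [measurable]: "\<And>i. i \<in> I \<Longrightarrow> (\<lambda>s. \<gamma> s i) \<in> borel_measurable borel"
    and N [measurable]: "N \<in> sets (PiM I (\<lambda>_. lborel :: 'a measure))"
    and AE: "\<And>y. y \<in> space (PiM I (\<lambda>_. lborel :: 'a measure)) \<Longrightarrow> AE s in lborel. (\<lambda>i\<in>I. y i + \<gamma> s i) \<notin> N"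
  shows "N \<in> null_sets (PiM I (\<lambda>_. lborel :: 'a measure))"
proof -
  let ?M = "PiM I (\<lambda>_. lborel :: 'a measure)"
  interpret product_sigma_finite "\<lambda>_. lborel :: 'a measure" by standard
  interpret M: sigma_finite_measure ?M by (rule sigma_finite[OF I])
  interpret pair_sigma_finite ?M "lborel :: real measure" by standard
  let ?T = "\<lambda>(y, s). \<lambda>i\<in>I. y i + \<gamma> s i"
  have T: "?T \<in> measurable (?M \<Otimes>\<^sub>M lborel) ?M"
    by measurable
  define A where "A = ?T -` N \<inter> space (?M \<Otimes>\<^sub>M lborel)"
  have A: "A \<in> sets (?M \<Otimes>\<^sub>M lborel)" unfolding A_def by (rule measurable_sets[OF T N])
  have "emeasure (?M \<Otimes>\<^sub>M lborel) A = (\<integral>\<^sup>+ y. emeasure lborel (Pair y -` A) \<partial>?M)"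
    by (rule lborel.emeasure_pair_measure_alt[OF A])
  also have "\<dots> = (\<integral>\<^sup>+ y. 0 \<partial>?M)"
  proof (rule nn_integral_cong)
    fix y assume y: "y \<in> space ?M"
    have "Pair y -` A = {s \<in> space lborel. \<not> (\<lambda>i\<in>I. y i + \<gamma> s i) \<notin> N}"
      using y by (auto simp: A_def space_pair_measure)
    moreover have "Pair y -` A \<in> sets lborel" by (rule sets_Pair1[OF A])
    ultimately show "emeasure lborel (Pair y -` A) = 0"
      using AE_iff_measurable[of "Pair y -` A" lborel "\<lambda>s. (\<lambda>i\<in>I. y i + \<gamma> s i) \<notin> N"] AE[OF y] by metis
  qed
  finally have 0: "emeasure (?M \<Otimes>\<^sub>M lborel) A = 0" by simp
  have "emeasure (?M \<Otimes>\<^sub>M lborel) A = (\<integral>\<^sup>+ s. emeasure ?M ((\<lambda>y. (y, s)) -` A) \<partial>lborel)"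
    by (rule emeasure_pair_measure_alt2[OF A])
  also have "\<dots> = (\<integral>\<^sup>+ s. emeasure ?M N \<partial>(lborel :: real measure))"
  proof (rule nn_integral_cong)
    fix s :: real
    have "emeasure ?M N = emeasure (distr ?M ?M (\<lambda>y. \<lambda>i\<in>I. y i + \<gamma> s i)) N"
      by (simp add: PiM_lborel_translate[OF I])
    also have "\<dots> = emeasure ?M ((\<lambda>y. \<lambda>i\<in>I. y i + \<gamma> s i) -` N \<inter> space ?M)"
      by (rule emeasure_distr[OF _ N]) measurable
    also have "(\<lambda>y. \<lambda>i\<in>I. y i + \<gamma> s i) -` N \<inter> space ?M = (\<lambda>y. (y, s)) -` A"
      by (auto simp: A_def space_pair_measure)
    finally show "emeasure ?M ((\<lambda>y. (y, s)) -` A) = emeasure ?M N" by simp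
  qed
  \<comment> \<open>Every translate of \<open>N\<close> has the measure of \<open>N\<close>, and the
    parameter runs over a line of infinite length.\<close>
  finally have "emeasure ?M N * \<infinity> = 0" using 0 by simp
  then have "emeasure ?M N = 0" by (simp add: ennreal_mult_eq_top_iff mult_eq_0_iff)
  then show ?thesis using N by auto
qed

definition monomial :: "'i set \<Rightarrow> ('i \<times> 'm \<Rightarrow> nat) \<Rightarrow> ('i \<Rightarrow> real ^ 'm::finite) \<Rightarrow> real" where
  "monomial I a h = (\<Prod>(i, m)\<in>I \<times> UNIV. (h i $ m) ^ a (i, m))"

text \<open>Along a translate of the curve every coordinate is a monic polynomial whose degree is
  its weight, whatever the base point \<open>y\<close>. Degrees of products are therefore weighted
  sums of exponents.\<close>

lemma monomial_curve_poly:
  fixes y :: "'i \<Rightarrow> real ^ 'm::finite" and w :: "'i \<times> 'm \<Rightarrow> nat"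
  assumes I: "finite I" and w: "\<And>i. w i \<ge> 1"
  obtains pp where "\<And>a. pp a \<noteq> 0" "\<And>a. degree (pp a) = (\<Sum>i\<in>I \<times> UNIV. a i * w i)"
    "\<And>a s. poly (pp a) s = monomial I a (\<lambda>i\<in>I. y i + (\<chi> m. s ^ w (i, m)))"
proof -
  define f where "f im = [: y (fst im) $ snd im :] + Polynomial.monom 1 (w im)" for im
  have df: "degree (f im) = w im" for im
  proof -
    have "degree [: y (fst im) $ snd im :] < degree (Polynomial.monom (1::real) (w im))"
      using w[of im] by (simp add: degree_monom_eq)
    then show ?thesis unfolding f_def by (subst degree_add_eq_right) (auto simp: degree_monom_eq)
  qed
  have f0: "f im \<noteq> 0" for im using df[of im] w[of im] by auto
  show ?thesis
  proof (rule that[of "\<lambda>a. \<Prod>im\<in>I \<times> UNIV. f im ^ a im"])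
    show "(\<Prod>im\<in>I \<times> UNIV. f im ^ a im) \<noteq> 0" for a using I f0 by (simp add: prod_zero_iff)
    show "degree (\<Prod>im\<in>I \<times> UNIV. f im ^ a im) = (\<Sum>i\<in>I \<times> UNIV. a i * w i)" for a
      using f0 by (subst degree_prod_eq_sum_degree) (auto simp: degree_power_eq df)
    show "poly (\<Prod>im\<in>I \<times> UNIV. f im ^ a im) s = monomial I a (\<lambda>i\<in>I. y i + (\<chi> m. s ^ w (i, m)))" for a s
      unfolding monomial_def poly_prod
      by (intro prod.cong) (auto simp: f_def poly_monom poly_power)
  qed
qed

text \<open>The weights \<open>Suc E ^ k i\<close> turn an exponent tuple into the number with these
  digits, so distinct monomials have distinct degrees on every translate of the curve.\<close>

lemma AE_monomials_badly_approximable: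
  fixes I :: "'i set"
  assumes I: "finite I" and S: "S \<noteq> {}" "S \<subseteq> (\<Pi>\<^sub>E i\<in>I \<times> (UNIV :: 'm::finite set). {..E})" and e: "e > 0"
  shows "AE h in PiM I (\<lambda>_. lborel :: (real ^ 'm) measure). badly_approximable S (\<lambda>a. monomial I a h) e"
proof -
  let ?M = "PiM I (\<lambda>_. lborel :: (real ^ 'm) measure)"
  have finS: "finite S" by (rule finite_subset[OF S(2)]) (use I in \<open>auto intro!: finite_PiE\<close>)
  obtain k :: "'i \<times> 'm \<Rightarrow> nat" where k: "inj_on k (I \<times> UNIV)"
    using finite_imp_inj_to_nat_seg[of "I \<times> (UNIV :: 'm set)"] I by auto
  define w where "w i = Suc E ^ k i" for i
  have w1: "w i \<ge> 1" for i by (simp add: w_def)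
  define \<gamma> :: "real \<Rightarrow> 'i \<Rightarrow> real ^ 'm" where "\<gamma> s i = (\<chi> m. s ^ w (i, m))" for s i
  define N where "N = {h\<in>space ?M. \<not> badly_approximable S (\<lambda>a. monomial I a h) e}"
  have mono: "(\<lambda>h. monomial I a h) \<in> borel_measurable ?M" for a
    unfolding monomial_def
  proof (intro borel_measurable_prod, clarify)
    fix i and m :: 'm assume i: "i \<in> I"
    have [measurable]: "(\<lambda>h. h i) \<in> borel_measurable ?M"
      using measurable_component_singleton[OF i, of "\<lambda>_. lborel :: (real ^ 'm) measure"] by simp
    have "continuous_on UNIV (\<lambda>x :: real ^ 'm. x $ m)" by (intro continuous_intros)
    from borel_measurable_continuous_onI[OF this]
    have "(\<lambda>h. h i $ m) \<in> borel_measurable ?M" by (rule measurable_compose[rotated]) measurable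
    then show "(\<lambda>h. (h i $ m) ^ a (i, m)) \<in> borel_measurable ?M" by (rule borel_measurable_power)
  qed
  have "N = space ?M - {h\<in>space ?M. badly_approximable S (\<lambda>a. monomial I a h) e}" by (auto simp: N_def)
  then have N: "N \<in> sets ?M"
    using measurable_badly_approximable[OF finS S(1) e, of "\<lambda>a h. monomial I a h" ?M] mono by auto
  have "N \<in> null_sets ?M"
  proof (rule null_set_of_curves[OF I _ N])
    show "(\<lambda>s. \<gamma> s i) \<in> borel_measurable borel" for i
      unfolding \<gamma>_def by (intro borel_measurable_continuous_onI continuous_intros)
    fix y assume y: "y \<in> space ?M"
    obtain pp where pp: "\<And>a. pp a \<noteq> 0" "\<And>a. degree (pp a) = (\<Sum>i\<in>I \<times> UNIV. a i * w i)"
      "\<And>a s. poly (pp a) s = monomial I a (\<lambda>i\<in>I. y i + (\<chi> m. s ^ w (i, m)))"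
      using monomial_curve_poly[where I = I and w = w and y = y, OF I w1] by blast
    have "inj_on (\<lambda>a. degree (pp a)) S"
    proof (rule inj_onI)
      fix a b assume ab: "a \<in> S" "b \<in> S" "degree (pp a) = degree (pp b)"
      have PiE: "a \<in> (\<Pi>\<^sub>E i\<in>I \<times> (UNIV :: 'm set). {..E})" "b \<in> (\<Pi>\<^sub>E i\<in>I \<times> (UNIV :: 'm set). {..E})"
        using ab S(2) by auto
      show "a = b"
      proof (rule PiE_ext[OF PiE])
        fix i assume i: "i \<in> I \<times> (UNIV :: 'm set)"
        show "a i = b i"
        proof (rule digits_unique[OF _ k _ _ _ i, of _ E])
          show "(\<Sum>i\<in>I \<times> UNIV. a i * Suc E ^ k i) = (\<Sum>i\<in>I \<times> UNIV. b i * Suc E ^ k i)"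
            using ab(3) by (simp add: pp(2) w_def)
        qed (use I PiE in auto)
      qed
    qed
    then have "AE s in lborel. badly_approximable S (\<lambda>a. poly (pp a) s) e"
      by (intro AE_poly_badly_approximable finS S(1) pp(1) e)
    then show "AE s in lborel. (\<lambda>i\<in>I. y i + \<gamma> s i) \<notin> N"
      by (rule AE_mp) (auto intro!: AE_I2 simp: N_def pp(3) \<gamma>_def)
  qed
  then show ?thesis by (rule AE_I') (auto simp: N_def)
qed

section \<open>The outer bound\<close>

abbreviation gauss :: "real \<Rightarrow> real measure" where
  "gauss s \<equiv> density lborel (\<lambda>x. ennreal (normal_density 0 s x))"

lemma prob_space_gauss: "0 < s \<Longrightarrow> prob_space (gauss s)"
  by (rule prob_space_normal_density)

lemma prob_space_gaussian_noise: "prob_space (gaussian_noise n)"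
  unfolding gaussian_noise_def by (intro prob_space_PiM prob_space_gauss) simp

lemma sets_gaussian_noise: "sets (gaussian_noise n) = sets (PiM {..<n} (\<lambda>_. borel))"
  unfolding gaussian_noise_def by (intro sets_PiM_cong) auto

lemma indep_vars_coordinates:
  assumes I: "I \<noteq> {}" and M: "\<And>i. i \<in> I \<Longrightarrow> prob_space (M i)"
  shows "prob_space.indep_vars (PiM I M) M (\<lambda>i \<omega>. \<omega> i) I"
proof -
  interpret prob_space "PiM I M" by (intro prob_space_PiM M)
  have "distr (PiM I M) (PiM I M) (\<lambda>\<omega>. \<lambda>i\<in>I. \<omega> i) = distr (PiM I M) (PiM I M) (\<lambda>\<omega>. \<omega>)"
    by (intro distr_cong) (auto simp: space_PiM)
  also have "\<dots> = PiM I M" by simp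
  also have "\<dots> = PiM I (\<lambda>i. distr (PiM I M) (M i) (\<lambda>\<omega>. \<omega> i))"
    by (intro PiM_cong refl distr_PiM_component[symmetric] M)
  finally show ?thesis by (subst indep_vars_iff_distr_eq_PiM'[OF I]) auto
qed

text \<open>Sums of independent normal variables are normal, and the sums at distinct times use
  disjoint blocks of coordinates. This allows the noise of a receiver to be assembled from several
  components without changing its law.\<close>

lemma gaussian_combination:
  fixes K :: "'k set" and b s :: "'k \<Rightarrow> real"
  assumes K: "finite K" and s: "\<And>\<kappa>. \<kappa> \<in> K \<Longrightarrow> 0 < s \<kappa>" and n: "n > 0"
    and one: "(\<Sum>\<kappa>\<in>K. (b \<kappa>)^2 * (s \<kappa>)^2) = 1"
  shows "distr (PiM (K \<times> {..<n}) (\<lambda>(\<kappa>, t). gauss (s \<kappa>))) (PiM {..<n} (\<lambda>_. borel))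
           (\<lambda>\<omega>. \<lambda>t\<in>{..<n}. \<Sum>\<kappa>\<in>K. b \<kappa> * \<omega> (\<kappa>, t)) = gaussian_noise n"
proof -
  let ?I = "K \<times> {..<n}" and ?G = "\<lambda>(\<kappa>, t::nat). gauss (s \<kappa>)"
  have ps: "prob_space (?G i)" if "i \<in> ?I" for i using that s by (auto intro!: prob_space_gauss)
  interpret prob_space "PiM ?I ?G" by (intro prob_space_PiM ps)
  \<comment> \<open>Zero coefficients are dropped, since a normal density requires a positive
    deviation.\<close>
  define K' where "K' = {\<kappa>\<in>K. b \<kappa> \<noteq> 0}"
  have K': "finite K'" "K' \<noteq> {}"
  proof -
    show "finite K'" using K by (simp add: K'_def)
    show "K' \<noteq> {}"
    proof
      assume "K' = {}"
      then have "(\<Sum>\<kappa>\<in>K. (b \<kappa>)^2 * (s \<kappa>)^2) = 0" by (intro sum.neutral) (auto simp: K'_def)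
      with one show False by simp
    qed
  qed
  have Kne: "?I \<noteq> {}" using K'(2) n by (auto simp: K'_def)
  have indepG: "indep_vars ?G (\<lambda>i \<omega>. \<omega> i) ?I" by (rule indep_vars_coordinates[OF Kne ps])
  have indep: "indep_vars (\<lambda>_. borel) (\<lambda>i \<omega>. \<omega> i) ?I"
    using indep_vars_compose2[OF indepG, of "\<lambda>_ x. x" "\<lambda>_. borel"] by (auto split: prod.splits)
  have sumK': "(\<Sum>\<kappa>\<in>K. b \<kappa> * \<omega> (\<kappa>, t)) = (\<Sum>\<kappa>\<in>K'. b \<kappa> * \<omega> (\<kappa>, t))" for \<omega> :: "'k \<times> nat \<Rightarrow> real" and t
    using K by (intro sum.mono_neutral_right) (auto simp: K'_def)
  have coord: "distributed (PiM ?I ?G) lborel (\<lambda>\<omega>. \<omega> (\<kappa>, t)) (normal_density 0 (s \<kappa>))"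
    if "\<kappa> \<in> K" "t < n" for \<kappa> t
  proof -
    have i: "(\<kappa>, t) \<in> ?I" using that by auto
    have "distr (PiM ?I ?G) (?G (\<kappa>, t)) (\<lambda>\<omega>. \<omega> (\<kappa>, t)) = ?G (\<kappa>, t)"
      by (rule distr_PiM_component[OF ps i])
    moreover have "distr (PiM ?I ?G) (?G (\<kappa>, t)) (\<lambda>\<omega>. \<omega> (\<kappa>, t)) = distr (PiM ?I ?G) lborel (\<lambda>\<omega>. \<omega> (\<kappa>, t))"
      by (intro distr_cong) auto
    ultimately show ?thesis
      using measurable_component_singleton[OF i, of ?G]
      by (auto simp: distributed_def cong: measurable_cong_sets)
  qed
  have distS: "distr (PiM ?I ?G) borel (\<lambda>\<omega>. \<Sum>\<kappa>\<in>K. b \<kappa> * \<omega> (\<kappa>, t)) = gauss 1" if t: "t < n" for t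
  proof -
    have D: "distributed (PiM ?I ?G) lborel (\<lambda>\<omega>. b \<kappa> * \<omega> (\<kappa>, t)) (normal_density 0 (\<bar>b \<kappa>\<bar> * s \<kappa>))"
      if "\<kappa> \<in> K'" for \<kappa>
      using normal_density_affine[OF coord[of \<kappa> t], of "b \<kappa>" 0] that t s by (auto simp: K'_def)
    have "indep_vars (\<lambda>\<kappa>. PiM {(\<kappa>, t)} (\<lambda>_. borel)) (\<lambda>\<kappa> \<omega>. restrict (\<lambda>i. \<omega> i) {(\<kappa>, t)}) K'"
      by (rule indep_vars_restrict[OF indep]) (use t in \<open>auto simp: disjoint_family_on_def K'_def\<close>)
    then have "indep_vars (\<lambda>_. borel) (\<lambda>\<kappa> \<omega>. (\<lambda>x. b \<kappa> * x (\<kappa>, t)) (restrict (\<lambda>i. \<omega> i) {(\<kappa>, t)})) K'"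
      by (rule indep_vars_compose2) measurable
    then have "indep_vars (\<lambda>_. borel) (\<lambda>\<kappa> \<omega>. b \<kappa> * \<omega> (\<kappa>, t)) K'" by simp
    then have "distributed (PiM ?I ?G) lborel (\<lambda>\<omega>. \<Sum>\<kappa>\<in>K'. b \<kappa> * \<omega> (\<kappa>, t))
        (normal_density (\<Sum>\<kappa>\<in>K'. 0) (sqrt (\<Sum>\<kappa>\<in>K'. (\<bar>b \<kappa>\<bar> * s \<kappa>)^2)))"
      using K' D s by (intro sum_indep_normal) (auto simp: K'_def)
    moreover have "(\<Sum>\<kappa>\<in>K'. (\<bar>b \<kappa>\<bar> * s \<kappa>)^2) = 1"
    proof -
      have "(\<Sum>\<kappa>\<in>K'. (\<bar>b \<kappa>\<bar> * s \<kappa>)^2) = (\<Sum>\<kappa>\<in>K. (b \<kappa>)^2 * (s \<kappa>)^2)"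
        using K by (intro sum.mono_neutral_cong_left) (auto simp: K'_def power_mult_distrib)
      then show ?thesis using one by simp
    qed
    ultimately have "distr (PiM ?I ?G) lborel (\<lambda>\<omega>. \<Sum>\<kappa>\<in>K. b \<kappa> * \<omega> (\<kappa>, t)) = gauss 1"
      by (simp add: distributed_def sumK')
    moreover have "distr (PiM ?I ?G) borel (\<lambda>\<omega>. \<Sum>\<kappa>\<in>K. b \<kappa> * \<omega> (\<kappa>, t)) =
        distr (PiM ?I ?G) lborel (\<lambda>\<omega>. \<Sum>\<kappa>\<in>K. b \<kappa> * \<omega> (\<kappa>, t))" by (intro distr_cong) auto
    ultimately show ?thesis by simp
  qed
  have indepS: "indep_vars (\<lambda>_. borel) (\<lambda>t \<omega>. \<Sum>\<kappa>\<in>K. b \<kappa> * \<omega> (\<kappa>, t)) {..<n}"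
  proof -
    have "indep_vars (\<lambda>t. PiM (K \<times> {t}) (\<lambda>_. borel)) (\<lambda>t \<omega>. restrict (\<lambda>i. \<omega> i) (K \<times> {t})) {..<n}"
      by (rule indep_vars_restrict[OF indep]) (auto simp: disjoint_family_on_def)
    then have "indep_vars (\<lambda>_. borel) (\<lambda>t \<omega>. (\<lambda>x. \<Sum>\<kappa>\<in>K. b \<kappa> * x (\<kappa>, t)) (restrict (\<lambda>i. \<omega> i) (K \<times> {t}))) {..<n}"
      by (rule indep_vars_compose2) measurable
    then show ?thesis by simp
  qed
  have ne: "{..<n} \<noteq> {}" using n by auto
  have meas: "(\<lambda>\<omega>. \<Sum>\<kappa>\<in>K. b \<kappa> * \<omega> (\<kappa>, t)) \<in> borel_measurable (PiM ?I ?G)" if "t \<in> {..<n}" for t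
  proof (intro borel_measurable_sum borel_measurable_times borel_measurable_const)
    fix \<kappa> assume "\<kappa> \<in> K"
    then have "(\<kappa>, t) \<in> ?I" using that by auto
    from measurable_component_singleton[OF this, of ?G]
    show "(\<lambda>\<omega>. \<omega> (\<kappa>, t)) \<in> borel_measurable (PiM ?I ?G)" by (simp cong: measurable_cong_sets)
  qed
  have "distr (PiM ?I ?G) (PiM {..<n} (\<lambda>_. borel)) (\<lambda>\<omega>. \<lambda>t\<in>{..<n}. \<Sum>\<kappa>\<in>K. b \<kappa> * \<omega> (\<kappa>, t)) =
      PiM {..<n} (\<lambda>t. distr (PiM ?I ?G) borel (\<lambda>\<omega>. \<Sum>\<kappa>\<in>K. b \<kappa> * \<omega> (\<kappa>, t)))"
    using indepS by (subst (asm) indep_vars_iff_distr_eq_PiM'[OF ne meas]) auto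
  also have "\<dots> = gaussian_noise n"
    unfolding gaussian_noise_def by (intro PiM_cong refl) (simp add: distS)
  finally show ?thesis .
qed

text \<open>Integration of one coordinate at a time: each density costs a factor
  \<open>c\<close>.\<close>

lemma nn_integral_PiM_density_le:
  fixes \<phi> :: "'i \<Rightarrow> real \<Rightarrow> ennreal"
  assumes I: "finite I" and ps: "\<And>i. prob_space (density lborel (\<phi> i))"
    and [measurable]: "\<And>i. \<phi> i \<in> borel_measurable borel"
    and le: "\<And>i x. i \<in> I \<Longrightarrow> \<phi> i x \<le> c"
    and f: "f \<in> borel_measurable (PiM I (\<lambda>_. borel))"
  shows "(\<integral>\<^sup>+x. f x \<partial>PiM I (\<lambda>i. density lborel (\<phi> i))) \<le> c ^ card I * (\<integral>\<^sup>+x. f x \<partial>PiM I (\<lambda>_. lborel))"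
  using I le f
proof (induction I arbitrary: f rule: finite_induct)
  case empty
  then show ?case by (simp add: PiM_empty)
next
  case (insert i I)
  interpret P: product_prob_space "\<lambda>i. density lborel (\<phi> i)" using ps by (rule product_prob_spaceI)
  interpret L: product_sigma_finite "\<lambda>_. lborel :: real measure" by standard
  have f1: "f \<in> borel_measurable (PiM (insert i I) (\<lambda>i. density lborel (\<phi> i)))"
    using insert.prems(2) by (subst measurable_cong_sets[OF sets_PiM_cong refl]) auto
  have f2: "f \<in> borel_measurable (PiM (insert i I) (\<lambda>_. lborel))"
    using insert.prems(2) by (subst measurable_cong_sets[OF sets_PiM_cong refl]) auto
  have upd: "(\<lambda>x. f (x(i := y))) \<in> borel_measurable (PiM I (\<lambda>_. borel))" for y
  proof -
    have "(\<lambda>x. x(i := y)) \<in> measurable (PiM I (\<lambda>_. borel)) (PiM (insert i I) (\<lambda>_. borel :: real measure))"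
      by (rule measurable_fun_upd[where J = I]) auto
    from measurable_compose[OF this insert.prems(2)] show ?thesis .
  qed
  have m: "(\<lambda>y. \<integral>\<^sup>+x. f (x(i := y)) \<partial>PiM I (\<lambda>_. lborel)) \<in> borel_measurable lborel"
  proof -
    interpret LI: sigma_finite_measure "PiM I (\<lambda>_. lborel :: real measure)"
      by (rule L.sigma_finite) (rule insert.hyps)
    have "(\<lambda>(y, x). x(i := y)) \<in> measurable (lborel \<Otimes>\<^sub>M PiM I (\<lambda>_. lborel)) (PiM (insert i I) (\<lambda>_. lborel :: real measure))"
      by measurable
    from measurable_compose[OF this f2]
    have "(\<lambda>(y, x). f (x(i := y))) \<in> borel_measurable (lborel \<Otimes>\<^sub>M PiM I (\<lambda>_. lborel))"
      by (simp add: case_prod_unfold)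
    then show ?thesis
      by (rule LI.borel_measurable_nn_integral)
  qed
  have "(\<integral>\<^sup>+x. f x \<partial>PiM (insert i I) (\<lambda>i. density lborel (\<phi> i))) =
     (\<integral>\<^sup>+y. (\<integral>\<^sup>+x. f (x(i := y)) \<partial>PiM I (\<lambda>i. density lborel (\<phi> i))) \<partial>density lborel (\<phi> i))"
    using insert.hyps by (intro P.product_nn_integral_insert_rev f1)
  also have "\<dots> \<le> (\<integral>\<^sup>+y. c ^ card I * (\<integral>\<^sup>+x. f (x(i := y)) \<partial>PiM I (\<lambda>_. lborel)) \<partial>density lborel (\<phi> i))"
    by (intro nn_integral_mono insert.IH[OF _ upd] insert.prems(1)) simp
  also have "\<dots> = (\<integral>\<^sup>+y. \<phi> i y * (c ^ card I * (\<integral>\<^sup>+x. f (x(i := y)) \<partial>PiM I (\<lambda>_. lborel))) \<partial>lborel)"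
    by (intro nn_integral_density) (use m in measurable)
  also have "\<dots> \<le> (\<integral>\<^sup>+y. c * (c ^ card I * (\<integral>\<^sup>+x. f (x(i := y)) \<partial>PiM I (\<lambda>_. lborel))) \<partial>lborel)"
    using insert.prems by (intro nn_integral_mono mult_right_mono) auto
  also have "\<dots> = c ^ card (insert i I) * (\<integral>\<^sup>+y. (\<integral>\<^sup>+x. f (x(i := y)) \<partial>PiM I (\<lambda>_. lborel)) \<partial>lborel)"
    using insert.hyps m by (simp add: nn_integral_cmult mult.assoc[symmetric])
  also have "(\<integral>\<^sup>+y. (\<integral>\<^sup>+x. f (x(i := y)) \<partial>PiM I (\<lambda>_. lborel)) \<partial>lborel) =
    (\<integral>\<^sup>+x. f x \<partial>PiM (insert i I) (\<lambda>_. lborel))"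
    using insert.hyps by (intro L.product_nn_integral_insert_rev[symmetric] f2)
  finally show ?case .
qed

text \<open>Regrouping of coordinates: the product over \<open>J \<times> {..<n}\<close> is the
  image of the iterated product, in which \<open>S\<close> becomes a box with sides
  \<open>E j\<close>.\<close>

lemma emeasure_PiM_blocks:
  fixes E :: "'j \<Rightarrow> (nat \<Rightarrow> real) set"
  assumes J: "finite J" and E: "\<And>j. j \<in> J \<Longrightarrow> E j \<in> sets (PiM {..<n} (\<lambda>_. borel))"
  defines "S \<equiv> {s \<in> space (PiM (J \<times> {..<n}) (\<lambda>_. lborel)). \<forall>j\<in>J. (\<lambda>t\<in>{..<n}. s (j, t)) \<in> E j}"
  shows "S \<in> sets (PiM (J \<times> {..<n}) (\<lambda>_. lborel))"
    and "emeasure (PiM (J \<times> {..<n}) (\<lambda>_. lborel)) S = (\<Prod>j\<in>J. emeasure (PiM {..<n} (\<lambda>_. lborel)) (E j))"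
proof -
  let ?L = "PiM {..<n} (\<lambda>_. lborel :: real measure)"
  let ?N = "PiM J (\<lambda>_. ?L)"
  let ?F = "PiM (J \<times> {..<n}) (\<lambda>_. lborel :: real measure)"
  let ?f = "\<lambda>y. \<lambda>(j, t)\<in>J \<times> {..<n}. y j t"
  interpret L: product_sigma_finite "\<lambda>_. lborel :: real measure" by standard
  have sfL: "sigma_finite_measure ?L" by (rule L.sigma_finite) simp
  interpret N: product_sigma_finite "\<lambda>_ :: 'j. ?L" by (intro product_sigma_finite.intro sfL)
  have f: "?f \<in> measurable ?N ?F"
  proof (rule measurable_restrict)
    fix i assume "i \<in> J \<times> {..<n}"
    then obtain j t where i: "i = (j, t)" and j: "j \<in> J" and t: "t \<in> {..<n}" by auto
    have "(\<lambda>y. y j) \<in> measurable ?N ?L" by (rule measurable_component_singleton) (rule j)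
    moreover have "(\<lambda>x. x t) \<in> measurable ?L lborel" by (rule measurable_component_singleton) (rule t)
    ultimately have "(\<lambda>y. y j t) \<in> measurable ?N lborel" by (rule measurable_compose)
    then show "(\<lambda>y. case i of (j, t) \<Rightarrow> y j t) \<in> measurable ?N lborel" by (simp add: i)
  qed
  have dF: "distr ?N ?F ?f = ?F"
  proof (rule L.PiM_eqI)
    fix A :: "'j \<times> nat \<Rightarrow> real set" assume A: "\<And>i. i \<in> J \<times> {..<n} \<Longrightarrow> A i \<in> sets (lborel :: real measure)"
    have "emeasure (distr ?N ?F ?f) (Pi\<^sub>E (J \<times> {..<n}) A) =
      emeasure ?N (?f -` Pi\<^sub>E (J \<times> {..<n}) A \<inter> space ?N)"
      using A J by (intro emeasure_distr f sets_PiM_I_finite) auto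
    also have "?f -` Pi\<^sub>E (J \<times> {..<n}) A \<inter> space ?N = Pi\<^sub>E J (\<lambda>j. Pi\<^sub>E {..<n} (\<lambda>t. A (j, t)))"
      by (auto simp: space_PiM PiE_iff)
    also have "emeasure ?N \<dots> = (\<Prod>j\<in>J. emeasure ?L (Pi\<^sub>E {..<n} (\<lambda>t. A (j, t))))"
      using A J by (intro N.emeasure_PiM sets_PiM_I_finite) auto
    also have "\<dots> = (\<Prod>j\<in>J. \<Prod>t\<in>{..<n}. emeasure lborel (A (j, t)))"
      using A by (intro prod.cong refl L.emeasure_PiM) auto
    also have "\<dots> = (\<Prod>i\<in>J \<times> {..<n}. emeasure lborel (A i))"
      by (simp add: prod.cartesian_product case_prod_unfold)
    finally show "emeasure (distr ?N ?F ?f) (Pi\<^sub>E (J \<times> {..<n}) A) = (\<Prod>i\<in>J \<times> {..<n}. emeasure lborel (A i))" .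
  qed (use J in auto)
  show S: "S \<in> sets ?F"
  proof -
    have "{s \<in> space ?F. (\<lambda>t\<in>{..<n}. s (j, t)) \<in> E j} \<in> sets ?F" if j: "j \<in> J" for j
    proof -
      have "(\<lambda>s. \<lambda>t\<in>{..<n}. s (j, t)) \<in> measurable ?F (PiM {..<n} (\<lambda>_. borel))"
        by (rule measurable_restrict) (simp add: measurable_component_singleton j)
      from measurable_sets[OF this E[OF j]] show ?thesis
        by (simp add: vimage_def Int_def conj_commute)
    qed
    then show ?thesis unfolding S_def using J by (intro sets.sets_Collect_finite_All) auto
  qed
  have "emeasure (distr ?N ?F ?f) S = emeasure ?N (?f -` S \<inter> space ?N)"
    by (rule emeasure_distr[OF f S])
  also have "?f -` S \<inter> space ?N = Pi\<^sub>E J E"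
  proof -
    have sub: "E j \<subseteq> {..<n} \<rightarrow>\<^sub>E UNIV" if "j \<in> J" for j
      using sets.sets_into_space[OF E[OF that]] by (simp add: space_PiM)
    have r: "(\<lambda>t\<in>{..<n}. ?f y (j, t)) = y j" if "j \<in> J" "y j \<in> {..<n} \<rightarrow>\<^sub>E UNIV" for y j
      using that by (auto simp: fun_eq_iff PiE_iff extensional_def restrict_def)
    show ?thesis
    proof (rule Set.set_eqI, rule iffI)
      fix y assume y: "y \<in> ?f -` S \<inter> space ?N"
      then have yj: "y j \<in> {..<n} \<rightarrow>\<^sub>E UNIV" if "j \<in> J" for j using that by (auto simp: space_PiM PiE_iff)
      have "(\<lambda>t\<in>{..<n}. ?f y (j, t)) \<in> E j" if "j \<in> J" for j using y that unfolding S_def by blast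
      moreover have e: "(\<lambda>t\<in>{..<n}. ?f y (j, t)) = y j" if "j \<in> J" for j
        by (rule r[OF that]) (rule yj[OF that])
      ultimately have "y j \<in> E j" if "j \<in> J" for j using that by metis
      moreover have "y \<in> extensional J" using y by (simp add: space_PiM PiE_iff)
      ultimately show "y \<in> Pi\<^sub>E J E" by (simp add: PiE_iff)
    next
      fix y assume y: "y \<in> Pi\<^sub>E J E"
      then have yj: "y j \<in> {..<n} \<rightarrow>\<^sub>E UNIV" if "j \<in> J" for j
        using sub[OF that] that by (simp add: PiE_iff subset_iff)
      have e: "(\<lambda>t\<in>{..<n}. ?f y (j, t)) = y j" if "j \<in> J" for j by (rule r[OF that]) (rule yj[OF that])
      have "(\<lambda>t\<in>{..<n}. ?f y (j, t)) \<in> E j" if "j \<in> J" for j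
        unfolding e[OF that] using y that by (simp add: PiE_iff)
      moreover have "?f y \<in> space ?F" by (auto simp: space_PiM)
      moreover have "y \<in> space ?N" using yj y by (simp add: space_PiM PiE_iff)
      ultimately show "y \<in> ?f -` S \<inter> space ?N" unfolding S_def by blast
    qed
  qed
  also have "emeasure ?N (Pi\<^sub>E J E) = (\<Prod>j\<in>J. emeasure ?L (E j))"
  proof (rule N.emeasure_PiM[OF J])
    show "E j \<in> sets ?L" if "j \<in> J" for j using E[OF that] by (simp cong: sets_PiM_cong)
  qed
  finally have "emeasure (distr ?N ?F ?f) S = (\<Prod>j\<in>J. emeasure ?L (E j))" .
  then show "emeasure ?F S = (\<Prod>j\<in>J. emeasure ?L (E j))" by (simp add: dF)
qed

section \<open>Energy of the received blocks\<close>

definition energy_ball :: "nat \<Rightarrow> real \<Rightarrow> (nat \<Rightarrow> real) set" where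
  "energy_ball n r = {y \<in> space (PiM {..<n} (\<lambda>_. borel)). (\<Sum>t<n. (y t)^2) \<le> real n * r}"

lemma energy_ball_sets: "energy_ball n r \<in> sets (PiM {..<n} (\<lambda>_. borel))"
  unfolding energy_ball_def by measurable

text \<open>Compare the indicator of the ball with the Gaussian \<open>exp ((n * r - sum y^2) / (2 * r))\<close>.\<close>

lemma emeasure_energy_ball_le:
  assumes r: "r > 0"
  shows "emeasure (PiM {..<n} (\<lambda>_. lborel)) (energy_ball n r) \<le> ennreal (sqrt (2 * pi * exp 1 * r) ^ n)"
proof -
  interpret L: product_sigma_finite "\<lambda>_. lborel :: real measure" by standard
  let ?L = "PiM {..<n} (\<lambda>_. lborel :: real measure)"
  let ?c = "exp (1/2) * sqrt (2 * pi * r)"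
  define \<phi> where "\<phi> y = ?c * normal_density 0 (sqrt r) y" for y
  have \<phi>: "\<phi> y = exp ((r - y^2) / (2 * r))" for y
  proof -
    have "(r - y^2) / (2 * r) = 1/2 + (- (y^2) / (2 * r))" using r by (simp add: field_simps)
    then have "exp ((r - y^2) / (2 * r)) = exp (1/2) * exp (- (y^2) / (2 * r))" by (simp only: exp_add)
    then show ?thesis using r unfolding \<phi>_def normal_density_def by simp
  qed
  have "emeasure ?L (energy_ball n r) = (\<integral>\<^sup>+ y. indicator (energy_ball n r) y \<partial>?L)"
    using energy_ball_sets[of n r] by (intro nn_integral_indicator[symmetric]) (simp cong: sets_PiM_cong)
  also have "\<dots> \<le> (\<integral>\<^sup>+ y. (\<Prod>t\<in>{..<n}. ennreal (\<phi> (y t))) \<partial>?L)"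
  proof (rule nn_integral_mono)
    fix y
    show "indicator (energy_ball n r) y \<le> (\<Prod>t\<in>{..<n}. ennreal (\<phi> (y t)))"
    proof (cases "y \<in> energy_ball n r")
      case True
      have "(\<Prod>t\<in>{..<n}. \<phi> (y t)) = exp (\<Sum>t<n. (r - (y t)^2) / (2 * r))" by (simp add: \<phi> exp_sum)
      also have "(\<Sum>t<n. (r - (y t)^2) / (2 * r)) = (real n * r - (\<Sum>t<n. (y t)^2)) / (2 * r)"
        by (simp add: sum_divide_distrib[symmetric] sum_subtractf)
      also have "exp \<dots> \<ge> 1" using True r by (simp add: energy_ball_def)
      finally have "1 \<le> (\<Prod>t\<in>{..<n}. \<phi> (y t))" .
      then have "1 \<le> ennreal (\<Prod>t\<in>{..<n}. \<phi> (y t))" by simp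
      also have "ennreal (\<Prod>t\<in>{..<n}. \<phi> (y t)) = (\<Prod>t\<in>{..<n}. ennreal (\<phi> (y t)))"
        by (intro prod_ennreal[symmetric]) (simp add: \<phi>)
      finally show ?thesis using True by simp
    qed simp
  qed
  also have "\<dots> = (\<Prod>t\<in>{..<n}. \<integral>\<^sup>+ x. ennreal (\<phi> x) \<partial>lborel)"
    by (rule L.product_nn_integral_prod) (auto simp: \<phi>_def)
  also have "(\<integral>\<^sup>+ x. ennreal (\<phi> x) \<partial>lborel) =
    ennreal ?c * (\<integral>\<^sup>+ x. ennreal (normal_density 0 (sqrt r) x) \<partial>lborel)"
    unfolding \<phi>_def using r by (simp add: ennreal_mult nn_integral_cmult)
  also have "(\<integral>\<^sup>+ x. ennreal (normal_density 0 (sqrt r) x) \<partial>lborel) = 1"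
  proof -
    interpret prob_space "gauss (sqrt r)" using r by (intro prob_space_gauss) simp
    have "emeasure (gauss (sqrt r)) UNIV = 1" using emeasure_space_1 by simp
    then show ?thesis by (simp add: emeasure_density)
  qed
  also have "(\<Prod>t\<in>{..<n}. ennreal ?c * 1) = ennreal (?c ^ n)"
    using r by (simp add: ennreal_power)
  also have "?c = sqrt (2 * pi * exp 1 * r)"
  proof -
    have "exp (1/2) = sqrt (exp (1::real))"
      by (rule real_sqrt_unique[symmetric]) (auto simp: power2_eq_square simp flip: exp_add)
    then show ?thesis by (simp add: real_sqrt_mult)
  qed
  finally show ?thesis .
qed

text \<open>Markov's inequality, since the expected energy of the received block is the energy of
  \<open>x\<close> plus \<open>n\<close>.\<close>

lemma gaussian_energy_tail:
  assumes r: "r > 0" and n: "n > 0"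
  shows "emeasure (gaussian_noise n) {z \<in> space (gaussian_noise n). (\<lambda>t\<in>{..<n}. x t + z t) \<notin> energy_ball n r}
    \<le> ennreal ((\<Sum>t<n. (x t)^2) / (real n * r) + 1 / r)"
proof -
  let ?G = "gaussian_noise n"
  interpret prob_space ?G by (rule prob_space_gaussian_noise)
  have comp: "(\<lambda>z. z t) \<in> borel_measurable ?G" if "t < n" for t
  proof -
    have "(\<lambda>z. z t) \<in> measurable (PiM {..<n} (\<lambda>_. borel :: real measure)) borel"
      using that by (intro measurable_component_singleton) auto
    then show ?thesis by (simp cong: measurable_cong_sets add: sets_gaussian_noise measurable_cong_sets[OF sets_gaussian_noise refl])
  qed
  have fm: "(\<lambda>z. \<Sum>t<n. (x t + z t)^2) \<in> borel_measurable ?G"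
    using comp by (intro borel_measurable_sum borel_measurable_power borel_measurable_add) auto
  have one: "(\<integral>\<^sup>+ z. ennreal ((a + z)^2) \<partial>gauss 1) = ennreal (a^2 + 1)" for a
  proof -
    have h0: "has_bochner_integral lborel (\<lambda>z. normal_density 0 1 z) 1"
      using std_normal_moment_even[of 0] by simp
    have h1: "has_bochner_integral lborel (\<lambda>z. normal_density 0 1 z * z) 0"
      using normal_moment_nz_1[of 1 0] by simp
    have h2: "has_bochner_integral lborel (\<lambda>z. normal_density 0 1 z * z^2) 1"
      using std_normal_moment_even[of 1] by simp
    have "has_bochner_integral lborel (\<lambda>z. a^2 * normal_density 0 1 z +
      2 * a * (normal_density 0 1 z * z) + normal_density 0 1 z * z^2) (a^2 * 1 + 2 * a * 0 + 1)"
      by (intro has_bochner_integral_add has_bochner_integral_mult_right h0 h1 h2)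
    then have hb: "has_bochner_integral lborel (\<lambda>z. normal_density 0 1 z * (a + z)^2) (a^2 + 1)"
      by (simp add: power2_eq_square algebra_simps)
    have "(\<integral>\<^sup>+ z. ennreal ((a + z)^2) \<partial>gauss 1) = (\<integral>\<^sup>+ z. ennreal (normal_density 0 1 z * (a + z)^2) \<partial>lborel)"
      by (subst nn_integral_density) (auto simp: ennreal_mult)
    also have "\<dots> = ennreal (a^2 + 1)"
      using has_bochner_integral_nn_integral hb nn_integral_eq_integral[of lborel "\<lambda>z. normal_density 0 1 z * (a + z)^2"]
      by (auto simp: has_bochner_integral_iff)
    finally show ?thesis .
  qed
  have coord: "(\<integral>\<^sup>+ z. ennreal ((x t + z t)^2) \<partial>?G) = ennreal ((x t)^2 + 1)" if t: "t < n" for t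
  proof -
    have "distr ?G (gauss 1) (\<lambda>z. z t) = gauss 1"
      unfolding gaussian_noise_def using t by (intro distr_PiM_component prob_space_gauss) auto
    then have "(\<integral>\<^sup>+ z. ennreal ((x t + z)^2) \<partial>gauss 1) =
      (\<integral>\<^sup>+ z. ennreal ((x t + z)^2) \<partial>distr ?G (gauss 1) (\<lambda>z. z t))" by simp
    also have "\<dots> = (\<integral>\<^sup>+ z. ennreal ((x t + z t)^2) \<partial>?G)"
      using comp[OF t] by (intro nn_integral_distr) (auto cong: measurable_cong_sets)
    finally show ?thesis using one by simp
  qed
  have "emeasure ?G {z \<in> space ?G. (\<lambda>t\<in>{..<n}. x t + z t) \<notin> energy_ball n r} \<le>
     emeasure ?G {z \<in> space ?G. 1 \<le> ennreal (1 / (real n * r)) * ennreal (\<Sum>t<n. (x t + z t)^2)}"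
  proof (rule emeasure_mono)
    show "{z \<in> space ?G. (\<lambda>t\<in>{..<n}. x t + z t) \<notin> energy_ball n r} \<subseteq>
      {z \<in> space ?G. 1 \<le> ennreal (1 / (real n * r)) * ennreal (\<Sum>t<n. (x t + z t)^2)}"
    proof clarify
      fix z assume "(\<lambda>t\<in>{..<n}. x t + z t) \<notin> energy_ball n r"
      then have "real n * r < (\<Sum>t<n. (x t + z t)^2)"
        by (auto simp: energy_ball_def space_PiM not_le)
      then have "1 \<le> 1 / (real n * r) * (\<Sum>t<n. (x t + z t)^2)" using r n by (simp add: field_simps)
      then have "1 \<le> ennreal (1 / (real n * r) * (\<Sum>t<n. (x t + z t)^2))" by simp
      also have "ennreal (1 / (real n * r) * (\<Sum>t<n. (x t + z t)^2)) =
        ennreal (1 / (real n * r)) * ennreal (\<Sum>t<n. (x t + z t)^2)"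
        using r by (intro ennreal_mult sum_nonneg) auto
      finally show "1 \<le> ennreal (1 / (real n * r)) * ennreal (\<Sum>t<n. (x t + z t)^2)" .
    qed
    show "{z \<in> space ?G. 1 \<le> ennreal (1 / (real n * r)) * ennreal (\<Sum>t<n. (x t + z t)^2)} \<in> sets ?G"
      using fm by measurable
  qed
  also have "\<dots> \<le> ennreal (1 / (real n * r)) * (\<integral>\<^sup>+ z. ennreal (\<Sum>t<n. (x t +
    z t)^2) * indicator (space ?G) z \<partial>?G)"
    using fm nn_integral_Markov_inequality[where u = "\<lambda>z. ennreal (\<Sum>t<n. (x t + z t)^2)" and M = ?G and A =
      "space ?G" and c = "ennreal (1 / (real n * r))"] by simp
  also have "(\<integral>\<^sup>+ z. ennreal (\<Sum>t<n. (x t + z t)^2) * indicator (space ?G) z \<partial>?G) =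
    (\<integral>\<^sup>+ z. (\<Sum>t<n. ennreal ((x t + z t)^2)) \<partial>?G)"
    by (intro nn_integral_cong) (simp add: sum_ennreal)
  also have "\<dots> = (\<Sum>t<n. \<integral>\<^sup>+ z. ennreal ((x t + z t)^2) \<partial>?G)"
    using comp by (intro nn_integral_sum) auto
  also have "\<dots> = (\<Sum>t<n. ennreal ((x t)^2 + 1))" using coord by (intro sum.cong) auto
  also have "\<dots> = ennreal (\<Sum>t<n. (x t)^2 + 1)" by (intro sum_ennreal) simp
  also have "(\<Sum>t<n. (x t)^2 + 1) = (\<Sum>t<n. (x t)^2) + real n" by (simp add: sum.distrib)
  also have "ennreal (1 / (real n * r)) * \<dots> = ennreal (1 / (real n * r) * ((\<Sum>t<n. (x t)^2) + real n))"
    using r by (intro ennreal_mult[symmetric] add_nonneg_nonneg sum_nonneg) auto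
  also have "1 / (real n * r) * ((\<Sum>t<n. (x t)^2) + real n) = (\<Sum>t<n. (x t)^2) / (real n * r) + 1 / r"
    using r n by (simp add: field_simps)
  finally show ?thesis .
qed

section \<open>The volume bound for a single code\<close>

lemma sum_UNIV_sum: "(\<Sum>\<kappa>\<in>(UNIV :: ('a::finite + 'b::finite) set). f \<kappa>) = (\<Sum>j\<in>UNIV. f (Inl j)) +
  (\<Sum>d\<in>UNIV. f (Inr d))"
  by (subst UNIV_sum, subst sum.union_disjoint) (auto simp: sum.reindex)

lemma normal_density_le: "0 < s \<Longrightarrow> normal_density 0 s x \<le> 1 / sqrt (2 * pi * s\<^sup>2)"
  by (simp add: normal_density_def divide_right_mono)

text \<open>Decoder \<open>d\<close> belongs to user \<open>u d\<close> and has the channel vector \<open>\<Sum>j. a d j *\<^sub>R g j\<close>. The decoders \<open>dj j\<close>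
  are those of user \<open>k\<close> in \<open>CARD('m)\<close> of its states, with the channel vectors \<open>g j\<close>.\<close>

locale converse_setup =
  fixes n :: nat and L :: "'n::finite \<Rightarrow> nat" and enc :: "('n \<Rightarrow> nat) \<Rightarrow> nat \<Rightarrow> real ^ 'm::finite"
    and g :: "'m \<Rightarrow> real ^ 'm" and a :: "'d::finite \<Rightarrow> 'm \<Rightarrow> real"
    and dec :: "'d \<Rightarrow> (nat \<Rightarrow> real) \<Rightarrow> nat" and u :: "'d \<Rightarrow> 'n" and k :: 'n and dj :: "'m \<Rightarrow> 'd"
    and \<sigma> \<epsilon> P r :: real
  assumes n: "n > 0" and L: "\<And>l. L l > 0" and \<sigma>: "0 < \<sigma>" "\<And>d. \<sigma>\<^sup>2 * (\<Sum>j\<in>UNIV. (a d j)\<^sup>2) < 1"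
    and dj: "inj dj" "\<And>j. u (dj j) = k" "\<And>j i. a (dj j) i = (if i = j then 1 else 0)"
    and cover: "\<And>l. \<exists>d. u d = l"
    and dec: "\<And>d. dec d \<in> measurable (PiM {..<n} (\<lambda>_. borel)) (count_space UNIV)"
    and err: "\<And>d. error_prob n L enc (u d) (\<Sum>j\<in>UNIV. a d j *\<^sub>R g j) (dec d) \<le> \<epsilon>"
    and \<epsilon>: "real CARD('d) * \<epsilon> \<le> 1/8"
    and power: "average_power n L enc \<le> P"
    and r: "r > 0" "\<And>j. 8 * real CARD('m) * ((norm (g j))\<^sup>2 * P + 1) \<le> r"
begin

definition gd :: "'d \<Rightarrow> real ^ 'm" where "gd d = (\<Sum>j\<in>UNIV. a d j *\<^sub>R g j)"

text \<open>The unit noise of decoder \<open>d\<close> is split as \<open>(\<Sum>j. a d j * \<eta> j) + v d\<close>, with \<open>\<eta> j\<close> at \<open>Inl j\<close> of variance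
  \<open>\<sigma>\<^sup>2\<close> and \<open>v d\<close> at \<open>Inr d\<close>.\<close>

definition coef :: "'d \<Rightarrow> 'm + 'd \<Rightarrow> real" where
  "coef d \<kappa> = (case \<kappa> of Inl j \<Rightarrow> a d j | Inr d' \<Rightarrow> if d' = d then 1 else 0)"

definition sd :: "'m + 'd \<Rightarrow> real" where
  "sd \<kappa> = (case \<kappa> of Inl _ \<Rightarrow> \<sigma> | Inr d \<Rightarrow> sqrt (1 - \<sigma>\<^sup>2 * (\<Sum>j\<in>UNIV. (a d j)\<^sup>2)))"

definition G :: "('m + 'd) \<times> nat \<Rightarrow> real measure" where "G = (\<lambda>(\<kappa>, t). gauss (sd \<kappa>))"

definition \<Omega> :: "(('m + 'd) \<times> nat \<Rightarrow> real) measure" where "\<Omega> = PiM (UNIV \<times> {..<n}) G"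

definition noise :: "'d \<Rightarrow> (('m + 'd) \<times> nat \<Rightarrow> real) \<Rightarrow> nat \<Rightarrow> real" where
  "noise d \<omega> = (\<lambda>t\<in>{..<n}. \<Sum>\<kappa>\<in>UNIV. coef d \<kappa> * \<omega> (\<kappa>, t))"

text \<open>The energy condition concerns the decoders \<open>dj j\<close>, whose decoding sets will
  enter through their volumes; inside the ball these are finite.\<close>

definition correct :: "('n \<Rightarrow> nat) \<Rightarrow> (('m + 'd) \<times> nat \<Rightarrow> real) \<Rightarrow> bool" where
  "correct w \<omega> \<longleftrightarrow> (\<forall>d. dec d (received n (gd d) (enc w) (noise d \<omega>)) = w (u d)) \<and>
     (\<forall>j. received n (gd (dj j)) (enc w) (noise (dj j) \<omega>) \<in> energy_ball n r)"

lemma sd_pos: "0 < sd \<kappa>"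
  using \<sigma> by (auto simp: sd_def split: sum.split)

lemma prob_space_G: "prob_space (G i)"
  unfolding G_def using sd_pos by (auto simp: case_prod_unfold intro!: prob_space_gauss)

sublocale \<Omega>: prob_space \<Omega>
  unfolding \<Omega>_def by (intro prob_space_PiM prob_space_G)

lemma sets_G: "sets (G i) = sets borel"
  by (simp add: G_def case_prod_unfold)

lemma sets_PiM_G: "sets (PiM I G) = sets (PiM I (\<lambda>_. borel))"
  by (intro sets_PiM_cong refl sets_G)

lemma noise_measurable: "noise d \<in> measurable (PiM (UNIV \<times> {..<n}) (\<lambda>_. borel)) (PiM {..<n} (\<lambda>_. borel))"
  unfolding noise_def
  by (rule measurable_restrict)
     (intro borel_measurable_sum borel_measurable_times borel_measurable_const measurable_component_singleton, auto)

text \<open>The part \<open>\<sigma>\<^sup>2 * (\<Sum>j\<in>UNIV. (a d j)\<^sup>2)\<close> of the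
  variance and its complement to 1 add up. So each decoder meets noise of the prescribed law,
  although the noises of different decoders are dependent, and every single error probability is the
  same on \<open>\<Omega>\<close>.\<close>

lemma noise_distr: "distr \<Omega> (PiM {..<n} (\<lambda>_. borel)) (noise d) = gaussian_noise n"
proof -
  have "(\<Sum>\<kappa>\<in>UNIV. (coef d \<kappa>)\<^sup>2 * (sd \<kappa>)\<^sup>2) = (\<Sum>j\<in>UNIV. (coef d (Inl j))\<^sup>2 * (sd (Inl j))\<^sup>2) +
    (\<Sum>d'\<in>UNIV. (coef d (Inr d'))\<^sup>2 * (sd (Inr d'))\<^sup>2)"
    by (subst UNIV_sum, subst sum.union_disjoint) (auto simp: sum.reindex)
  also have "(\<Sum>j\<in>UNIV. (coef d (Inl j))\<^sup>2 * (sd (Inl j))\<^sup>2) = \<sigma>\<^sup>2 * (\<Sum>j\<in>UNIV. (a d j)\<^sup>2)"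
    by (simp add: coef_def sd_def sum_distrib_left mult.commute)
  also have "(\<Sum>d'\<in>UNIV. (coef d (Inr d'))\<^sup>2 * (sd (Inr d'))\<^sup>2) =
    (\<Sum>d'\<in>UNIV. if d' = d then (sd (Inr d))\<^sup>2 else 0)"
    by (intro sum.cong) (auto simp: coef_def)
  also have "\<dots> = 1 - \<sigma>\<^sup>2 * (\<Sum>j\<in>UNIV. (a d j)\<^sup>2)"
    using \<sigma>(2)[of d] by (simp add: sd_def)
  finally have "(\<Sum>\<kappa>\<in>UNIV. (coef d \<kappa>)\<^sup>2 * (sd \<kappa>)\<^sup>2) = 1" by simp
  from gaussian_combination[OF _ _ n this] show ?thesis
    using sd_pos unfolding \<Omega>_def G_def noise_def by simp
qed

lemma noise_prob:
  assumes "Z \<in> sets (PiM {..<n} (\<lambda>_. borel))"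
  shows "measure \<Omega> {\<omega> \<in> space \<Omega>. noise d \<omega> \<in> Z} = measure (gaussian_noise n) Z"
proof -
  have "noise d \<in> measurable \<Omega> (PiM {..<n} (\<lambda>_. borel))"
    using noise_measurable by (simp add: \<Omega>_def measurable_cong_sets[OF sets_PiM_G refl])
  then have "measure (distr \<Omega> (PiM {..<n} (\<lambda>_. borel)) (noise d)) Z = measure \<Omega> (noise d -` Z \<inter> space \<Omega>)"
    by (rule measure_distr) (rule assms)
  then show ?thesis by (simp add: noise_distr vimage_def Int_def conj_commute)
qed

lemma received_measurable: "received n h x \<in> measurable (PiM {..<n} (\<lambda>_. borel)) (PiM {..<n} (\<lambda>_. borel))"
  unfolding received_def
  by (rule measurable_restrict) (intro borel_measurable_add borel_measurable_const measurable_component_singleton, auto)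

lemma dec_sets:
  "{z \<in> space (PiM {..<n} (\<lambda>_. borel)). dec d (received n h x z) = c} \<in> sets (PiM {..<n} (\<lambda>_. borel))"
proof -
  have "(\<lambda>z. dec d (received n h x z)) \<in> measurable (PiM {..<n} (\<lambda>_. borel)) (count_space UNIV)"
    by (rule measurable_compose[OF received_measurable dec])
  from measurable_sets[OF this, of "{c}"] show ?thesis by (simp add: vimage_def Int_def conj_commute)
qed

lemma ball_sets:
  "{z \<in> space (PiM {..<n} (\<lambda>_. borel)). received n h x z \<in> energy_ball n r} \<in> sets (PiM {..<n} (\<lambda>_. borel))"
  using measurable_sets[OF received_measurable energy_ball_sets]
    by (simp add: vimage_def Int_def conj_commute)

lemma correct_measurable: "{\<omega> \<in> space (PiM (UNIV \<times> {..<n}) (\<lambda>_. borel)). correct w \<omega>} \<in> sets (PiM (UNIV \<times> {..<n}) (\<lambda>_. borel))"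
proof -
  let ?M = "PiM (UNIV \<times> {..<n} :: (('m + 'd) \<times> nat) set) (\<lambda>_. borel :: real measure)"
  have 1: "{\<omega> \<in> space ?M. dec d (received n (gd d) (enc w) (noise d \<omega>)) = w (u d)} \<in> sets ?M" for d
  proof -
    have "(\<lambda>\<omega>. dec d (received n (gd d) (enc w) (noise d \<omega>))) \<in> measurable ?M (count_space UNIV)"
      by (rule measurable_compose[OF measurable_compose[OF noise_measurable received_measurable] dec])
    from measurable_sets[OF this, of "{w (u d)}"] show ?thesis by (simp add: vimage_def Int_def conj_commute)
  qed
  have 2: "{\<omega> \<in> space ?M. received n (gd (dj j)) (enc w) (noise (dj j) \<omega>) \<in> energy_ball n r} \<in> sets ?M" for j
    using measurable_sets[OF measurable_compose[OF noise_measurable received_measurable] energy_ball_sets]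
    by (simp add: vimage_def Int_def conj_commute)
  have "{\<omega> \<in> space ?M. (\<forall>d\<in>UNIV. dec d (received n (gd d) (enc w) (noise d \<omega>)) = w (u d)) \<and>
     (\<forall>j\<in>UNIV. received n (gd (dj j)) (enc w) (noise (dj j) \<omega>) \<in> energy_ball n r)} \<in> sets ?M"
    by (intro sets.sets_Collect_conj sets.sets_Collect_finite_All 1 2) auto
  then show ?thesis by (simp add: correct_def)
qed

lemma space_\<Omega>: "space \<Omega> = space (PiM (UNIV \<times> {..<n}) (\<lambda>_. borel))"
  using sets_eq_imp_space_eq[OF sets_PiM_G] by (simp add: \<Omega>_def)

lemma correct_sets: "{\<omega> \<in> space \<Omega>. correct w \<omega>} \<in> sets \<Omega>"
  using correct_measurable[of w] by (simp add: space_\<Omega>) (simp add: \<Omega>_def sets_PiM_G)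

lemma finite_message_tuples: "finite (message_tuples L)"
  unfolding message_tuples_def by (intro finite_PiE) auto

lemma card_message_tuples: "card (message_tuples L) = (\<Prod>l\<in>UNIV. L l)"
  unfolding message_tuples_def by (subst card_PiE) auto

lemma card_message_tuples_pos: "0 < card (message_tuples L)"
  unfolding card_message_tuples using L by (intro prod_pos) auto

text \<open>A union bound over failure events. Each event involves the noise of one decoder only, so
  its probability may be computed under \<open>gaussian_noise n\<close>.\<close>

lemma incorrect_prob_le:
  "1 - measure \<Omega> {\<omega> \<in> space \<Omega>. correct w \<omega>} \<le>
     (\<Sum>d\<in>UNIV. measure (gaussian_noise n) {z \<in> space (gaussian_noise n). dec d (received n (gd d) (enc w) z) \<noteq> w (u d)}) +
     (\<Sum>j\<in>UNIV. (\<Sum>t<n. (inner (g j) (enc w t))\<^sup>2) / (real n * r) + 1 / r)"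
proof -
  have spG: "space (gaussian_noise n) = space (PiM {..<n} (\<lambda>_. borel))"
    by (rule sets_eq_imp_space_eq[OF sets_gaussian_noise])
  define Z where "Z d = {z \<in> space (PiM {..<n} (\<lambda>_. borel)). dec d (received n (gd d) (enc w) z) \<noteq> w (u d)}"
    for d
  define B where "B j = {z \<in> space (PiM {..<n} (\<lambda>_. borel)). received n (gd (dj j)) (enc w) z \<notin> energy_ball n r}" for j
  have Z: "Z d \<in> sets (PiM {..<n} (\<lambda>_. borel))" for d
    using dec_sets[of d "gd d" "enc w" "w (u d)"] unfolding Z_def by (intro sets.sets_Collect_neg)
  have B: "B j \<in> sets (PiM {..<n} (\<lambda>_. borel))" for j
    using ball_sets unfolding B_def by (intro sets.sets_Collect_neg)
  let ?NZ = "\<lambda>d. {\<omega> \<in> space \<Omega>. noise d \<omega> \<in> Z d}" and ?NB = "\<lambda>j. {\<omega> \<in> space \<Omega>. noise (dj j) \<omega> \<in> B j}"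
  have sp: "noise d \<omega> \<in> space (PiM {..<n} (\<lambda>_. borel))" for d \<omega> by (simp add: noise_def space_PiM)
  have nm: "noise d \<in> measurable \<Omega> (PiM {..<n} (\<lambda>_. borel))" for d
    using noise_measurable by (simp add: \<Omega>_def measurable_cong_sets[OF sets_PiM_G refl])
  have NZ: "?NZ d \<in> sets \<Omega>" for d using measurable_sets[OF nm Z]
    by (simp add: vimage_def Int_def conj_commute)
  have NB: "?NB j \<in> sets \<Omega>" for j using measurable_sets[OF nm B]
    by (simp add: vimage_def Int_def conj_commute)
  have "1 - measure \<Omega> {\<omega> \<in> space \<Omega>. correct w \<omega>} = measure \<Omega> (space \<Omega> - {\<omega> \<in> space \<Omega>. correct w \<omega>})"
    using \<Omega>.prob_compl[OF correct_sets] by simp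
  also have "space \<Omega> - {\<omega> \<in> space \<Omega>. correct w \<omega>} = (\<Union>d\<in>UNIV. ?NZ d) \<union> (\<Union>j\<in>UNIV. ?NB j)"
    using sp by (auto simp: correct_def Z_def B_def)
  also have "measure \<Omega> \<dots> \<le> measure \<Omega> (\<Union>d\<in>UNIV. ?NZ d) + measure \<Omega> (\<Union>j\<in>UNIV. ?NB j)"
    using NZ NB by (intro measure_Un_le sets.finite_UN) auto
  also have "\<dots> \<le> (\<Sum>d\<in>UNIV. measure \<Omega> (?NZ d)) + (\<Sum>j\<in>UNIV. measure \<Omega> (?NB j))"
    using NZ NB by (intro add_mono measure_UNION_le) auto
  also have "(\<Sum>d\<in>UNIV. measure \<Omega> (?NZ d)) = (\<Sum>d\<in>UNIV. measure (gaussian_noise n) (Z d))"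
    by (intro sum.cong refl noise_prob Z)
  also have "(\<Sum>j\<in>UNIV. measure \<Omega> (?NB j)) \<le>
    (\<Sum>j\<in>UNIV. (\<Sum>t<n. (inner (g j) (enc w t))\<^sup>2) / (real n * r) + 1 / r)"
  proof (rule sum_mono)
    fix j :: 'm
    interpret N: prob_space "gaussian_noise n" by (rule prob_space_gaussian_noise)
    have gdj: "gd (dj j) = g j"
    proof -
      have "gd (dj j) = (\<Sum>i\<in>UNIV. if i = j then g j else 0)"
        unfolding gd_def by (intro sum.cong) (auto simp: dj(3))
      then show ?thesis by simp
    qed
    have Bj: "B j = {z \<in> space (gaussian_noise n). (\<lambda>t\<in>{..<n}. inner (g j) (enc w t) +
      z t) \<notin> energy_ball n r}"
      by (simp add: B_def spG received_def gdj)
    have "ennreal (measure (gaussian_noise n) (B j)) = emeasure (gaussian_noise n) (B j)"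
      by (simp add: N.emeasure_eq_measure)
    also have "\<dots> \<le> ennreal ((\<Sum>t<n. (inner (g j) (enc w t))\<^sup>2) / (real n * r) + 1 / r)"
      unfolding Bj by (rule gaussian_energy_tail[OF r(1) n])
    finally have "measure (gaussian_noise n) (B j) \<le> (\<Sum>t<n. (inner (g j) (enc w t))\<^sup>2) / (real n * r) + 1 / r"
      using r(1) by (subst (asm) ennreal_le_iff) (auto intro!: add_nonneg_nonneg divide_nonneg_nonneg sum_nonneg)
    then show "measure \<Omega> (?NB j) \<le> (\<Sum>t<n. (inner (g j) (enc w t))\<^sup>2) / (real n * r) + 1 / r"
      using noise_prob[OF B] by simp
  qed
  finally show ?thesis by (simp add: Z_def spG)
qed

text \<open>On average at most one eighth comes from decoding errors, by the size of
  \<open>\<epsilon>\<close>, and at most one eighth from blocks that leave the energy ball, by the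
  power constraint and the size of \<open>r\<close>.\<close>

lemma incorrect_prob_sum_le:
  "(\<Sum>w\<in>message_tuples L. 1 - measure \<Omega> {\<omega> \<in> space \<Omega>. correct w \<omega>}) \<le> real (card (message_tuples L)) / 4"
proof -
  let ?T = "message_tuples L"
  define N where "N = real (card ?T)"
  have N: "N > 0" using card_message_tuples_pos by (simp add: N_def)
  have e: "(\<Sum>w\<in>?T. measure (gaussian_noise n) {z \<in> space (gaussian_noise n). dec d (received n (gd d) (enc w) z) \<noteq> w (u d)}) \<le> N * \<epsilon>" for d
    using err[of d] N unfolding error_prob_def gd_def[symmetric] N_def[symmetric] by (simp add: field_simps)
  have pw: "(\<Sum>w\<in>?T. \<Sum>t<n. (norm (enc w t))\<^sup>2) \<le> N * real n * P"
    using power N n unfolding average_power_def N_def[symmetric]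
      by (simp add: sum_divide_distrib[symmetric] field_simps)
  have b: "(\<Sum>w\<in>?T. (\<Sum>t<n. (inner (g j) (enc w t))\<^sup>2) / (real n * r) + 1 / r) \<le> N / (8 * real CARD('m))" for j
  proof -
    have "(\<Sum>w\<in>?T. \<Sum>t<n. (inner (g j) (enc w t))\<^sup>2) \<le> (\<Sum>w\<in>?T. \<Sum>t<n. (norm (g j))\<^sup>2 * (norm (enc w t))\<^sup>2)"
    proof (intro sum_mono)
      fix w t
      have "\<bar>inner (g j) (enc w t)\<bar>\<^sup>2 \<le> (norm (g j) * norm (enc w t))\<^sup>2"
        by (intro power_mono Cauchy_Schwarz_ineq2) simp
      then show "(inner (g j) (enc w t))\<^sup>2 \<le> (norm (g j))\<^sup>2 * (norm (enc w t))\<^sup>2"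
        by (simp add: power_mult_distrib)
    qed
    also have "\<dots> = (norm (g j))\<^sup>2 * (\<Sum>w\<in>?T. \<Sum>t<n. (norm (enc w t))\<^sup>2)" by (simp add: sum_distrib_left)
    also have "\<dots> \<le> (norm (g j))\<^sup>2 * (N * real n * P)" by (intro mult_left_mono pw) simp
    finally have 1: "(\<Sum>w\<in>?T. \<Sum>t<n. (inner (g j) (enc w t))\<^sup>2) \<le> N * real n * ((norm (g j))\<^sup>2 * P)"
      by (simp add: mult_ac)
    have "(\<Sum>w\<in>?T. (\<Sum>t<n. (inner (g j) (enc w t))\<^sup>2) / (real n * r) + 1 / r) =
        (\<Sum>w\<in>?T. \<Sum>t<n. (inner (g j) (enc w t))\<^sup>2) / (real n * r) + N / r"
      by (simp add: sum.distrib sum_divide_distrib N_def)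
    also have "\<dots> \<le> N * real n * ((norm (g j))\<^sup>2 * P) / (real n * r) + N / r"
      using 1 r(1) n by (intro add_right_mono divide_right_mono) auto
    also have "\<dots> = N * ((norm (g j))\<^sup>2 * P + 1) / r" using n r(1) by (simp add: field_simps)
    also have "\<dots> \<le> N / (8 * real CARD('m))"
    proof -
      have "N * (8 * real CARD('m) * ((norm (g j))\<^sup>2 * P + 1)) \<le> N * r"
        using r(2)[of j] N by (intro mult_left_mono) auto
      then show ?thesis using r(1) by (simp add: field_simps)
    qed
    finally show ?thesis .
  qed
  have "(\<Sum>w\<in>?T. 1 - measure \<Omega> {\<omega> \<in> space \<Omega>. correct w \<omega>}) \<le>
     (\<Sum>w\<in>?T. (\<Sum>d\<in>UNIV. measure (gaussian_noise n) {z \<in> space (gaussian_noise n). dec d (received n (gd d) (enc w) z) \<noteq> w (u d)}) +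
     (\<Sum>j\<in>UNIV. (\<Sum>t<n. (inner (g j) (enc w t))\<^sup>2) / (real n * r) + 1 / r))"
    by (intro sum_mono incorrect_prob_le)
  also have "\<dots> = (\<Sum>d\<in>UNIV. \<Sum>w\<in>?T. measure (gaussian_noise n) {z \<in> space (gaussian_noise n). dec d (received n (gd d) (enc w) z) \<noteq> w (u d)}) +
     (\<Sum>j\<in>UNIV. \<Sum>w\<in>?T. (\<Sum>t<n. (inner (g j) (enc w t))\<^sup>2) / (real n * r) + 1 / r)"
    by (subst sum.distrib) (intro arg_cong2[where f = "(+)"] sum.swap)
  also have "\<dots> \<le> (\<Sum>d\<in>(UNIV :: 'd set). N * \<epsilon>) + (\<Sum>j\<in>(UNIV :: 'm set). N / (8 * real CARD('m)))"
    by (intro add_mono sum_mono e b)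
  also have "\<dots> = N * (real CARD('d) * \<epsilon>) + N / 8" by simp
  also have "\<dots> \<le> N * (1/8) + N / 8" using \<epsilon> N by (intro add_right_mono mult_left_mono) auto
  finally show ?thesis by (simp add: N_def)
qed

abbreviation LL :: "(nat \<Rightarrow> real) measure" where "LL \<equiv> PiM {..<n} (\<lambda>_. lborel)"

definition Ie :: "(('m + 'd) \<times> nat) set" where "Ie = range Inl \<times> {..<n}"
definition Iv :: "(('m + 'd) \<times> nat) set" where "Iv = range Inr \<times> {..<n}"

lemma Ie_Iv: "Iv \<inter> Ie = {}" "Iv \<union> Ie = UNIV \<times> {..<n}" "finite Ie" "finite Iv" "card Ie = CARD('m) * n"
  by (auto simp: Ie_def Iv_def UNIV_sum card_image card_cartesian_product)

definition region :: "'m \<Rightarrow> nat \<Rightarrow> (nat \<Rightarrow> real) set" where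
  "region j c = {y \<in> energy_ball n r. dec (dj j) y = c}"

lemma region_sets: "region j c \<in> sets (PiM {..<n} (\<lambda>_. borel))"
proof -
  have "dec (dj j) -` {c} \<inter> space (PiM {..<n} (\<lambda>_. borel)) \<in> sets (PiM {..<n} (\<lambda>_. borel))"
    by (rule measurable_sets[OF dec]) simp
  then have "energy_ball n r \<inter> (dec (dj j) -` {c} \<inter> space (PiM {..<n} (\<lambda>_. borel))) \<in> sets (PiM {..<n} (\<lambda>_. borel))"
    by (rule sets.Int[OF energy_ball_sets])
  also have "energy_ball n r \<inter> (dec (dj j) -` {c} \<inter> space (PiM {..<n} (\<lambda>_. borel))) = region j c"
    by (auto simp: region_def energy_ball_def)
  finally show ?thesis .
qed

definition shift :: "('n \<Rightarrow> nat) \<Rightarrow> ('m + 'd) \<times> nat \<Rightarrow> real" where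
  "shift w i = (case fst i of Inl j \<Rightarrow> - inner (g j) (enc w (snd i)) | Inr _ \<Rightarrow> 0)"

definition split_received :: "(('m + 'd) \<times> nat \<Rightarrow> real) \<Rightarrow> 'd \<Rightarrow> (('m + 'd) \<times> nat \<Rightarrow> real) \<Rightarrow> nat \<Rightarrow> real" where
  "split_received v d s = (\<lambda>t\<in>{..<n}. (\<Sum>j\<in>UNIV. a d j * s (Inl j, t)) + v (Inr d, t))"

text \<open>In the coordinates \<open>s j = g j \<bullet> x + \<eta> j\<close> the received signals no longer depend on the codeword.\<close>

lemma received_merge:
  "received n (gd d) (enc w) (noise d (merge Iv Ie (v, \<lambda>i\<in>Ie. s i + shift w i))) = split_received v d s"
proof
  fix t
  let ?\<omega> = "merge Iv Ie (v, \<lambda>i\<in>Ie. s i + shift w i)"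
  show "received n (gd d) (enc w) (noise d ?\<omega>) t = split_received v d s t"
  proof (cases "t < n")
    case True
    have 1: "?\<omega> (Inl j, t) = s (Inl j, t) - inner (g j) (enc w t)" for j
      using True by (auto simp: merge_def Ie_def Iv_def shift_def)
    have 2: "?\<omega> (Inr d', t) = v (Inr d', t)" for d'
      using True by (auto simp: merge_def Ie_def Iv_def)
    have "(\<Sum>d'\<in>UNIV. coef d (Inr d') * ?\<omega> (Inr d', t)) = (\<Sum>d'\<in>UNIV. if d' = d then v (Inr d, t) else 0)"
      unfolding 2 by (intro sum.cong) (auto simp: coef_def)
    then have "(\<Sum>\<kappa>\<in>UNIV. coef d \<kappa> * ?\<omega> (\<kappa>, t)) = (\<Sum>j\<in>UNIV. a d j * (s (Inl j, t) - inner (g j) (enc w t))) +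
      v (Inr d, t)"
      unfolding sum_UNIV_sum 1 by (simp add: coef_def)
    moreover have "inner (gd d) (enc w t) = (\<Sum>j\<in>UNIV. a d j * inner (g j) (enc w t))"
      by (simp add: gd_def inner_sum_left)
    ultimately show ?thesis using True
      by (simp add: received_def noise_def split_received_def right_diff_distrib sum_subtractf)
  qed (simp add: received_def split_received_def)
qed

definition ind :: "('n \<Rightarrow> nat) \<Rightarrow> (('m + 'd) \<times> nat \<Rightarrow> real) \<Rightarrow> ennreal" where
  "ind w = indicator {\<omega> \<in> space (PiM (UNIV \<times> {..<n}) (\<lambda>_. borel)). correct w \<omega>}"

lemma ind_measurable: "ind w \<in> borel_measurable (PiM (UNIV \<times> {..<n}) (\<lambda>_. borel))"
  unfolding ind_def by (rule borel_measurable_indicator) (rule correct_measurable)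

lemma merge_measurable_right:
  assumes v: "v \<in> space (PiM Iv (\<lambda>_. borel))"
  shows "(\<lambda>e. merge Iv Ie (v, e)) \<in> measurable (PiM Ie (\<lambda>_. borel)) (PiM (UNIV \<times> {..<n}) (\<lambda>_. borel :: real measure))"
proof -
  have "(\<lambda>e. (v, e)) \<in> measurable (PiM Ie (\<lambda>_. borel)) (PiM Iv (\<lambda>_. borel) \<Otimes>\<^sub>M PiM Ie (\<lambda>_. borel))"
    using v by simp
  from measurable_compose[OF this measurable_merge] show ?thesis unfolding Ie_Iv(2) .
qed

text \<open>For fixed \<open>v\<close> these are the coordinates at which all the decoders
  \<open>dj j\<close> of user \<open>k\<close> output \<open>c\<close> inside the ball. The residual
  noise \<open>v\<close> only translates the blocks, so the measure of the set does not depend on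
  it.\<close>

definition signal_set :: "nat \<Rightarrow> (('m + 'd) \<times> nat \<Rightarrow> real) \<Rightarrow> (('m + 'd) \<times> nat \<Rightarrow> real) set" where
  "signal_set c v = {s \<in> space (PiM (range Inl \<times> {..<n}) (\<lambda>_. lborel)). \<forall>\<kappa>\<in>range Inl. (\<lambda>t\<in>{..<n}. s (\<kappa>, t)) \<in>
      (case \<kappa> of Inl j \<Rightarrow> {y \<in> space LL. (\<lambda>t\<in>{..<n}. y t + v (Inr (dj j), t)) \<in> region j c} | Inr _ \<Rightarrow> {})}"

lemma signal_set:
  "signal_set c v \<in> sets (PiM Ie (\<lambda>_. lborel))"
  "emeasure (PiM Ie (\<lambda>_. lborel)) (signal_set c v) = (\<Prod>j\<in>UNIV. emeasure LL (region j c))"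
proof -
  define E where "E \<kappa> = (case \<kappa> of Inl j \<Rightarrow> {y \<in> space LL. (\<lambda>t\<in>{..<n}. y t +
    v (Inr (dj j), t)) \<in> region j c} | Inr _ \<Rightarrow> {})"
    for \<kappa> :: "'m + 'd"
  have T: "(\<lambda>y. \<lambda>t\<in>{..<n}. y t + v (Inr (dj j), t)) \<in> measurable LL LL" for j
    by measurable
  have reg: "region j c \<in> sets LL" for j using region_sets[of j c] by (simp cong: sets_PiM_cong)
  have EL: "E (Inl j) \<in> sets LL" "emeasure LL (E (Inl j)) = emeasure LL (region j c)" for j
  proof -
    have eq: "E (Inl j) = (\<lambda>y. \<lambda>t\<in>{..<n}. y t + v (Inr (dj j), t)) -` region j c \<inter> space LL"
      by (auto simp: E_def)
    show "E (Inl j) \<in> sets LL" unfolding eq by (rule measurable_sets[OF T reg])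
    have "emeasure LL (region j c) = emeasure (distr LL LL (\<lambda>y. \<lambda>t\<in>{..<n}. y t +
      v (Inr (dj j), t))) (region j c)"
      using PiM_lborel_translate[of "{..<n}" "\<lambda>t. v (Inr (dj j), t)"] by simp
    also have "\<dots> = emeasure LL (E (Inl j))" unfolding eq by (rule emeasure_distr[OF T reg])
    finally show "emeasure LL (E (Inl j)) = emeasure LL (region j c)" by simp
  qed
  have Es: "E \<kappa> \<in> sets (PiM {..<n} (\<lambda>_. borel))" if "\<kappa> \<in> range Inl" for \<kappa>
    using that EL(1) by (auto cong: sets_PiM_cong)
  have fin: "finite (range Inl :: ('m + 'd) set)" by simp
  note blocks = emeasure_PiM_blocks[OF fin Es]
  show "signal_set c v \<in> sets (PiM Ie (\<lambda>_. lborel))"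
    using blocks(1) unfolding signal_set_def Ie_def E_def .
  have "emeasure (PiM Ie (\<lambda>_. lborel)) (signal_set c v) = (\<Prod>\<kappa>\<in>range Inl. emeasure LL (E \<kappa>))"
    using blocks(2) unfolding signal_set_def Ie_def E_def .
  also have "\<dots> = (\<Prod>j\<in>UNIV. emeasure LL (region j c))"
    by (subst prod.reindex) (auto simp: EL(2))
  finally show "emeasure (PiM Ie (\<lambda>_. lborel)) (signal_set c v) = (\<Prod>j\<in>UNIV. emeasure LL (region j c))" .
qed

text \<open>Given \<open>s\<close> and \<open>v\<close> all decoder outputs are fixed, and by
  \<open>cover\<close> they determine the whole message tuple. So at most one tuple of
  \<open>T\<close> is decoded correctly, and only where the decoders of user \<open>k\<close> agree
  on \<open>c\<close>.\<close>

lemma sum_ind_le: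
  assumes T: "T \<subseteq> {w. w k = c}" "finite T" and s: "s \<in> space (PiM Ie (\<lambda>_. lborel))"
  shows "(\<Sum>w\<in>T. ind w (merge Iv Ie (v, \<lambda>i\<in>Ie. s i + shift w i))) \<le> indicator (signal_set c v) s"
proof -
  let ?\<omega> = "\<lambda>w. merge Iv Ie (v, \<lambda>i\<in>Ie. s i + shift w i)"
  define X where "X = {w\<in>T. correct w (?\<omega> w)}"
  have out: "dec d (split_received v d s) = w (u d)" "split_received v (dj j) s \<in> energy_ball n r" if "w \<in> X"
    for w d j
    using that unfolding X_def correct_def received_merge by auto
  have "(\<Sum>w\<in>T. ind w (?\<omega> w)) \<le> (\<Sum>w\<in>T. if w \<in> X then 1 else 0)"
    by (intro sum_mono) (auto simp: ind_def X_def split: split_indicator)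
  also have "\<dots> = of_nat (card X)"
  proof -
    have "T \<inter> {w. w \<in> X} = X" by (auto simp: X_def)
    then show ?thesis using T(2) by (simp add: sum.If_cases)
  qed
  also have "\<dots> \<le> indicator (signal_set c v) s"
  proof (cases "X = {}")
    case False
    then obtain w where w: "w \<in> X" by auto
    have "X \<subseteq> {w}"
    proof
      fix w' assume w': "w' \<in> X"
      have "w' l = w l" for l using cover[of l] out(1)[OF w] out(1)[OF w'] by metis
      then show "w' \<in> {w}" by auto
    qed
    then have c1: "card X \<le> 1" using card_mono[of "{w}" X] by simp
    have "s \<in> signal_set c v" unfolding signal_set_def
    proof (intro CollectI conjI ballI)
      show "s \<in> space (PiM (range Inl \<times> {..<n}) (\<lambda>_. lborel))" using s by (simp add: Ie_def)
      fix \<kappa> :: "'m + 'd" assume "\<kappa> \<in> range Inl"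
      then obtain j where \<kappa>: "\<kappa> = Inl j" by auto
      have "(\<Sum>i\<in>UNIV. a (dj j) i * s (Inl i, t)) = (\<Sum>i\<in>UNIV. if i = j then s (Inl j, t) else 0)" for t
        by (intro sum.cong) (auto simp: dj(3))
      then have "split_received v (dj j) s = (\<lambda>t\<in>{..<n}. (\<lambda>t\<in>{..<n}. s (Inl j, t)) t + v (Inr (dj j), t))"
        unfolding split_received_def by (intro restrict_ext) simp
      moreover have "split_received v (dj j) s \<in> region j c"
        using out[OF w] w T(1) dj(2) by (auto simp: region_def X_def)
      ultimately show "(\<lambda>t\<in>{..<n}. s (\<kappa>, t)) \<in> (case \<kappa> of Inl j \<Rightarrow> {y \<in> space LL. (\<lambda>t\<in>{..<n}. y t +
        v (Inr (dj j), t)) \<in> region j c} | Inr _ \<Rightarrow> {})"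
        by (simp add: \<kappa> space_PiM)
    qed
    then show ?thesis using c1 by (simp add: one_le_numeral)
  qed simp
  finally show ?thesis .
qed

lemma nn_integral_translate:
  assumes "finite I" and f: "f \<in> borel_measurable (PiM I (\<lambda>_. lborel :: real measure))"
  shows "(\<integral>\<^sup>+s. f (\<lambda>i\<in>I. s i + c i) \<partial>PiM I (\<lambda>_. lborel)) = (\<integral>\<^sup>+s. f s \<partial>PiM I (\<lambda>_. lborel))"
proof -
  have T: "(\<lambda>s. \<lambda>i\<in>I. s i + c i) \<in> measurable (PiM I (\<lambda>_. lborel)) (PiM I (\<lambda>_. lborel :: real measure))"
    by measurable
  have "(\<integral>\<^sup>+s. f s \<partial>PiM I (\<lambda>_. lborel)) =
    (\<integral>\<^sup>+s. f s \<partial>distr (PiM I (\<lambda>_. lborel)) (PiM I (\<lambda>_. lborel)) (\<lambda>s. \<lambda>i\<in>I. s i + c i))"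
    by (simp add: PiM_lborel_translate[OF assms(1)])
  also have "\<dots> = (\<integral>\<^sup>+s. f (\<lambda>i\<in>I. s i + c i) \<partial>PiM I (\<lambda>_. lborel))"
    by (intro nn_integral_distr[OF T]) (simp add: f)
  finally show ?thesis by simp
qed

text \<open>For fixed \<open>v\<close> the Gaussian density of the remaining
  \<open>CARD('m) * n\<close> coordinates is bounded by a constant, and Lebesgue measure allows a
  translation by each codeword. Afterwards all tuples live in the same coordinates, where correct
  decoding of one excludes the others and takes place inside \<open>signal_set c v\<close>.\<close>

lemma fiber_prob_le:
  assumes T: "T \<subseteq> {w. w k = c}" "finite T"
  shows "(\<Sum>w\<in>T. emeasure \<Omega> {\<omega> \<in> space \<Omega>. correct w \<omega>}) \<le>
    ennreal (1 / sqrt (2 * pi * \<sigma>\<^sup>2)) ^ (CARD('m) * n) * (\<Prod>j\<in>UNIV. emeasure LL (region j c))"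
proof -
  let ?\<kappa> = "ennreal (1 / sqrt (2 * pi * \<sigma>\<^sup>2))"
  let ?B = "\<Prod>j\<in>UNIV. emeasure LL (region j c)"
  let ?F = "\<lambda>\<omega>. \<Sum>w\<in>T. ind w \<omega>"
  define \<phi> where "\<phi> i x = ennreal (normal_density 0 (sd (fst i)) x)" for i :: "('m + 'd) \<times> nat" and x
  have G\<phi>: "G = (\<lambda>i. density lborel (\<phi> i))" by (simp add: G_def case_prod_unfold \<phi>_def[abs_def])
  interpret P: product_prob_space G by (rule product_prob_spaceI) (rule prob_space_G)
  have "(\<Sum>w\<in>T. emeasure \<Omega> {\<omega> \<in> space \<Omega>. correct w \<omega>}) = (\<Sum>w\<in>T. \<integral>\<^sup>+\<omega>. ind w \<omega> \<partial>\<Omega>)"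
    unfolding ind_def space_\<Omega>[symmetric]
      by (intro sum.cong refl nn_integral_indicator[symmetric] correct_sets)
  also have "\<dots> = (\<integral>\<^sup>+\<omega>. ?F \<omega> \<partial>\<Omega>)"
    by (intro nn_integral_sum[symmetric]) (use ind_measurable in \<open>simp add: \<Omega>_def measurable_cong_sets[OF sets_PiM_G refl]\<close>)
  also have "\<dots> = (\<integral>\<^sup>+v. (\<integral>\<^sup>+e. ?F (merge Iv Ie (v, e)) \<partial>PiM Ie G) \<partial>PiM Iv G)"
  proof -
    have "?F \<in> borel_measurable (PiM (Iv \<union> Ie) G)"
      unfolding Ie_Iv(2) by (intro borel_measurable_sum) (use ind_measurable in \<open>simp add: measurable_cong_sets[OF sets_PiM_G refl]\<close>)
    from P.product_nn_integral_fold[OF Ie_Iv(1) Ie_Iv(4) Ie_Iv(3) this] show ?thesis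
      unfolding Ie_Iv(2) \<Omega>_def .
  qed
  also have "\<dots> \<le> (\<integral>\<^sup>+v. ?\<kappa> ^ (CARD('m) * n) * ?B \<partial>PiM Iv G)"
  proof (rule nn_integral_mono)
    fix v assume "v \<in> space (PiM Iv G)"
    then have v: "v \<in> space (PiM Iv (\<lambda>_. borel))" by (simp add: sets_eq_imp_space_eq[OF sets_PiM_G])
    have mw: "(\<lambda>e. ind w (merge Iv Ie (v, e))) \<in> borel_measurable (PiM Ie (\<lambda>_. borel))" for w
      by (rule measurable_compose[OF merge_measurable_right[OF v] ind_measurable])
    have mwl: "(\<lambda>e. ind w (merge Iv Ie (v, e))) \<in> borel_measurable (PiM Ie (\<lambda>_. lborel))" for w
      using mw[of w] by (subst measurable_cong_sets[OF sets_PiM_cong refl]) auto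
    have "(\<integral>\<^sup>+e. ?F (merge Iv Ie (v, e)) \<partial>PiM Ie G) \<le>
      ?\<kappa> ^ card Ie * (\<integral>\<^sup>+e. ?F (merge Iv Ie (v, e)) \<partial>PiM Ie (\<lambda>_. lborel))"
      unfolding G\<phi>
    proof (rule nn_integral_PiM_density_le[OF Ie_Iv(3)])
      show "prob_space (density lborel (\<phi> i))" for i using prob_space_G[of i] by (simp add: G\<phi>)
      show "\<phi> i \<in> borel_measurable borel" for i unfolding \<phi>_def by measurable
      show "\<phi> i x \<le> ?\<kappa>" if i: "i \<in> Ie" for i x
      proof -
        have "sd (fst i) = \<sigma>" using i by (auto simp: Ie_def sd_def)
        then show ?thesis using normal_density_le[OF \<sigma>(1)] by (simp add: \<phi>_def ennreal_leI)
      qed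
      show "(\<lambda>e. ?F (merge Iv Ie (v, e))) \<in> borel_measurable (PiM Ie (\<lambda>_. borel))"
        using mw by (intro borel_measurable_sum) auto
    qed
    also have "(\<integral>\<^sup>+e. ?F (merge Iv Ie (v, e)) \<partial>PiM Ie (\<lambda>_. lborel)) =
      (\<Sum>w\<in>T. \<integral>\<^sup>+e. ind w (merge Iv Ie (v, e)) \<partial>PiM Ie (\<lambda>_. lborel))"
      by (rule nn_integral_sum) (rule mwl)
    also have "\<dots> = (\<Sum>w\<in>T. \<integral>\<^sup>+s. ind w (merge Iv Ie (v, \<lambda>i\<in>Ie. s i + shift w i)) \<partial>PiM Ie (\<lambda>_. lborel))"
      by (intro sum.cong refl nn_integral_translate[OF Ie_Iv(3) mwl, symmetric])
    also have "\<dots> = (\<integral>\<^sup>+s. (\<Sum>w\<in>T. ind w (merge Iv Ie (v, \<lambda>i\<in>Ie. s i + shift w i))) \<partial>PiM Ie (\<lambda>_. lborel))"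
    proof (rule nn_integral_sum[symmetric])
      fix w
      have "(\<lambda>s. \<lambda>i\<in>Ie. s i + shift w i) \<in> measurable (PiM Ie (\<lambda>_. lborel)) (PiM Ie (\<lambda>_. lborel :: real measure))"
        by measurable
      from measurable_compose[OF this mwl]
      show "(\<lambda>s. ind w (merge Iv Ie (v, \<lambda>i\<in>Ie. s i + shift w i))) \<in> borel_measurable (PiM Ie (\<lambda>_. lborel))" .
    qed
    also have "\<dots> \<le> (\<integral>\<^sup>+s. indicator (signal_set c v) s \<partial>PiM Ie (\<lambda>_. lborel))"
      by (intro nn_integral_mono sum_ind_le T)
    also have "\<dots> = ?B" by (simp add: signal_set)
    finally show "(\<integral>\<^sup>+e. ?F (merge Iv Ie (v, e)) \<partial>PiM Ie G) \<le> ?\<kappa> ^ (CARD('m) * n) * ?B"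
      unfolding Ie_Iv(5) by (simp add: mult_left_mono)
  qed
  also have "\<dots> = ?\<kappa> ^ (CARD('m) * n) * ?B"
  proof -
    interpret prob_space "PiM Iv G" by (intro prob_space_PiM prob_space_G)
    show ?thesis using emeasure_space_1 by simp
  qed
  finally show ?thesis .
qed

text \<open>The regions of different messages are disjoint parts of one energy ball.\<close>

lemma regions_volume:
  "emeasure LL (region j c) \<le> ennreal (sqrt (2 * pi * exp 1 * r) ^ n)"
  "(\<Sum>c<L k. measure LL (region j c)) \<le> sqrt (2 * pi * exp 1 * r) ^ n"
proof -
  let ?V = "sqrt (2 * pi * exp 1 * r) ^ n"
  have V0: "0 \<le> ?V" using r(1) by simp
  have ball: "emeasure LL (energy_ball n r) \<le> ennreal ?V" by (rule emeasure_energy_ball_le[OF r(1)])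
  have bs: "energy_ball n r \<in> sets LL" using energy_ball_sets[of n r] by (simp cong: sets_PiM_cong)
  have rs: "region j c \<in> sets LL" for c using region_sets[of j c] by (simp cong: sets_PiM_cong)
  have sub: "region j c \<subseteq> energy_ball n r" for c by (auto simp: region_def)
  show le: "emeasure LL (region j c) \<le> ennreal ?V" for c
    by (rule order_trans[OF emeasure_mono[OF sub bs] ball])
  have fin: "region j c \<in> fmeasurable LL" for c
    using rs le[of c] by (intro fmeasurableI) (auto simp: less_top[symmetric] top_unique intro: le_less_trans)
  have fb: "energy_ball n r \<in> fmeasurable LL"
    using bs ball by (intro fmeasurableI) (auto intro: le_less_trans)
  have "(\<Sum>c<L k. measure LL (region j c)) = measure LL (\<Union>c\<in>{..<L k}. region j c)"
    by (intro measure_UNION'[symmetric] fin) (auto simp: region_def pairwise_def disjnt_def)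
  also have "\<dots> \<le> measure LL (energy_ball n r)"
    using sub rs fb by (intro measure_mono_fmeasurable) (auto intro!: sets.finite_UN)
  also have "\<dots> \<le> ?V"
    using ball V0 unfolding emeasure_eq_measure2[OF fb] by (subst (asm) ennreal_le_iff) auto
  finally show "(\<Sum>c<L k. measure LL (region j c)) \<le> ?V" .
qed

lemma card_tuples_in:
  assumes "B \<subseteq> {..<L k}"
  shows "real (card {w \<in> message_tuples L. w k \<in> B}) * real (L k) =
    real (card B) * real (card (message_tuples L))"
proof -
  have "{w \<in> message_tuples L. w k \<in> B} = (\<Pi>\<^sub>E l\<in>UNIV. if l = k then B else {..<L l})"
    using assms by (fastforce simp: message_tuples_def PiE_iff split: if_splits)
  then have "card {w \<in> message_tuples L. w k \<in> B} = (\<Prod>l\<in>UNIV. card (if l = k then B else {..<L l}))"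
    by (simp add: card_PiE)
  also have "\<dots> = card B * (\<Prod>l\<in>UNIV - {k}. L l)"
    by (subst prod.remove[of _ k]) (auto intro!: prod.cong)
  finally have 1: "card {w \<in> message_tuples L. w k \<in> B} = card B * (\<Prod>l\<in>UNIV - {k}. L l)" .
  have 2: "card (message_tuples L) = L k * (\<Prod>l\<in>UNIV - {k}. L l)"
    unfolding card_message_tuples by (subst prod.remove[of _ k]) auto
  show ?thesis unfolding 1 2 by simp
qed

text \<open>Messages of user \<open>k\<close> with a large region for some \<open>j\<close> are
  discarded, and enough success probability survives. The rest is bounded fiber by fiber: a region
  of an ordinary message has volume of order \<open>V / L k\<close> in each of the
  \<open>CARD('m)\<close> blocks, which produces the power of \<open>L k\<close>.\<close>

theorem converse_inequality:
  "real (\<Prod>l\<in>UNIV. L l) * real (L k) ^ CARD('m) \<le>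
     2 * real (L k) * (4 * real CARD('m)) ^ CARD('m) * ((sqrt (2 * pi * exp 1 * r) / sqrt (2 * pi * \<sigma>\<^sup>2)) ^ CARD('m)) ^ n"
proof -
  let ?T = "message_tuples L" and ?M = "CARD('m)"
  define V where "V = sqrt (2 * pi * exp 1 * r) ^ n"
  define q where "q = 1 / sqrt (2 * pi * \<sigma>\<^sup>2)"
  define N where "N = real (card ?T)"
  \<comment> \<open>By Markov's inequality this threshold is exceeded, for each of the
    \<open>CARD('m)\<close> decoders, by at most a fraction \<open>1 / (4 * CARD('m))\<close> of the
    messages, so by a quarter of them in total.\<close>
  define \<theta> where "\<theta> = 4 * real ?M * V / real (L k)"
  have V: "V > 0" using r(1) by (simp add: V_def)
  have q: "q > 0" using \<sigma>(1) by (simp add: q_def)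
  have Lk: "real (L k) > 0" using L[of k] by simp
  have M: "real ?M > 0" by simp
  have \<theta>: "\<theta> > 0" using V Lk by (simp add: \<theta>_def)
  define bad where "bad j = {c. c < L k \<and> \<theta> < measure LL (region j c)}" for j
  define Bad where "Bad = (\<Union>j\<in>UNIV. bad j)"
  have Bad_sub: "Bad \<subseteq> {..<L k}" by (auto simp: Bad_def bad_def)
  have bad: "real (card (bad j)) \<le> real (L k) / (4 * real ?M)" for j
  proof -
    have "real (card (bad j)) * \<theta> = (\<Sum>c\<in>bad j. \<theta>)" by simp
    also have "\<dots> \<le> (\<Sum>c\<in>bad j. measure LL (region j c))" by (intro sum_mono) (auto simp: bad_def)
    also have "\<dots> \<le> (\<Sum>c<L k. measure LL (region j c))" by (intro sum_mono2) (auto simp: bad_def)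
    also have "\<dots> \<le> V" unfolding V_def by (rule regions_volume(2))
    finally show ?thesis using V Lk by (simp add: \<theta>_def field_simps)
  qed
  have "card Bad \<le> (\<Sum>j\<in>UNIV. card (bad j))" unfolding Bad_def by (rule card_UN_le) simp
  then have "real (card Bad) \<le> (\<Sum>j\<in>UNIV. real (card (bad j)))"
    by (metis of_nat_le_iff of_nat_sum)
  also have "\<dots> \<le> (\<Sum>j\<in>(UNIV :: 'm set). real (L k) / (4 * real ?M))" by (intro sum_mono bad)
  also have "\<dots> = real (L k) / 4" by simp
  finally have cBad: "real (card Bad) \<le> real (L k) / 4" .
  define S where "S c = {w \<in> ?T. w k = c}" for c
  define pc where "pc w = measure \<Omega> {\<omega> \<in> space \<Omega>. correct w \<omega>}" for w
  have finT: "finite ?T" by (rule finite_message_tuples)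
  \<comment> \<open>One quarter is lost to incorrect events and at most one quarter to
    \<open>Bad\<close>.\<close>
  have half: "N / 2 \<le> (\<Sum>w\<in>{w\<in>?T. w k \<notin> Bad}. pc w)"
  proof -
    have "(\<Sum>w\<in>?T. 1 - pc w) \<le> N / 4" unfolding pc_def N_def by (rule incorrect_prob_sum_le)
    then have "3 * N / 4 \<le> (\<Sum>w\<in>?T. pc w)" by (simp add: sum_subtractf N_def)
    also have "(\<Sum>w\<in>?T. pc w) = (\<Sum>w\<in>{w\<in>?T. w k \<in> Bad}. pc w) + (\<Sum>w\<in>{w\<in>?T. w k \<notin> Bad}. pc w)"
      using finT by (subst sum.union_disjoint[symmetric]) (auto intro!: sum.cong)
    also have "(\<Sum>w\<in>{w\<in>?T. w k \<in> Bad}. pc w) \<le> (\<Sum>w\<in>{w\<in>?T. w k \<in> Bad}. 1)"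
      by (intro sum_mono) (simp add: pc_def)
    also have "\<dots> \<le> N / 4"
    proof -
      have "real (card {w\<in>?T. w k \<in> Bad}) * real (L k) = real (card Bad) * N"
        unfolding N_def by (rule card_tuples_in[OF Bad_sub])
      also have "\<dots> \<le> real (L k) / 4 * N" using cBad by (intro mult_right_mono) (auto simp: N_def)
      finally show ?thesis using Lk by (simp add: field_simps)
    qed
    finally show ?thesis by simp
  qed
  have fiber: "(\<Sum>w\<in>S c. pc w) \<le> q ^ (?M * n) * \<theta> ^ ?M" if c: "c < L k" "c \<notin> Bad" for c
  proof -
    have "ennreal (\<Sum>w\<in>S c. pc w) = (\<Sum>w\<in>S c. emeasure \<Omega> {\<omega> \<in> space \<Omega>. correct w \<omega>})"
      by (subst sum_ennreal[symmetric]) (auto simp: pc_def \<Omega>.emeasure_eq_measure)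
    also have "\<dots> \<le> ennreal q ^ (?M * n) * (\<Prod>j\<in>UNIV. emeasure LL (region j c))"
      unfolding q_def using finT by (intro fiber_prob_le[of _ c]) (auto simp: S_def)
    also have "\<dots> \<le> ennreal q ^ (?M * n) * (\<Prod>j\<in>(UNIV :: 'm set). ennreal \<theta>)"
    proof -
      have "emeasure LL (region j c) \<le> ennreal \<theta>" for j
      proof -
        have "emeasure LL (region j c) < \<infinity>" using regions_volume(1)[of j c] by (auto intro: le_less_trans)
        then have "emeasure LL (region j c) = ennreal (measure LL (region j c))"
          by (intro emeasure_eq_ennreal_measure) auto
        moreover have "measure LL (region j c) \<le> \<theta>" using c by (force simp: Bad_def bad_def not_less)
        ultimately show ?thesis by (simp add: ennreal_leI)
      qed
      then have "(\<Prod>j\<in>UNIV. emeasure LL (region j c)) \<le> (\<Prod>j\<in>(UNIV :: 'm set). ennreal \<theta>)"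
        by (rule prod_mono_ennreal)
      then show ?thesis by (rule mult_left_mono) simp
    qed
    also have "\<dots> = ennreal (q ^ (?M * n) * \<theta> ^ ?M)"
      using q \<theta> by (simp add: ennreal_power ennreal_mult)
    finally show ?thesis using q \<theta> by (subst (asm) ennreal_le_iff) auto
  qed
  have "(\<Sum>w\<in>{w\<in>?T. w k \<notin> Bad}. pc w) = (\<Sum>c\<in>{..<L k} - Bad. \<Sum>w\<in>S c. pc w)"
  proof -
    have "{w\<in>?T. w k \<notin> Bad} = (\<Union>c\<in>{..<L k} - Bad. S c)"
      by (auto simp: S_def message_tuples_def PiE_iff)
    then show ?thesis using finT by (simp add: S_def) (subst sum.UNION_disjoint; auto)
  qed
  also have "\<dots> \<le> (\<Sum>c\<in>{..<L k} - Bad. q ^ (?M * n) * \<theta> ^ ?M)" by (intro sum_mono fiber) auto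
  also have "\<dots> \<le> (\<Sum>c\<in>{..<L k}. q ^ (?M * n) * \<theta> ^ ?M)" using q \<theta> by (intro sum_mono2) auto
  also have "\<dots> = real (L k) * (q ^ (?M * n) * \<theta> ^ ?M)" by simp
  finally have "N \<le> 2 * (real (L k) * (q ^ (?M * n) * \<theta> ^ ?M))" using half by simp
  then have "N * real (L k) ^ ?M \<le> 2 * (real (L k) * (q ^ (?M * n) * \<theta> ^ ?M)) * real (L k) ^ ?M"
    by (intro mult_right_mono) auto
  also have "\<dots> = 2 * real (L k) * (4 * real ?M) ^ ?M * (q ^ (?M * n) * V ^ ?M)"
    using Lk by (simp add: \<theta>_def power_divide power_mult_distrib)
  also have "q ^ (?M * n) * V ^ ?M = ((sqrt (2 * pi * exp 1 * r) / sqrt (2 * pi * \<sigma>\<^sup>2)) ^ ?M) ^ n"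
    by (simp add: q_def V_def power_divide mult.commute flip: power_mult)
  finally show ?thesis by (simp add: N_def card_message_tuples)
qed

end

section \<open>From block codes to rates\<close>

text \<open>Otherwise the powers of \<open>x / y\<close> would outgrow \<open>K\<close>. The lemma
  removes the constants that do not grow with the block length.\<close>

lemma le_of_power_le:
  fixes x y K :: real
  assumes "\<forall>\<^sub>F n in sequentially. x ^ n \<le> K * y ^ n" "0 \<le> x" "0 < y"
  shows "x \<le> y"
proof (rule ccontr)
  assume "\<not> x \<le> y"
  then have "1 < x / y" using assms by simp
  then obtain N where N: "K < (x / y) ^ N" using real_arch_pow by blast
  have "\<forall>\<^sub>F n in sequentially. K < (x / y) ^ n"
    using eventually_ge_at_top[of N]
  proof eventually_elim
    case (elim n)
    have "(x / y) ^ N \<le> (x / y) ^ n" using \<open>1 < x / y\<close> elim by (intro power_increasing) auto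
    then show ?case using N by simp
  qed
  then have "\<forall>\<^sub>F n in sequentially. False" using assms(1)
  proof eventually_elim
    case (elim n)
    then show ?case using assms by (simp add: power_divide field_simps)
  qed
  then show False by simp
qed

text \<open>After one factor \<open>L k\<close> cancels, the converse inequality bounds the product
  of all \<open>L l\<close> times \<open>L k ^ (CARD('m) - 1)\<close> by a constant times the
  \<open>n\<close>-th power of a quantity of order \<open>P powr (CARD('m) / 2)\<close>. Growing
  \<open>n\<close> removes the constant.\<close>

lemma rate_bound:
  fixes J :: "'n::finite \<Rightarrow> nat" and h :: "'n \<times> nat \<Rightarrow> real ^ 'm::finite" and k :: 'n and \<iota> :: "'m \<Rightarrow> nat"
  assumes J: "\<And>l. J l \<ge> 1" and \<iota>: "\<And>j. \<iota> j \<in> {1..J k}"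
    and span: "\<And>x. \<exists>b. x = (\<Sum>j\<in>UNIV. b j *\<^sub>R h (k, \<iota> j))"
  shows "\<exists>C. \<forall>P\<ge>1. \<forall>R. achievable J h P R \<longrightarrow>
     (\<Sum>l\<in>UNIV. R l) + (real CARD('m) - 1) * R k \<le> real CARD('m) / 2 * log 2 P + C"
proof -
  let ?M = "real CARD('m)"
  obtain b where b: "\<And>x. x = (\<Sum>j\<in>UNIV. b x j *\<^sub>R h (k, \<iota> j))" using span by metis
  define g where "g j = h (k, \<iota> j)" for j
  \<comment> \<open>\<open>Inl j\<close> is user \<open>k\<close> in state \<open>\<iota> j\<close>,
    whose channel vector is the basis vector \<open>g j\<close>. \<open>Inr l\<close> is user
    \<open>l\<close> in state 1; these decoders make every message readable.\<close>
  define a :: "'m + 'n \<Rightarrow> 'm \<Rightarrow> real" where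
    "a d = (case d of Inl j \<Rightarrow> (\<lambda>i. if i = j then 1 else 0) | Inr l \<Rightarrow> b (h (l, 1)))" for d
  define u :: "'m + 'n \<Rightarrow> 'n" where "u d = (case d of Inl j \<Rightarrow> k | Inr l \<Rightarrow> l)" for d
  define st :: "'m + 'n \<Rightarrow> nat" where "st d = (case d of Inl j \<Rightarrow> \<iota> j | Inr l \<Rightarrow> 1)" for d
  have st: "st d \<in> {1..J (u d)}" for d using J \<iota> by (auto simp: st_def u_def split: sum.split)
  have ga: "(\<Sum>j\<in>UNIV. a d j *\<^sub>R g j) = h (u d, st d)" for d
  proof (cases d)
    case (Inl j)
    have "(\<Sum>i\<in>UNIV. a d i *\<^sub>R g i) = (\<Sum>i\<in>UNIV. if i = j then g j else 0)"
      by (intro sum.cong) (auto simp: a_def Inl)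
    then show ?thesis by (simp add: Inl g_def u_def st_def)
  next
    case (Inr l)
    then show ?thesis using b[of "h (l, 1)"] by (simp add: a_def u_def st_def g_def)
  qed
  define A where "A = (\<Sum>d\<in>UNIV. \<Sum>j\<in>UNIV. (a d j)\<^sup>2)"
  have A0: "A \<ge> 0" by (auto simp: A_def intro!: sum_nonneg)
  have Ad: "(\<Sum>j\<in>UNIV. (a d j)\<^sup>2) \<le> A" for d
    unfolding A_def by (rule member_le_sum) (auto intro: sum_nonneg)
  \<comment> \<open>Small enough to leave a positive residual variance for every decoder, and
    independent of \<open>P\<close>.\<close>
  define \<sigma> where "\<sigma> = sqrt (1 / (A + 1))"
  have \<sigma>: "\<sigma> > 0" "\<sigma>\<^sup>2 = 1 / (A + 1)" using A0 by (auto simp: \<sigma>_def)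
  have \<sigma>a: "\<sigma>\<^sup>2 * (\<Sum>j\<in>UNIV. (a d j)\<^sup>2) < 1" for d using Ad[of d] A0 by (simp add: \<sigma>(2))
  define \<Gamma> where "\<Gamma> = (\<Sum>j\<in>UNIV. (norm (g j))\<^sup>2)"
  have \<Gamma>0: "\<Gamma> \<ge> 0" by (simp add: \<Gamma>_def sum_nonneg)
  have \<Gamma>j: "(norm (g j))\<^sup>2 \<le> \<Gamma>" for j unfolding \<Gamma>_def by (rule member_le_sum) auto
  define C0 where "C0 = 8 * ?M * (\<Gamma> + 1) * exp 1 / \<sigma>\<^sup>2"
  have C0: "C0 > 0" unfolding C0_def using \<Gamma>0 \<sigma>(1) by (intro divide_pos_pos mult_pos_pos) auto
  have main: "(\<Sum>l\<in>UNIV. R l) + (?M - 1) * R k \<le> ?M / 2 * log 2 P + ?M / 2 * log 2 C0"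
    if P: "P \<ge> 1" and ach: "achievable J h P R" for P R
  proof -
    \<comment> \<open>Received energy per symbol is of order \<open>P\<close>; the unit noise energy
      is absorbed because \<open>P \<ge> 1\<close>.\<close>
    define r where "r = 8 * ?M * (\<Gamma> + 1) * P"
    have r: "r > 0" using P \<Gamma>0 by (simp add: r_def)
    have rj: "8 * ?M * ((norm (g j))\<^sup>2 * P + 1) \<le> r" for j
    proof -
      have "(norm (g j))\<^sup>2 * P + 1 \<le> \<Gamma> * P + P" using \<Gamma>j[of j] P by (intro add_mono mult_right_mono) auto
      then have "8 * ?M * ((norm (g j))\<^sup>2 * P + 1) \<le> 8 * ?M * (\<Gamma> * P + P)" by (intro mult_left_mono) auto
      then show ?thesis by (simp add: r_def algebra_simps)
    qed
    define \<epsilon> where "\<epsilon> = 1 / (8 * real CARD('m + 'n))"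
    have \<epsilon>: "\<epsilon> > 0" by (simp add: \<epsilon>_def add_pos_pos)
    define B where "B = (sqrt (2 * pi * exp 1 * r) / sqrt (2 * pi * \<sigma>\<^sup>2)) ^ CARD('m)"
    define s where "s = (\<Sum>l\<in>UNIV. R l) + (?M - 1) * R k"
    have B0: "B > 0" using r \<sigma>(1) unfolding B_def by (intro zero_less_power divide_pos_pos) auto
    have ev: "\<forall>\<^sub>F n in sequentially. (2 powr s) ^ n \<le> (2 * (4 * ?M) ^ CARD('m)) * B ^ n"
    proof -
      have "\<forall>\<^sub>F n in sequentially. \<exists>enc dec. is_code J h P n (\<lambda>k. nat \<lceil>2 powr (real n * R k)\<rceil>) \<epsilon> enc dec"
        using ach \<epsilon> unfolding achievable_def by blast
      then show ?thesis using eventually_gt_at_top[of 0]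
      proof eventually_elim
        case (elim n)
        define L where "L l = nat \<lceil>2 powr (real n * R l)\<rceil>" for l
        obtain enc dec where code: "is_code J h P n L \<epsilon> enc dec" using elim(1) unfolding L_def by blast
        have Lge: "2 powr (real n * R l) \<le> real (L l)" for l
          unfolding L_def by (simp add: of_nat_ceiling)
        have Lpos: "L l > 0" for l
          using Lge[of l] powr_gt_zero[of 2 "real n * R l"] by (metis not_gr_zero of_nat_0 not_le zero_neq_numeral)
        interpret converse_setup n L enc g a "\<lambda>d. dec (u d) (st d)" u k Inl \<sigma> \<epsilon> P r
        proof
          show "n > 0" by (rule elim(2))
          show "error_prob n L enc (u d) (\<Sum>j\<in>UNIV. a d j *\<^sub>R g j) (dec (u d) (st d)) \<le> \<epsilon>" for d
            unfolding ga using code st[of d] by (auto simp: is_code_def)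
          show "dec (u d) (st d) \<in> measurable (PiM {..<n} (\<lambda>_. borel)) (count_space UNIV)" for d
            using code st[of d] by (auto simp: is_code_def)
          show "average_power n L enc \<le> P" using code by (simp add: is_code_def)
          show "\<exists>d. u d = l" for l by (intro exI[of _ "Inr l"]) (simp add: u_def)
          have c: "c * (1 / (8 * c)) \<le> 1 / 8" if "c > 0" for c :: real using that by simp
          show "real CARD('m + 'n) * \<epsilon> \<le> 1 / 8" unfolding \<epsilon>_def by (rule c) (simp add: add_pos_pos)
        qed (use Lpos \<sigma> \<sigma>a r rj in \<open>auto simp: a_def u_def\<close>)
        have "(2 powr s) ^ n * real (L k) = 2 powr (real n * s) * real (L k)"
          by (simp add: powr_powr mult.commute flip: powr_realpow)
        also have "real n * s = (\<Sum>l\<in>UNIV. real n * R l) + (?M - 1) * (real n * R k)"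
          by (simp add: s_def sum_distrib_left algebra_simps)
        also have "2 powr \<dots> = (\<Prod>l\<in>UNIV. 2 powr (real n * R l)) * (2 powr (real n * R k)) powr (?M - 1)"
          by (simp add: powr_add powr_sum powr_powr mult.commute)
        also have "?M - 1 = real (CARD('m) - 1)" by simp
        also have "(2 powr (real n * R k)) powr real (CARD('m) - 1) =
          (2 powr (real n * R k)) ^ (CARD('m) - 1)"
          by (rule powr_realpow) simp
        also have "(\<Prod>l\<in>UNIV. 2 powr (real n * R l)) * (2 powr (real n * R k)) ^ (CARD('m) - 1) * real (L k) \<le>
            (\<Prod>l\<in>UNIV. real (L l)) * real (L k) ^ (CARD('m) - 1) * real (L k)"
          by (intro mult_right_mono mult_mono prod_mono power_mono conjI Lge prod_nonneg zero_le_power) auto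
        also have "\<dots> = real (\<Prod>l\<in>UNIV. L l) * real (L k) ^ CARD('m)"
          by (simp add: mult.assoc flip: power_Suc2)
        also have "\<dots> \<le> 2 * real (L k) * (4 * ?M) ^ CARD('m) * B ^ n"
          unfolding B_def by (rule converse_inequality)
        finally have "(2 powr s) ^ n * real (L k) \<le> (2 * (4 * ?M) ^ CARD('m)) * B ^ n * real (L k)"
          by (simp add: mult_ac)
        then show ?case using Lpos[of k] by simp
      qed
    qed
    have "2 powr s \<le> B" by (rule le_of_power_le[OF ev _ B0]) simp
    then have "s \<le> log 2 B" using B0 by (simp add: le_log_iff)
    also have "B = (sqrt (C0 * P)) ^ CARD('m)"
    proof -
      have "sqrt (2 * pi * exp 1 * r) / sqrt (2 * pi * \<sigma>\<^sup>2) = sqrt ((2 * pi * exp 1 * r) / (2 * pi * \<sigma>\<^sup>2))"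
        by (rule real_sqrt_divide[symmetric])
      also have "(2 * pi * exp 1 * r) / (2 * pi * \<sigma>\<^sup>2) = C0 * P"
        by (simp add: C0_def r_def)
      finally show ?thesis by (simp add: B_def)
    qed
    also have "log 2 ((sqrt (C0 * P)) ^ CARD('m)) = ?M * log 2 (sqrt (C0 * P))"
      using C0 P by (simp add: log_nat_power)
    also have "log 2 (sqrt (C0 * P)) = (log 2 P + log 2 C0) / 2"
      using C0 P by (simp add: log_def ln_sqrt ln_mult add_divide_distrib)
    finally show ?thesis by (simp add: s_def algebra_simps)
  qed
  then show ?thesis by blast
qed

lemma sum_capacity_upper:
  fixes J :: "'n::finite \<Rightarrow> nat" and h :: "'n \<times> nat \<Rightarrow> real ^ 'm::finite" and \<iota> :: "'n \<Rightarrow> 'm \<Rightarrow> nat"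
  assumes J: "\<And>l. J l \<ge> 1" and \<iota>: "\<And>k j. \<iota> k j \<in> {1..J k}"
    and span: "\<And>k x. \<exists>b. x = (\<Sum>j\<in>UNIV. b j *\<^sub>R h (k, \<iota> k j))"
  shows "\<exists>C. \<forall>P\<ge>1. sum_capacity J h P \<le>
     ereal (real CARD('m) * real CARD('n) / (real CARD('m) + real CARD('n) - 1) * (1 / 2 * log 2 P) + C)"
proof -
  let ?M = "real CARD('m)" and ?N = "real CARD('n)"
  have "\<exists>C. \<forall>P\<ge>1. \<forall>R. achievable J h P R \<longrightarrow>
     (\<Sum>l\<in>UNIV. R l) + (?M - 1) * R k \<le> ?M / 2 * log 2 P + C" for k
    by (rule rate_bound[OF J \<iota> span])
  then obtain C where C: "\<And>k P R. P \<ge> 1 \<Longrightarrow> achievable J h P R \<Longrightarrow>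
     (\<Sum>l\<in>UNIV. R l) + (?M - 1) * R k \<le> ?M / 2 * log 2 P + C k" by metis
  have MN: "?M + ?N - 1 > 0"
  proof -
    have "?M \<ge> 1" "?N \<ge> 1" using zero_less_card_finite[where 'a = 'm] zero_less_card_finite[where 'a = 'n]
      by linarith+
    then show ?thesis by linarith
  qed
  have "(\<Sum>l\<in>UNIV. R l) \<le> ?M * ?N / (?M + ?N - 1) * (1 / 2 * log 2 P) + (\<Sum>k\<in>UNIV. C k) / (?M + ?N - 1)"
    if P: "P \<ge> 1" and R: "achievable J h P R" for P R
  proof -
    define s where "s = (\<Sum>l\<in>UNIV. R l)"
    have "(\<Sum>k\<in>(UNIV :: 'n set). s + (?M - 1) * R k) \<le> (\<Sum>k\<in>UNIV. ?M / 2 * log 2 P + C k)"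
      unfolding s_def by (intro sum_mono C P R)
    \<comment> \<open>Each rate occurs once in every one of the \<open>?N\<close> full sums and
      \<open>?M - 1\<close> further times in the inequality of its own user.\<close>
    then have "?N * s + (?M - 1) * s \<le> ?N * (?M / 2 * log 2 P) + (\<Sum>k\<in>UNIV. C k)"
      by (simp add: sum.distrib s_def flip: sum_distrib_left)
    then have "(?M + ?N - 1) * s \<le> ?N * (?M / 2 * log 2 P) + (\<Sum>k\<in>UNIV. C k)"
      by (simp add: algebra_simps)
    then have "s \<le> (?N * (?M / 2 * log 2 P) + (\<Sum>k\<in>UNIV. C k)) / (?M + ?N - 1)"
      using MN by (simp add: pos_le_divide_eq mult.commute)
    also have "\<dots> = ?M * ?N / (?M + ?N - 1) * (1 / 2 * log 2 P) + (\<Sum>k\<in>UNIV. C k) / (?M + ?N - 1)"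
      by (simp add: add_divide_distrib mult_ac)
    finally show ?thesis by (simp add: s_def)
  qed
  then show ?thesis unfolding sum_capacity_def
    by (intro exI[of _ "(\<Sum>k\<in>UNIV. C k) / (?M + ?N - 1)"] allI impI SUP_least) simp
qed

section \<open>Coding over separated signals\<close>

definition hamming :: "nat \<Rightarrow> (nat \<Rightarrow> 'a) \<Rightarrow> (nat \<Rightarrow> 'a) \<Rightarrow> nat" where
  "hamming n x y = card {t. t < n \<and> x t \<noteq> y t}"

text \<open>A word of the ball is determined by the positions where it differs from \<open>x\<close>
  and by its letters there. Position sets are counted crudely by \<open>2 ^ n\<close>, which will
  cost one bit of rate.\<close>

lemma hamming_ball_card:
  assumes A: "finite A" "A \<noteq> {}" and x: "x \<in> {..<n} \<rightarrow>\<^sub>E A"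
  shows "card {y \<in> {..<n} \<rightarrow>\<^sub>E A. hamming n x y \<le> d} \<le> 2 ^ n * card A ^ d"
proof -
  let ?f = "\<lambda>(D, z). \<lambda>t\<in>{..<n}. if t \<in> D then z t else x t"
  let ?Z = "SIGMA D:{D. D \<subseteq> {..<n} \<and> card D \<le> d}. D \<rightarrow>\<^sub>E A"
  have finD: "finite {D. D \<subseteq> {..<n} \<and> card D \<le> d}" by (rule finite_subset[of _ "Pow {..<n}"]) auto
  have finZ: "finite ?Z" using finD A by (intro finite_SigmaI finite_PiE) (auto intro: finite_subset)
  have "{y \<in> {..<n} \<rightarrow>\<^sub>E A. hamming n x y \<le> d} \<subseteq> ?f ` ?Z"
  proof
    fix y assume y: "y \<in> {y \<in> {..<n} \<rightarrow>\<^sub>E A. hamming n x y \<le> d}"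
    define D where "D = {t. t < n \<and> x t \<noteq> y t}"
    have "(D, restrict y D) \<in> ?Z" using y by (auto simp: D_def hamming_def PiE_iff)
    moreover have "y = ?f (D, restrict y D)"
    proof
      fix t show "y t = ?f (D, restrict y D) t"
        using y by (cases "t < n") (auto simp: D_def PiE_iff extensional_def)
    qed
    ultimately show "y \<in> ?f ` ?Z" by blast
  qed
  then have "card {y \<in> {..<n} \<rightarrow>\<^sub>E A. hamming n x y \<le> d} \<le> card ?Z"
    using finZ by (meson card_image_le card_mono finite_imageI le_trans)
  also have "\<dots> = (\<Sum>D\<in>{D. D \<subseteq> {..<n} \<and> card D \<le> d}. card (D \<rightarrow>\<^sub>E A))"
    using finD A by (intro card_SigmaI) (auto intro!: finite_PiE intro: finite_subset)
  also have "\<dots> \<le> (\<Sum>D\<in>{D. D \<subseteq> {..<n} \<and> card D \<le> d}. card A ^ d)"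
  proof (rule sum_mono)
    fix D assume D: "D \<in> {D. D \<subseteq> {..<n} \<and> card D \<le> d}"
    then have "card (D \<rightarrow>\<^sub>E A) = card A ^ card D" by (subst card_PiE) (auto intro: finite_subset)
    also have "\<dots> \<le> card A ^ d" using D A by (intro power_increasing) (auto simp: Suc_le_eq card_gt_0_iff)
    finally show "card (D \<rightarrow>\<^sub>E A) \<le> card A ^ d" .
  qed
  also have "\<dots> = card {D. D \<subseteq> {..<n} \<and> card D \<le> d} * card A ^ d" by simp
  also have "\<dots> \<le> card (Pow {..<n}) * card A ^ d" by (intro mult_right_mono card_mono) auto
  finally show ?thesis by (simp add: card_Pow)
qed

lemma hamming_commute: "hamming n x y = hamming n y x"
  by (simp add: hamming_def eq_commute)

text \<open>Greedy choice: as long as the balls of radius \<open>d\<close> around the chosen words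
  do not exhaust all words, another codeword can be added.\<close>

lemma Gilbert_Varshamov:
  assumes A: "finite A" "A \<noteq> {}"
  shows "L * (2 ^ n * card A ^ d) \<le> card A ^ n \<Longrightarrow>
    \<exists>c. (\<forall>i<L. c i \<in> {..<n} \<rightarrow>\<^sub>E A) \<and> (\<forall>i<L. \<forall>j<L. i \<noteq> j \<longrightarrow> d < hamming n (c i) (c j))"
proof (induction L)
  case (Suc L)
  have B: "2 ^ n * card A ^ d > 0" using A by (simp add: card_gt_0_iff)
  have "L * (2 ^ n * card A ^ d) \<le> card A ^ n" using Suc.prems by simp
  then obtain c where c: "\<forall>i<L. c i \<in> {..<n} \<rightarrow>\<^sub>E A" "\<forall>i<L. \<forall>j<L. i \<noteq> j \<longrightarrow> d < hamming n (c i) (c j)"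
    using Suc.IH by auto
  let ?W = "{..<n} \<rightarrow>\<^sub>E A" and ?near = "\<lambda>i. {y \<in> {..<n} \<rightarrow>\<^sub>E A. hamming n (c i) y \<le> d}"
  have finW: "finite ?W" using A by (intro finite_PiE) auto
  have "card (\<Union>i<L. ?near i) \<le> (\<Sum>i<L. card (?near i))" by (rule card_UN_le) simp
  also have "\<dots> \<le> (\<Sum>i<L. 2 ^ n * card A ^ d)" using c by (intro sum_mono hamming_ball_card A) auto
  also have "\<dots> < Suc L * (2 ^ n * card A ^ d)" using B by simp
  also have "\<dots> \<le> card A ^ n" by (rule Suc.prems)
  also have "\<dots> = card ?W" by (subst card_PiE) auto
  finally have "card (\<Union>i<L. ?near i) < card ?W" .
  then have "\<not> ?W \<subseteq> (\<Union>i<L. ?near i)"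
    using finW card_mono[of "\<Union>i<L. ?near i" ?W] by (auto simp: not_less[symmetric])
  then obtain y where y0: "y \<in> ?W" "y \<notin> (\<Union>i<L. ?near i)" by blast
  have y: "y \<in> ?W" "\<And>i. i < L \<Longrightarrow> d < hamming n (c i) y" using y0 by (auto simp: not_le)
  show ?case
  proof (intro exI[of _ "c(L := y)"] conjI allI impI)
    show "(c(L := y)) i \<in> ?W" if "i < Suc L" for i using that c y by (auto simp: less_Suc_eq)
    show "d < hamming n ((c(L := y)) i) ((c(L := y)) j)" if "i < Suc L" "j < Suc L" "i \<noteq> j" for i j
      using that c y by (auto simp: less_Suc_eq hamming_commute[of n y])
  qed
qed auto

section \<open>Detection of symbols in Gaussian noise\<close>

text \<open>Chebyshev's inequality is strong enough here: the separation exceeds any fixed constant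
  for large \<open>P\<close>, and block coding does the rest.\<close>

lemma Gaussian_tail:
  assumes "\<delta> > 0"
  shows "measure (gauss 1) {z. \<delta> \<le> \<bar>z\<bar>} \<le> 1 / \<delta>\<^sup>2"
proof -
  interpret prob_space "gauss 1" by (rule prob_space_gauss) simp
  have "integrable (gauss 1) (\<lambda>z. z\<^sup>2)" "expectation (\<lambda>z. z\<^sup>2) = 1" "expectation (\<lambda>z. z) = 0"
    using std_normal_moment_even[of 1] normal_moment_nz_1[of 1 0]
    by (auto simp: integrable_density integral_density has_bochner_integral_iff)
  then have "prob {z \<in> space (gauss 1). \<delta> \<le> \<bar>z - expectation (\<lambda>z. z)\<bar>} \<le> variance (\<lambda>z. z) / \<delta>\<^sup>2"
    using assms by (intro Chebyshev_inequality) auto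
  then show ?thesis using \<open>expectation (\<lambda>z. z\<^sup>2) = 1\<close> \<open>expectation (\<lambda>z. z) = 0\<close> by simp
qed

text \<open>Union bound over the sets of \<open>e + 1\<close> positions, with independence inside
  each set.\<close>

lemma many_large_noise_prob:
  fixes \<delta> :: real
  defines "p \<equiv> measure (gauss 1) {z. \<delta> \<le> \<bar>z\<bar>}"
  shows "measure (gaussian_noise n) {z \<in> space (gaussian_noise n). e < card {t. t < n \<and> \<delta> \<le> \<bar>z t\<bar>}} \<le>
    2 ^ n * p ^ Suc e"
proof -
  let ?G = "gaussian_noise n"
  interpret N: prob_space ?G by (rule prob_space_gaussian_noise)
  interpret g: prob_space "gauss 1" by (rule prob_space_gauss) simp
  interpret P: product_prob_space "\<lambda>_ :: nat. gauss 1"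
    by (rule product_prob_spaceI) (rule g.prob_space_axioms)
  define F where "F S = (\<Pi>\<^sub>E t\<in>{..<n}. if t \<in> S then {z. \<delta> \<le> \<bar>z\<bar>} else (UNIV :: real set))" for S
  let ?\<S> = "{S. S \<subseteq> {..<n} \<and> card S = Suc e}"
  have fin: "finite ?\<S>" by (rule finite_subset[of _ "Pow {..<n}"]) auto
  have m: "(if t \<in> S then {z. \<delta> \<le> \<bar>z\<bar>} else (UNIV :: real set)) \<in> sets (gauss 1)" for t S
    by simp
  have Fs: "F S \<in> sets ?G" for S
    unfolding F_def gaussian_noise_def using m by (intro sets_PiM_I_finite) auto
  have FP: "measure ?G (F S) = p ^ Suc e" if S: "S \<in> ?\<S>" for S
  proof -
    have "ennreal (measure ?G (F S)) = emeasure ?G (F S)" by (simp add: N.emeasure_eq_measure)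
    also have "\<dots> = (\<Prod>t\<in>{..<n}. emeasure (gauss 1) (if t \<in> S then {z. \<delta> \<le> \<bar>z\<bar>} else UNIV))"
      unfolding F_def gaussian_noise_def using m by (intro P.emeasure_PiM) auto
    also have "\<dots> = ennreal (\<Prod>t\<in>{..<n}. measure (gauss 1) (if t \<in> S then {z. \<delta> \<le> \<bar>z\<bar>} else UNIV))"
      by (simp add: g.emeasure_eq_measure prod_ennreal)
    finally have "measure ?G (F S) = (\<Prod>t\<in>{..<n}. measure (gauss 1) (if t \<in> S then {z. \<delta> \<le> \<bar>z\<bar>} else UNIV))"
      by (subst (asm) ennreal_inj) (auto intro: prod_nonneg)
    also have "\<dots> = (\<Prod>t\<in>{..<n}. if t \<in> S then p else 1)"
      using g.prob_space by (intro prod.cong) (auto simp: p_def)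
    also have "\<dots> = p ^ Suc e" using S by (simp add: prod.If_cases Int_absorb1)
    finally show ?thesis .
  qed
  have "{z \<in> space ?G. e < card {t. t < n \<and> \<delta> \<le> \<bar>z t\<bar>}} \<subseteq> (\<Union>S\<in>?\<S>. F S)"
  proof
    fix z assume z: "z \<in> {z \<in> space ?G. e < card {t. t < n \<and> \<delta> \<le> \<bar>z t\<bar>}}"
    then have "Suc e \<le> card {t. t < n \<and> \<delta> \<le> \<bar>z t\<bar>}" by auto
    then obtain S where S: "S \<subseteq> {t. t < n \<and> \<delta> \<le> \<bar>z t\<bar>}" "card S = Suc e"
      by (rule obtain_subset_with_card_n) auto
    then have "S \<in> ?\<S>" "z \<in> F S" using z by (auto simp: F_def gaussian_noise_def space_PiM PiE_iff)
    then show "z \<in> (\<Union>S\<in>?\<S>. F S)" by blast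
  qed
  then have "measure ?G {z \<in> space ?G. e < card {t. t < n \<and> \<delta> \<le> \<bar>z t\<bar>}} \<le> measure ?G (\<Union>S\<in>?\<S>. F S)"
    using fin Fs by (intro N.finite_measure_mono sets.finite_UN) auto
  also have "\<dots> \<le> (\<Sum>S\<in>?\<S>. measure ?G (F S))" using fin Fs by (intro measure_UNION_le) auto
  also have "\<dots> = real (card ?\<S>) * p ^ Suc e" using FP by simp
  also have "\<dots> \<le> real (card (Pow {..<n})) * p ^ Suc e"
    by (intro mult_right_mono of_nat_mono card_mono) (auto simp: p_def)
  finally show ?thesis by (simp add: card_Pow)
qed

text \<open>Every user has its own code over its alphabet \<open>A k\<close>. Symbols are detected
  one at a time by closeness to some admissible signal, whatever the other users send. Detection can
  fail only where the noise is at least \<open>\<delta>\<close>, and a code of distance greater than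
  \<open>2 * e\<close> corrects \<open>e\<close> failures.\<close>

lemma code_exists:
  fixes A :: "'n::finite \<Rightarrow> 'a set" and X :: "('n \<Rightarrow> 'a) \<Rightarrow> real ^ 'm::finite" and h :: "'n \<times> nat \<Rightarrow> real ^ 'm"
  assumes A: "\<And>k. finite (A k)" "\<And>k. A k \<noteq> {}" and n: "n > 0" and L: "\<And>k. L k > 0" and \<delta>: "\<delta> > 0"
    and power: "\<And>s. s \<in> Pi\<^sub>E UNIV A \<Longrightarrow> (norm (X s))\<^sup>2 \<le> P"
    and sep: "\<And>k j s s'. j \<in> {1..J k} \<Longrightarrow> s \<in> Pi\<^sub>E UNIV A \<Longrightarrow> s' \<in> Pi\<^sub>E UNIV A \<Longrightarrow> s k \<noteq> s' k \<Longrightarrow>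
       2 * \<delta> \<le> \<bar>inner (h (k, j)) (X s) - inner (h (k, j)) (X s')\<bar>"
    and GV: "\<And>k. L k * (2 ^ n * card (A k) ^ (2 * e)) \<le> card (A k) ^ n"
    and tail: "2 ^ n * measure (gauss 1) {z. \<delta> \<le> \<bar>z\<bar>} ^ Suc e \<le> \<epsilon>"
  shows "\<exists>enc dec. is_code J h P n L \<epsilon> enc dec"
proof -
  have "\<exists>c. (\<forall>i<L k. c i \<in> {..<n} \<rightarrow>\<^sub>E A k) \<and> (\<forall>i<L k. \<forall>j<L k. i \<noteq> j \<longrightarrow> 2 * e < hamming n (c i) (c j))" for k
    by (rule Gilbert_Varshamov[OF A GV])
  then obtain c where c: "\<And>k i. i < L k \<Longrightarrow> c k i \<in> {..<n} \<rightarrow>\<^sub>E A k"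
      "\<And>k i j. i < L k \<Longrightarrow> j < L k \<Longrightarrow> i \<noteq> j \<Longrightarrow> 2 * e < hamming n (c k i) (c k j)" by metis
  define sym where "sym w t = (\<lambda>k. c k (w k) t)" for w t
  define enc where "enc w t = X (sym w t)" for w t
  \<comment> \<open>A neighbourhood of all signals in which user \<open>k\<close> sends
    \<open>a\<close>. The interference is not decoded; it suffices that these sets are disjoint for
    different \<open>a\<close>, which the separation \<open>2 * \<delta>\<close> ensures.\<close>
  define U where "U k j a = (\<Union>s\<in>{s \<in> Pi\<^sub>E UNIV A. s k = a}. {y. \<bar>y - inner (h (k, j)) (X s)\<bar> < \<delta>})" for k j a
  define dist_ok where "dist_ok k j i y \<longleftrightarrow> i < L k \<and> card {t. t < n \<and> y t \<notin> U k j (c k i t)} \<le> e" for k j i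
    and y :: "nat \<Rightarrow> real"
  \<comment> \<open>\<open>LEAST\<close> gives a measurable choice; when at most \<open>e\<close>
    noise entries are large, the admissible index is unique.\<close>
  define dec where "dec k j y = (LEAST i. dist_ok k j i y)" for k j y
  have U: "U k j a \<in> sets borel" for k j a
    unfolding U_def by (intro borel_open open_UN ballI open_Collect_less continuous_intros)
  have U_disj: "a = b" if jk: "j \<in> {1..J k}" and ya: "y \<in> U k j a" and yb: "y \<in> U k j b" for k j a b y
  proof (rule ccontr)
    assume "a \<noteq> b"
    obtain s where s: "s \<in> Pi\<^sub>E UNIV A" "s k = a" "\<bar>y - inner (h (k, j)) (X s)\<bar> < \<delta>"
      using ya by (auto simp: U_def)
    obtain s' where s': "s' \<in> Pi\<^sub>E UNIV A" "s' k = b" "\<bar>y - inner (h (k, j)) (X s')\<bar> < \<delta>"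
      using yb by (auto simp: U_def)
    have "2 * \<delta> \<le> \<bar>inner (h (k, j)) (X s) - inner (h (k, j)) (X s')\<bar>"
      using sep[OF jk s(1) s'(1)] s(2) s'(2) \<open>a \<noteq> b\<close> by auto
    with s(3) s'(3) show False by linarith
  qed
  have sym: "sym w t \<in> Pi\<^sub>E UNIV A" if "w \<in> message_tuples L" "t < n" for w t
    using that c(1) by (fastforce simp: sym_def message_tuples_def PiE_iff)
  have wk: "w k < L k" if "w \<in> message_tuples L" for w k using that by (auto simp: message_tuples_def)
  have cT: "card (message_tuples L) > 0"
    unfolding message_tuples_def using L by (subst card_PiE) (auto intro!: prod_pos)
  have "average_power n L enc \<le> P"
  proof -
    have "(\<Sum>w\<in>message_tuples L. (\<Sum>t<n. (norm (enc w t))\<^sup>2) / real n) \<le> (\<Sum>w\<in>message_tuples L. P)"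
    proof (rule sum_mono)
      fix w assume w: "w \<in> message_tuples L"
      have "(\<Sum>t<n. (norm (enc w t))\<^sup>2) \<le> (\<Sum>t<n. P)"
        unfolding enc_def using sym[OF w] by (intro sum_mono power) auto
      then show "(\<Sum>t<n. (norm (enc w t))\<^sup>2) / real n \<le> P" using n by (simp add: field_simps)
    qed
    then show ?thesis using cT unfolding average_power_def by (simp add: field_simps)
  qed
  moreover have "dec k j \<in> measurable (PiM {..<n} (\<lambda>_. borel)) (count_space UNIV)" for k j
  proof -
    let ?M = "PiM {..<n} (\<lambda>_. borel :: real measure)"
    have "{y \<in> space ?M. dist_ok k j i y} \<in> sets ?M" for i
    proof -
      have "(\<lambda>y. \<Sum>t<n. indicator (- U k j (c k i t)) (y t) :: real) \<in> borel_measurable ?M"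
      proof (rule borel_measurable_sum)
        fix t assume t: "t \<in> {..<n}"
        have "(\<lambda>y. y t) \<in> borel_measurable ?M" by (rule measurable_component_singleton[OF t])
        moreover have "(indicator (- U k j (c k i t)) :: real \<Rightarrow> real) \<in> borel_measurable borel"
          using U by (intro borel_measurable_indicator) auto
        ultimately show "(\<lambda>y. indicator (- U k j (c k i t)) (y t) :: real) \<in> borel_measurable ?M"
          by (rule measurable_compose)
      qed
      then have s1: "{y \<in> space ?M. (\<Sum>t<n. indicator (- U k j (c k i t)) (y t)) \<le> real e} \<in> sets ?M"
        by measurable
      have eq: "(\<Sum>t<n. indicator (- U k j (c k i t)) (y t)) = real (card {t. t < n \<and> y t \<notin> U k j (c k i t)})"
        for y
      proof -
        have "(\<Sum>t<n. indicator (- U k j (c k i t)) (y t)) =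
          (\<Sum>t<n. if y t \<notin> U k j (c k i t) then 1 else 0 :: real)"
          by (intro sum.cong) (auto simp: indicator_def)
        also have "\<dots> = real (card ({..<n} \<inter> {t. y t \<notin> U k j (c k i t)}))" by (simp add: sum.If_cases)
        also have "{..<n} \<inter> {t. y t \<notin> U k j (c k i t)} = {t. t < n \<and> y t \<notin> U k j (c k i t)}" by auto
        finally show ?thesis .
      qed
      have s: "{y \<in> space ?M. card {t. t < n \<and> y t \<notin> U k j (c k i t)} \<le> e} \<in> sets ?M"
        using s1 unfolding eq of_nat_le_iff .
      show ?thesis
      proof (cases "i < L k")
        case True
        then have "{y \<in> space ?M. dist_ok k j i y} =
          {y \<in> space ?M. card {t. t < n \<and> y t \<notin> U k j (c k i t)} \<le> e}"
          by (simp only: dist_ok_def simp_thms)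
        then show ?thesis using s by (simp only:)
      next
        case False
        then have "{y \<in> space ?M. dist_ok k j i y} = {}" by (simp add: dist_ok_def)
        then show ?thesis by (simp only: sets.empty_sets)
      qed
    qed
    then show ?thesis unfolding dec_def
      by (intro measurable_Least) (simp only: pred_def)
  qed
  moreover have "error_prob n L enc k (h (k, j)) (dec k j) \<le> \<epsilon>" if j: "j \<in> {1..J k}" for k j
  proof -
    let ?G = "gaussian_noise n"
    interpret N: prob_space ?G by (rule prob_space_gaussian_noise)
    have le: "measure ?G {z \<in> space ?G. dec k j (received n (h (k, j)) (enc w) z) \<noteq> w k} \<le> \<epsilon>"
      if w: "w \<in> message_tuples L" for w
    proof -
      have ok: "dec k j (received n (h (k, j)) (enc w) z) = w k" if z: "card {t. t < n \<and> \<delta> \<le> \<bar>z t\<bar>} \<le> e" for z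
      proof -
        let ?y = "received n (h (k, j)) (enc w) z"
        let ?E = "\<lambda>i. {t. t < n \<and> ?y t \<notin> U k j (c k i t)}"
        have in_U: "?y t \<in> U k j (c k (w k) t)" if t: "t < n" "\<not> \<delta> \<le> \<bar>z t\<bar>" for t
          unfolding U_def
        proof (rule UN_I[of "sym w t"])
          show "sym w t \<in> {s \<in> Pi\<^sub>E UNIV A. s k = c k (w k) t}" using sym[OF w t(1)] by (simp add: sym_def)
          show "?y t \<in> {y. \<bar>y - inner (h (k, j)) (X (sym w t))\<bar> < \<delta>}"
            using t by (simp add: received_def enc_def)
        qed
        have "card (?E (w k)) \<le> card {t. t < n \<and> \<delta> \<le> \<bar>z t\<bar>}" using in_U by (intro card_mono) auto
        then have true_ok: "dist_ok k j (w k) ?y" using z wk[OF w] by (simp add: dist_ok_def)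
        have uni: "i = w k" if i: "dist_ok k j i ?y" for i
        proof (rule ccontr)
          assume ne: "i \<noteq> w k"
          have "{t. t < n \<and> c k i t \<noteq> c k (w k) t} \<subseteq> ?E i \<union> ?E (w k)" using U_disj[OF j] by blast
          then have "hamming n (c k i) (c k (w k)) \<le> card (?E i \<union> ?E (w k))"
            unfolding hamming_def by (intro card_mono) auto
          also have "\<dots> \<le> card (?E i) + card (?E (w k))" by (rule card_Un_le)
          also have "\<dots> \<le> 2 * e" using i true_ok by (simp add: dist_ok_def)
          finally show False using c(2)[of i k "w k"] i wk[OF w, of k] ne by (simp add: dist_ok_def)
        qed
        show ?thesis unfolding dec_def by (rule Least_equality, rule true_ok) (drule uni, simp)
      qed
      have "measure ?G {z \<in> space ?G. dec k j (received n (h (k, j)) (enc w) z) \<noteq> w k} \<le>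
          measure ?G {z \<in> space ?G. e < card {t. t < n \<and> \<delta> \<le> \<bar>z t\<bar>}}"
      proof (rule N.finite_measure_mono)
        show "{z \<in> space ?G. dec k j (received n (h (k, j)) (enc w) z) \<noteq> w k} \<subseteq> {z \<in> space ?G. e < card {t. t < n \<and> \<delta> \<le> \<bar>z t\<bar>}}"
          using ok by (auto simp: not_le[symmetric])
        have "(\<lambda>z. \<Sum>t<n. indicator {z. \<delta> \<le> \<bar>z\<bar>} (z t) :: real) \<in> borel_measurable ?G"
        proof (rule borel_measurable_sum)
          fix t assume t: "t \<in> {..<n}"
          have "(\<lambda>y. y t) \<in> borel_measurable (PiM {..<n} (\<lambda>_. borel :: real measure))"
            by (rule measurable_component_singleton[OF t])
          then have "(\<lambda>y. y t) \<in> borel_measurable ?G"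
            by (subst measurable_cong_sets[OF sets_gaussian_noise refl])
          moreover have "(indicator {z. \<delta> \<le> \<bar>z\<bar>} :: real \<Rightarrow> real) \<in> borel_measurable borel"
            by (intro borel_measurable_indicator) measurable
          ultimately show "(\<lambda>y. indicator {z. \<delta> \<le> \<bar>z\<bar>} (y t) :: real) \<in> borel_measurable ?G"
            by (rule measurable_compose)
        qed
        then have s1: "{z \<in> space ?G. real e < (\<Sum>t<n. indicator {z. \<delta> \<le> \<bar>z\<bar>} (z t))} \<in> sets ?G" by measurable
        have eq: "(\<Sum>t<n. indicator {z. \<delta> \<le> \<bar>z\<bar>} (z t)) = real (card {t. t < n \<and> \<delta> \<le> \<bar>z t\<bar>})" for z
        proof -
          have "(\<Sum>t<n. indicator {z. \<delta> \<le> \<bar>z\<bar>} (z t)) = (\<Sum>t<n. if \<delta> \<le> \<bar>z t\<bar> then 1 else 0 :: real)"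
            by (intro sum.cong) (auto simp: indicator_def)
          also have "\<dots> = real (card ({..<n} \<inter> {t. \<delta> \<le> \<bar>z t\<bar>}))" by (simp add: sum.If_cases)
          also have "{..<n} \<inter> {t. \<delta> \<le> \<bar>z t\<bar>} = {t. t < n \<and> \<delta> \<le> \<bar>z t\<bar>}" by auto
          finally show ?thesis .
        qed
        show "{z \<in> space ?G. e < card {t. t < n \<and> \<delta> \<le> \<bar>z t\<bar>}} \<in> sets ?G"
          using s1 unfolding eq of_nat_less_iff .
      qed
      also have "\<dots> \<le> \<epsilon>" by (rule order_trans[OF many_large_noise_prob tail])
      finally show ?thesis .
    qed
    have "(\<Sum>w\<in>message_tuples L. measure ?G {z \<in> space ?G. dec k j (received n (h (k, j)) (enc w) z) \<noteq> w k}) \<le>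
      (\<Sum>w\<in>message_tuples L. \<epsilon>)"
      by (intro sum_mono le)
    then show ?thesis using cT unfolding error_prob_def by (simp add: field_simps)
  qed
  ultimately have "is_code J h P n L \<epsilon> enc dec" by (simp add: is_code_def)
  then show ?thesis by blast
qed

text \<open>At fixed power a single symbol is detected with an error probability that does not
  depend on \<open>n\<close>. Codes that correct a fraction \<open>\<tau>\<close> of the positions
  make the block error decrease geometrically.\<close>

lemma achievable_from_separation:
  fixes A :: "'n::finite \<Rightarrow> 'a set" and X :: "('n \<Rightarrow> 'a) \<Rightarrow> real ^ 'm::finite" and h :: "'n \<times> nat \<Rightarrow> real ^ 'm"
  assumes A: "\<And>k. finite (A k)" "\<And>k. A k \<noteq> {}" and \<delta>: "\<delta> > 0"
    and power: "\<And>s. s \<in> Pi\<^sub>E UNIV A \<Longrightarrow> (norm (X s))\<^sup>2 \<le> P"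
    and sep: "\<And>k j s s'. j \<in> {1..J k} \<Longrightarrow> s \<in> Pi\<^sub>E UNIV A \<Longrightarrow> s' \<in> Pi\<^sub>E UNIV A \<Longrightarrow> s k \<noteq> s' k \<Longrightarrow>
       2 * \<delta> \<le> \<bar>inner (h (k, j)) (X s) - inner (h (k, j)) (X s')\<bar>"
    and \<tau>: "0 < \<tau>"
    and tail: "2 * measure (gauss 1) {z. \<delta> \<le> \<bar>z\<bar>} powr \<tau> \<le> 1 / 2"
    and R: "\<And>k. 0 \<le> R k" "\<And>k. R k + 2 \<le> (1 - 2 * \<tau>) * log 2 (card (A k))"
  shows "achievable J h P R"
proof -
  define p where "p = measure (gauss 1) {z. \<delta> \<le> \<bar>z\<bar>}"
  interpret g: prob_space "gauss 1" by (rule prob_space_gauss) simp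
  have p: "0 \<le> p" "p \<le> 1" by (auto simp: p_def)
  have q: "card (A k) \<ge> 1" for k using A[of k] by (simp add: Suc_le_eq card_gt_0_iff)
  have "\<forall>\<^sub>F n in sequentially. \<exists>enc dec. is_code J h P n (\<lambda>k. nat \<lceil>2 powr (real n * R k)\<rceil>) \<epsilon> enc dec"
    if \<epsilon>: "\<epsilon> > 0" for \<epsilon>
  proof -
    have "\<forall>\<^sub>F n in sequentially. (1 / 2 :: real) ^ n < \<epsilon>"
      by (rule order_tendstoD(2)[OF LIMSEQ_realpow_zero \<epsilon>]) auto
    then show ?thesis using eventually_gt_at_top[of 0]
    proof eventually_elim
      case (elim n)
      \<comment> \<open>The rate loss uses \<open>e \<le> \<tau> * n\<close>, the error probability
        uses \<open>\<tau> * n \<le> e + 1\<close>.\<close>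
      define e where "e = nat \<lfloor>\<tau> * real n\<rfloor>"
      have e: "real e \<le> \<tau> * real n" "\<tau> * real n \<le> real (Suc e)"
        using \<tau> by (auto simp: e_def of_nat_nat) linarith
      show ?case
      proof (rule code_exists[where A = A and X = X and \<delta> = \<delta> and e = e])
        show "finite (A k)" "A k \<noteq> {}" for k by (rule A)+
        show "n > 0" by (rule elim(2))
        show "\<delta> > 0" by (rule \<delta>)
        show "(norm (X s))\<^sup>2 \<le> P" if "s \<in> Pi\<^sub>E UNIV A" for s using that by (rule power)
        show "2 * \<delta> \<le> \<bar>inner (h (k, j)) (X s) - inner (h (k, j)) (X s')\<bar>"
          if "j \<in> {1..J k}" "s \<in> Pi\<^sub>E UNIV A" "s' \<in> Pi\<^sub>E UNIV A" "s k \<noteq> s' k" for k j s s'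
          using that by (rule sep)
      next
        fix k
        define x where "x = 2 powr (real n * R k)"
        have x1: "1 \<le> x" using R(1)[of k] by (simp add: x_def ge_one_powr_ge_zero)
        show "nat \<lceil>2 powr (real n * R k)\<rceil> > 0" by simp
        have "real (nat \<lceil>x\<rceil>) \<le> 2 * x" using x1 by linarith
        define q where "q = real (card (A k))"
        have q1: "q \<ge> 1" using q[of k] by (simp add: q_def)
        have "real (nat \<lceil>x\<rceil>) * (2 ^ n * q ^ (2 * e)) \<le> (2 * x) * (2 ^ n * q powr (2 * \<tau> * real n))"
        proof (intro mult_mono mult_nonneg_nonneg)
          show "real (nat \<lceil>x\<rceil>) \<le> 2 * x" by fact
          have "q ^ (2 * e) = q powr (real (2 * e))" using q1 by (subst powr_realpow) auto
          also have "\<dots> \<le> q powr (2 * \<tau> * real n)" using q1 e(1) by (intro powr_mono) auto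
          finally show "q ^ (2 * e) \<le> q powr (2 * \<tau> * real n)" .
        qed (use x1 q1 in auto)
        also have "\<dots> = 2 powr (1 + real n * R k + real n + 2 * \<tau> * real n * log 2 q)"
        proof -
          have "q powr (2 * \<tau> * real n) = 2 powr (2 * \<tau> * real n * log 2 q)"
            using q1 by (simp add: powr_def log_def)
          then show ?thesis by (simp add: x_def powr_add powr_realpow)
        qed
        \<comment> \<open>The two bits in \<open>R k + 2\<close> pay for the factor
          \<open>2 ^ n\<close> of the Hamming balls and, as \<open>n \<ge> 1\<close>, for rounding
          up the number of messages.\<close>
        also have "\<dots> \<le> 2 powr (real n * log 2 q)"
        proof (rule powr_mono)
          have "real n * (R k + 2) \<le> real n * ((1 - 2 * \<tau>) * log 2 q)"
            using R(2)[of k] by (intro mult_left_mono) (auto simp: q_def)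
          moreover have "real n \<ge> 1" using elim(2) by simp
          ultimately show "1 + real n * R k + real n + 2 * \<tau> * real n * log 2 q \<le> real n * log 2 q"
            by (simp add: algebra_simps)
        qed simp
        also have "\<dots> = q ^ n" using q1 by (simp add: powr_def log_def exp_of_nat_mult mult.assoc)
        finally have "real (nat \<lceil>x\<rceil> * (2 ^ n * card (A k) ^ (2 * e))) \<le> real (card (A k) ^ n)"
          by (simp add: q_def)
        then show "nat \<lceil>2 powr (real n * R k)\<rceil> * (2 ^ n * card (A k) ^ (2 * e)) \<le> card (A k) ^ n"
          unfolding x_def of_nat_le_iff .
      next
        have "2 ^ n * p ^ Suc e \<le> (2 * p powr \<tau>) ^ n"
        proof (cases "p = 0")
          case False
          then have p0: "p > 0" using p by simp
          have "p ^ Suc e = p powr real (Suc e)" using p0 by (subst powr_realpow) auto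
          also have "\<dots> \<le> p powr (\<tau> * real n)" using e(2) p0 p by (intro powr_mono') auto
          also have "\<dots> = (p powr \<tau>) ^ n" using p0 by (simp add: powr_powr flip: powr_realpow)
          finally show ?thesis by (simp add: power_mult_distrib)
        qed simp
        also have "\<dots> \<le> (1 / 2) ^ n" using tail by (intro power_mono) (auto simp: p_def)
        also have "\<dots> \<le> \<epsilon>" using elim(1) by simp
        finally show "2 ^ n * measure (gauss 1) {z. \<delta> \<le> \<bar>z\<bar>} ^ Suc e \<le> \<epsilon>" by (simp add: p_def)
      qed
    qed
  qed
  then show ?thesis using R(1) by (simp add: achievable_def)
qed

section \<open>Interference alignment\<close>

lemma finite_state_index: "finite (state_index (J :: 'n::finite \<Rightarrow> nat))"
  unfolding state_index_def by (intro finite_SigmaI) auto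

type_synonym ('n, 'm) coeff = "('n \<times> nat) \<times> 'm"
type_synonym ('n, 'm) expo = "('n, 'm) coeff \<Rightarrow> nat"

definition coords :: "('n \<Rightarrow> nat) \<Rightarrow> ('n, 'm) coeff set" where
  "coords J = state_index J \<times> UNIV"

definition bump :: "'p \<Rightarrow> ('p \<Rightarrow> nat) \<Rightarrow> 'p \<Rightarrow> nat" where
  "bump p e = e(p := Suc (e p))"

lemma monomial_bump:
  assumes "finite I" "i \<in> I"
  shows "monomial I (bump (i, m) e) h = h i $ m * monomial I e h"
proof -
  have mem: "(i, m) \<in> I \<times> UNIV" using assms by simp
  have fin: "finite (I \<times> (UNIV :: 'b set))" using assms by simp
  have "monomial I (bump (i, m) e) h = (h i $ m) ^ Suc (e (i, m)) * (\<Prod>(i', m')\<in>I \<times> UNIV - {(i, m)}. (h i' $ m') ^ bump (i, m) e (i', m'))"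
    unfolding monomial_def prod.remove[OF fin mem] by (simp add: bump_def)
  also have "(\<Prod>(i', m')\<in>I \<times> UNIV - {(i, m)}. (h i' $ m') ^ bump (i, m) e (i', m')) =
      (\<Prod>(i', m')\<in>I \<times> UNIV - {(i, m)}. (h i' $ m') ^ e (i', m'))"
  proof (rule prod.cong[OF refl])
    fix x assume "x \<in> I \<times> (UNIV :: 'b set) - {(i, m)}"
    then have "bump (i, m) e x = e x" by (simp add: bump_def)
    then show "(case x of (i', m') \<Rightarrow> (h i' $ m') ^ bump (i, m) e (i', m')) =
      (case x of (i', m') \<Rightarrow> (h i' $ m') ^ e (i', m'))"
      by (cases x) simp
  qed
  also have "(h i $ m) ^ Suc (e (i, m)) * \<dots> = h i $ m * monomial I e h"
    unfolding monomial_def prod.remove[OF fin mem] by simp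
  finally show ?thesis .
qed

text \<open>Exponents of the monomials that carry the symbols of user \<open>l\<close>. In the coordinates of the other
  users multiplication by a channel coefficient only enlarges the range \<open>{1..b}\<close> to \<open>{1..b+1}\<close>, which
  aligns the interference. The exponents in the coordinates of \<open>l\<close> itself are large, which separates the
  signals of different users, and even, so that a desired term reveals the antenna it came from.\<close>

definition exps :: "('n \<Rightarrow> nat) \<Rightarrow> nat \<Rightarrow> 'n \<Rightarrow> ('n, 'm) expo set" where
  "exps J b l = (\<Pi>\<^sub>E p\<in>coords J. if fst (fst p) = l then (\<lambda>s. 2 * b + 2 * s) ` {1..b} else {1..b})"

text \<open>Receivers of users other than \<open>l\<close> multiply by coefficients outside the
  coordinates of \<open>l\<close>. One additional value in the other ranges therefore contains the
  images of \<open>exps J b l\<close> at all these receivers, from all antennas at once.\<close>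

definition aligned_exps :: "('n \<Rightarrow> nat) \<Rightarrow> nat \<Rightarrow> 'n \<Rightarrow> ('n, 'm) expo set" where
  "aligned_exps J b l = (\<Pi>\<^sub>E p\<in>coords J. if fst (fst p) =
    l then (\<lambda>s. 2 * b + 2 * s) ` {1..b} else {1..b + 1})"

lemma finite_coords: "finite (coords (J :: 'n::finite \<Rightarrow> nat) :: ('n, 'm::finite) coeff set)"
  by (simp add: coords_def finite_state_index)

lemma finite_exps: "finite (exps (J :: 'n::finite \<Rightarrow> nat) b l :: ('n, 'm::finite) expo set)"
  "finite (aligned_exps J b l :: ('n, 'm) expo set)"
  unfolding exps_def aligned_exps_def by (intro finite_PiE finite_coords; simp)+

lemma card_even_range: "card ((\<lambda>s. 2 * b + 2 * s) ` {1..b::nat}) = b"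
  by (subst card_image) (auto simp: inj_on_def)

lemma card_exps: "card (exps (J :: 'n::finite \<Rightarrow> nat) b l :: ('n, 'm::finite) expo set) =
  b ^ card (coords J :: ('n, 'm) coeff set)"
proof -
  have "card (exps J b l :: ('n, 'm) expo set) = (\<Prod>p\<in>(coords J :: ('n, 'm) coeff set).
      card (if fst (fst p) = l then (\<lambda>s. 2 * b + 2 * s) ` {1..b} else {1..b}))"
    unfolding exps_def by (rule card_PiE[OF finite_coords])
  also have "\<dots> = (\<Prod>p\<in>(coords J :: ('n, 'm) coeff set). b)"
    using card_even_range[of b] by (intro prod.cong[OF refl]) simp
  finally show ?thesis by simp
qed

lemma card_aligned_exps: "card (aligned_exps (J :: 'n::finite \<Rightarrow> nat) b l :: ('n, 'm::finite) expo set) \<le>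
  (b + 1) ^ card (coords J :: ('n, 'm) coeff set)"
proof -
  have "card (aligned_exps J b l :: ('n, 'm) expo set) = (\<Prod>p\<in>(coords J :: ('n, 'm) coeff set).
      card (if fst (fst p) = l then (\<lambda>s. 2 * b + 2 * s) ` {1..b} else {1..b + 1}))"
    unfolding aligned_exps_def by (rule card_PiE[OF finite_coords])
  also have "\<dots> \<le> (\<Prod>p\<in>(coords J :: ('n, 'm) coeff set). b + 1)"
    using card_even_range[of b] by (intro prod_mono) simp
  finally show ?thesis by simp
qed

text \<open>The slack 1 raises the exponent from \<open>card S - 1\<close> to \<open>card S\<close>,
  a loss that disappears as the number of monomials grows with \<open>b\<close>. All finite sets of
  exponents are included, so one null set serves every \<open>b\<close>.\<close>

definition generic :: "('n::finite \<Rightarrow> nat) \<Rightarrow> ('n \<times> nat \<Rightarrow> real ^ 'm::finite) \<Rightarrow> bool" where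
  "generic J h \<longleftrightarrow> (\<forall>E S. S \<noteq> {} \<longrightarrow> S \<subseteq> (\<Pi>\<^sub>E p\<in>coords J. {..E}) \<longrightarrow>
     badly_approximable S (\<lambda>a. monomial (state_index J) a h) 1)"

text \<open>There are countably many exponent bounds \<open>E\<close>, and finitely many sets
  \<open>S\<close> for each of them.\<close>

lemma AE_generic: "AE h in state_lebesgue (J :: 'n::finite \<Rightarrow> nat). generic J (h :: 'n \<times> nat \<Rightarrow> real ^ 'm::finite)"
proof -
  let ?M = "state_lebesgue J :: ('n \<times> nat \<Rightarrow> real ^ 'm) measure"
  have "AE h in ?M. \<forall>S\<in>Pow (\<Pi>\<^sub>E p\<in>(coords J :: ('n, 'm) coeff set). {..E}). S \<noteq> {} \<longrightarrow>
     badly_approximable S (\<lambda>a. monomial (state_index J) a h) 1" for E :: nat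
  proof (rule AE_finite_allI)
    show "finite (Pow (\<Pi>\<^sub>E p\<in>(coords J :: ('n, 'm) coeff set). {..E}))"
      by (intro finite_Pow_iff[THEN iffD2] finite_PiE finite_coords) auto
    fix S assume S: "S \<in> Pow (\<Pi>\<^sub>E p\<in>(coords J :: ('n, 'm) coeff set). {..E})"
    show "AE h in ?M. S \<noteq> {} \<longrightarrow> badly_approximable S (\<lambda>a. monomial (state_index J) a h) 1"
    proof (cases "S = {}")
      case False
      have "AE h in ?M. badly_approximable S (\<lambda>a. monomial (state_index J) a h) 1"
        unfolding state_lebesgue_def
        by (rule AE_monomials_badly_approximable[OF finite_state_index False]) (use S in \<open>auto simp: coords_def\<close>)
      then show ?thesis by (rule AE_mp) auto
    qed simp
  qed
  then have "AE h in ?M. \<forall>E::nat. \<forall>S\<in>Pow (\<Pi>\<^sub>E p\<in>(coords J :: ('n, 'm) coeff set). {..E}). S \<noteq> {} \<longrightarrow>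
     badly_approximable S (\<lambda>a. monomial (state_index J) a h) 1"
    by (simp add: AE_all_countable)
  then show ?thesis by (rule AE_mp) (auto simp: generic_def)
qed

section \<open>Symbol streams and their images at the receivers\<close>

definition stream_labels :: "('n \<Rightarrow> nat) \<Rightarrow> nat \<Rightarrow> ('n \<times> 'm \<times> ('n, 'm) expo) set" where
  "stream_labels J b = (SIGMA l:UNIV. UNIV \<times> exps J b l)"

definition symbols :: "('n \<Rightarrow> nat) \<Rightarrow> nat \<Rightarrow> nat \<Rightarrow> 'n \<Rightarrow> ('m \<times> ('n, 'm) expo \<Rightarrow> int) set" where
  "symbols J b Q l = (\<Pi>\<^sub>E x\<in>UNIV \<times> exps J b l. {0..int Q})"

text \<open>The exponent with which a stream arrives at the user and state \<open>i\<close>: a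
  stream on antenna \<open>m\<close> picks up the factor \<open>h i $ m\<close>.\<close>

definition landing :: "'n \<times> nat \<Rightarrow> 'n \<times> 'm \<times> ('n, 'm) expo \<Rightarrow> ('n, 'm) expo" where
  "landing i x = (case x of (l, m, e) \<Rightarrow> bump (i, m) e)"

lemma finite_stream_labels: "finite (stream_labels (J :: 'n::finite \<Rightarrow> nat) b :: ('n \<times> 'm::finite \<times> ('n, 'm) expo) set)"
  unfolding stream_labels_def using finite_exps(1) by (intro finite_SigmaI) auto

text \<open>In the coordinates of \<open>k\<close> its own exponents are at least
  \<open>2 * b + 2\<close>, while those of other users are at most \<open>b + 1\<close> even after
  multiplication; so the stream belongs to \<open>k\<close>. Its exponents there are even, so the
  odd one reveals the antenna, and lowering it recovers \<open>e\<close>.\<close>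

lemma landing_unique:
  assumes k: "j \<in> {1..J k}" and e: "e \<in> exps J b k" and x: "x \<in> stream_labels J b"
    and eq: "landing (k, j) x = landing (k, j) (k, m, e)"
  shows "x = (k, m, e)"
proof -
  obtain l' m' e' where x': "x = (l', m', e')" by (cases x)
  have e': "e' \<in> exps J b l'" using x by (simp add: x' stream_labels_def)
  have mem: "((k, j), m'') \<in> coords J" for m'' using k by (simp add: coords_def state_index_def)
  have eq': "bump ((k, j), m') e' = bump ((k, j), m) e" using eq by (simp add: landing_def x')
  have ev: "\<exists>s. e ((k, j), m'') = 2 * b + 2 * s \<and> 1 \<le> s" for m''
    using PiE_mem[OF e[unfolded exps_def] mem[of m'']] by auto
  have at: "bump ((k, j), m') e' ((k, j), m) = Suc (e ((k, j), m))" unfolding eq' by (simp add: bump_def)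
  have "l' = k"
  proof (rule ccontr)
    assume "l' \<noteq> k"
    then have "e' ((k, j), m'') \<le> b" for m'' using PiE_mem[OF e'[unfolded exps_def] mem[of m'']] by auto
    then have "bump ((k, j), m') e' ((k, j), m) \<le> Suc b" by (simp add: bump_def le_SucI)
    then show False using ev[of m] at by auto
  qed
  then have ev': "\<exists>s. e' ((k, j), m'') = 2 * b + 2 * s \<and> 1 \<le> s" for m''
    using PiE_mem[OF e'[unfolded exps_def] mem[of m'']] by auto
  have "m' = m"
  proof (rule ccontr)
    assume "m' \<noteq> m"
    then have "e' ((k, j), m) = Suc (e ((k, j), m))" using at by (simp add: bump_def)
    moreover obtain s s' where "e' ((k, j), m) = 2 * b + 2 * s" "e ((k, j), m) = 2 * b + 2 * s'"
      using ev[of m] ev'[of m] by auto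
    ultimately have "2 * (b + s) = Suc (2 * (b + s'))" by simp
    then show False by (metis even_Suc even_mult_iff even_numeral)
  qed
  moreover have "e' = e"
  proof
    fix p show "e' p = e p" using fun_cong[OF eq', of p] \<open>m' = m\<close> by (auto simp: bump_def split: if_splits)
  qed
  ultimately show ?thesis using x' \<open>l' = k\<close> by simp
qed

text \<open>Own streams are counted individually. Those of another user fall into its aligned set
  regardless of the antenna, so an interferer contributes no factor \<open>CARD('m)\<close>. This
  asymmetry is the gain from alignment.\<close>

lemma card_landing:
  fixes J :: "'n::finite \<Rightarrow> nat"
  assumes k: "j \<in> {1..J k}"
  shows "card (landing (k, j) ` (stream_labels J b :: ('n \<times> 'm::finite \<times> ('n, 'm) expo) set)) \<le>
     CARD('m) * b ^ card (coords J :: ('n, 'm) coeff set) +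
       (CARD('n) - 1) * (b + 1) ^ card (coords J :: ('n, 'm) coeff set)"
proof -
  let ?G = "card (coords J :: ('n, 'm) coeff set)"
  let ?own = "landing (k, j) ` ({k} \<times> (UNIV :: 'm set) \<times> exps J b k)"
  let ?al = "\<Union>l\<in>UNIV - {k}. (aligned_exps J b l :: ('n, 'm) expo set)"
  have "landing (k, j) ` (stream_labels J b :: ('n \<times> 'm \<times> ('n, 'm) expo) set) \<subseteq> ?own \<union> ?al"
  proof
    fix a assume "a \<in> landing (k, j) ` (stream_labels J b :: ('n \<times> 'm \<times> ('n, 'm) expo) set)"
    then obtain l m e where e: "e \<in> exps J b l" "a = landing (k, j) (l, m, e)"
      by (auto simp: stream_labels_def)
    show "a \<in> ?own \<union> ?al"
    proof (cases "l = k")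
      case True then show ?thesis using e by auto
    next
      case False
      have mem: "((k, j), m) \<in> coords J" using k by (simp add: coords_def state_index_def)
      have "bump ((k, j), m) e \<in> aligned_exps J b l" unfolding aligned_exps_def
      proof (rule PiE_I)
        fix p assume p: "p \<in> (coords J :: ('n, 'm) coeff set)"
        then have "e p \<in> (if fst (fst p) = l then (\<lambda>s. 2 * b + 2 * s) ` {1..b} else {1..b})"
          using e(1) unfolding exps_def by (rule PiE_mem[rotated])
        then show "bump ((k, j), m) e p \<in> (if fst (fst p) =
          l then (\<lambda>s. 2 * b + 2 * s) ` {1..b} else {1..b + 1})"
          using False by (auto simp: bump_def split: if_splits)
      next
        fix p assume p: "p \<notin> (coords J :: ('n, 'm) coeff set)"
        then have "p \<noteq> ((k, j), m)" using mem by blast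
        then show "bump ((k, j), m) e p = undefined"
          using PiE_arb[OF e(1)[unfolded exps_def] p] by (simp add: bump_def)
      qed
      then show ?thesis using False e(2) by (auto simp: landing_def)
    qed
  qed
  then have "card (landing (k, j) ` (stream_labels J b :: ('n \<times> 'm \<times> ('n, 'm) expo) set)) \<le> card (?own \<union> ?al)"
    by (intro card_mono) (simp_all add: finite_exps)
  also have "\<dots> \<le> card ?own + card ?al" by (rule card_Un_le)
  also have "card ?own \<le> card ({k} \<times> (UNIV :: 'm set) \<times> (exps J b k :: ('n, 'm) expo set))"
    by (intro card_image_le) (simp add: finite_exps)
  also have "\<dots> = CARD('m) * b ^ ?G" by (simp add: card_cartesian_product card_exps)
  also have "card ?al \<le> (\<Sum>l\<in>UNIV - {k}. card (aligned_exps J b l :: ('n, 'm) expo set))"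
    by (rule card_UN_le) simp
  also have "\<dots> \<le> (\<Sum>l\<in>UNIV - {k}. (b + 1) ^ ?G)" by (intro sum_mono card_aligned_exps)
  also have "\<dots> = (CARD('n) - 1) * (b + 1) ^ ?G" by simp
  finally show ?thesis by simp
qed

section \<open>Minimum distance of the received signals\<close>

definition signal :: "('n::finite \<Rightarrow> nat) \<Rightarrow> nat \<Rightarrow> ('n \<times> nat \<Rightarrow> real ^ 'm::finite) \<Rightarrow>
    ('n \<Rightarrow> 'm \<times> ('n, 'm) expo \<Rightarrow> int) \<Rightarrow> real ^ 'm" where
  "signal J b h s = (\<Sum>(l, m, e)\<in>stream_labels J b. (real_of_int (s l (m, e)) * monomial (state_index J) e h) *\<^sub>R axis m 1)"

lemma inner_signal:
  fixes h :: "'n::finite \<times> nat \<Rightarrow> real ^ 'm::finite"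
  assumes k: "j \<in> {1..J k}"
  shows "inner (h (k, j)) (signal J b h s) =
    (\<Sum>x\<in>stream_labels J b. real_of_int (s (fst x) (snd x)) * monomial (state_index J) (landing (k, j) x) h)"
proof -
  have "(k, j) \<in> state_index J" using k by (simp add: state_index_def)
  note mb = monomial_bump[OF finite_state_index this]
  show ?thesis unfolding signal_def inner_sum_right
  proof (rule sum.cong[OF refl])
    fix x :: "'n \<times> 'm \<times> ('n, 'm) expo"
    obtain l m e where x: "x = (l, m, e)" by (cases x)
    show "inner (h (k, j)) (case x of (l, m, e) \<Rightarrow> (real_of_int (s l (m, e)) * monomial (state_index J) e h) *\<^sub>R axis m 1) =
        real_of_int (s (fst x) (snd x)) * monomial (state_index J) (landing (k, j) x) h"
      using mb[of m e h] by (simp add: x landing_def inner_axis)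
  qed
qed

lemma signal_norm_le:
  assumes s: "s \<in> Pi\<^sub>E UNIV (symbols J b Q)"
  shows "norm (signal J b h s) \<le> real Q * (\<Sum>(l, m, e)\<in>(stream_labels J b :: ('n::finite \<times> 'm::finite \<times> ('n, 'm) expo) set). \<bar>monomial (state_index J) e h\<bar>)"
proof -
  have "norm (signal J b h s) \<le> (\<Sum>x\<in>stream_labels J b. real Q * (case x of (l, m, e) \<Rightarrow> \<bar>monomial (state_index J) e h\<bar>))"
    unfolding signal_def
  proof (rule sum_norm_le)
    fix x assume x: "x \<in> (stream_labels J b :: ('n \<times> 'm \<times> ('n, 'm) expo) set)"
    obtain l m e where x': "x = (l, m, e)" by (cases x)
    have "s l \<in> symbols J b Q l" using s by auto
    then have "s l (m, e) \<in> {0..int Q}"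
      using x unfolding symbols_def x' stream_labels_def by (auto simp: PiE_iff)
    then have "\<bar>real_of_int (s l (m, e))\<bar> \<le> real Q" by auto
    then show "norm (case x of (l, m, e) \<Rightarrow> (real_of_int (s l (m, e)) * monomial (state_index J) e h) *\<^sub>R axis m (1::real)) \<le>
        real Q * (case x of (l, m, e) \<Rightarrow> \<bar>monomial (state_index J) e h\<bar>)"
      by (simp add: x' abs_mult mult_right_mono)
  qed
  then show ?thesis by (simp add: sum_distrib_left)
qed

text \<open>Two received signals differ by an integer combination of the monomials in
  \<open>S\<close>. Interfering symbols may add up in any way, but where a symbol of user
  \<open>k\<close> differs the collected coefficient is this single difference, by
  \<open>landing_unique\<close>. So the combination is nontrivial and bad approximability
  applies.\<close>

lemma signal_separation_at:
  fixes J :: "'n::finite \<Rightarrow> nat" and h :: "'n \<times> nat \<Rightarrow> real ^ 'm::finite"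
  assumes h: "generic J h" and b: "b \<ge> 1" and k: "j \<in> {1..J k}"
  defines "D \<equiv> CARD('m) * b ^ card (coords J :: ('n, 'm) coeff set) +
    (CARD('n) - 1) * (b + 1) ^ card (coords J :: ('n, 'm) coeff set)"
  shows "\<exists>c>0. \<forall>Q\<ge>1. \<forall>s\<in>Pi\<^sub>E UNIV (symbols J b Q). \<forall>s'\<in>Pi\<^sub>E UNIV (symbols J b Q). s k \<noteq> s' k \<longrightarrow>
     c * real Q powr (- real D) \<le> \<bar>inner (h (k, j)) (signal J b h s) - inner (h (k, j)) (signal J b h s')\<bar>"
proof -
  let ?W = "stream_labels J b :: ('n \<times> 'm \<times> ('n, 'm) expo) set"
  define S where "S = landing (k, j) ` ?W"
  \<comment> \<open>At most \<open>w\<close> streams share one monomial, so \<open>w * Q\<close>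
    bounds every collected coefficient.\<close>
  define w where "w = real (card ?W)"
  have finW: "finite ?W" by (rule finite_stream_labels)
  obtain e0 where e0: "e0 \<in> (exps J b k :: ('n, 'm) expo set)"
  proof -
    have "card (exps J b k :: ('n, 'm) expo set) \<noteq> 0" using b by (simp add: card_exps)
    then show ?thesis using that by (metis card.empty ex_in_conv)
  qed
  have W0: "?W \<noteq> {}" using e0 by (auto simp: stream_labels_def)
  have w1: "w \<ge> 1" using finW W0 by (simp add: w_def Suc_le_eq card_gt_0_iff)
  have S0: "S \<noteq> {}" using W0 by (simp add: S_def)
  have SE: "S \<subseteq> (\<Pi>\<^sub>E p\<in>coords J. {..4 * b + 1})"
  proof
    fix a assume "a \<in> S"
    then obtain l m e where e: "e \<in> exps J b l" "a = bump ((k, j), m) e"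
      by (auto simp: S_def stream_labels_def landing_def)
    have mem: "((k, j), m) \<in> coords J" using k by (simp add: coords_def state_index_def)
    show "a \<in> (\<Pi>\<^sub>E p\<in>coords J. {..4 * b + 1})"
    proof (rule PiE_I)
      fix p assume p: "p \<in> (coords J :: ('n, 'm) coeff set)"
      then have "e p \<in> (if fst (fst p) = l then (\<lambda>s. 2 * b + 2 * s) ` {1..b} else {1..b})"
        using e(1) unfolding exps_def by (rule PiE_mem[rotated])
      then have "e p \<le> 4 * b" by (auto split: if_splits)
      then show "a p \<in> {..4 * b + 1}" by (auto simp: e(2) bump_def)
    next
      fix p assume p: "p \<notin> (coords J :: ('n, 'm) coeff set)"
      then have "p \<noteq> ((k, j), m)" using mem by blast
      then show "a p = undefined"
        using PiE_arb[OF e(1)[unfolded exps_def] p] by (simp add: e(2) bump_def)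
    qed
  qed
  have "badly_approximable S (\<lambda>a. monomial (state_index J) a h) 1"
    using h S0 SE unfolding generic_def by blast
  then obtain c where c: "c > 0" "\<And>X q. X \<ge> 1 \<Longrightarrow> (\<exists>a\<in>S. (q::_\<Rightarrow>int) a \<noteq> 0) \<Longrightarrow> (\<forall>a\<in>S. real_of_int \<bar>q a\<bar> \<le> X) \<Longrightarrow>
     c * X powr (- (real (card S) - 1) - 1) \<le> \<bar>\<Sum>a\<in>S. real_of_int (q a) * monomial (state_index J) a h\<bar>"
    unfolding badly_approximable_def by blast
  have cardS: "card S \<le> D" unfolding S_def D_def by (rule card_landing) (rule k)
  have main: "c * w powr (- real D) * real Q powr (- real D) \<le>
    \<bar>inner (h (k, j)) (signal J b h s) - inner (h (k, j)) (signal J b h s')\<bar>"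
    if Q: "Q \<ge> 1" and s: "s \<in> Pi\<^sub>E UNIV (symbols J b Q)" and s': "s' \<in> Pi\<^sub>E UNIV (symbols J b Q)" and ne:
      "s k \<noteq> s' k" for Q s s'
  proof -
    define dd where "dd x = s (fst x) (snd x) - s' (fst x) (snd x)" for x
    define q where "q a = (\<Sum>x\<in>{x\<in>?W. landing (k, j) x = a}. dd x)" for a
    have rng: "s l y \<in> {0..int Q}" "s' l y \<in> {0..int Q}" if "(l, y) \<in> ?W" for l y
      using s s' that unfolding stream_labels_def symbols_def by (auto simp: PiE_iff)
    have ddQ: "\<bar>dd x\<bar> \<le> int Q" if "x \<in> ?W" for x
      using rng[of "fst x" "snd x"] that by (auto simp: dd_def)
    have qb: "\<forall>a\<in>S. real_of_int \<bar>q a\<bar> \<le> w * real Q"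
    proof
      fix a
      have "real_of_int \<bar>q a\<bar> \<le> (\<Sum>x\<in>{x\<in>?W. landing (k, j) x = a}. real_of_int \<bar>dd x\<bar>)"
        unfolding q_def by (simp add: sum_abs of_int_abs[symmetric] del: of_int_abs flip: of_int_sum)
      also have "\<dots> \<le> (\<Sum>x\<in>?W. real_of_int \<bar>dd x\<bar>)" using finW by (intro sum_mono2) auto
      also have "\<dots> \<le> (\<Sum>x\<in>?W. real Q)"
      proof (rule sum_mono)
        fix x assume "x \<in> ?W"
        then have "real_of_int \<bar>dd x\<bar> \<le> real_of_int (int Q)" using ddQ by (simp only: of_int_le_iff)
        then show "real_of_int \<bar>dd x\<bar> \<le> real Q" by simp
      qed
      finally show "real_of_int \<bar>q a\<bar> \<le> w * real Q" by (simp add: w_def)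
    qed
    have qne: "\<exists>a\<in>S. q a \<noteq> 0"
    proof -
      have sk: "s k \<in> symbols J b Q k" "s' k \<in> symbols J b Q k" using s s' by auto
      have "\<not> (\<forall>y\<in>UNIV \<times> exps J b k. s k y = s' k y)"
        using ne PiE_ext[OF sk[unfolded symbols_def]] by blast
      then obtain m e where me: "e \<in> exps J b k" "s k (m, e) \<noteq> s' k (m, e)" by auto
      have mem: "(k, m, e) \<in> ?W" using me by (simp add: stream_labels_def)
      have "{x\<in>?W. landing (k, j) x = landing (k, j) (k, m, e)} = {(k, m, e)}"
        using landing_unique[OF k me(1)] mem by blast
      then have "q (landing (k, j) (k, m, e)) = dd (k, m, e)" by (simp add: q_def)
      also have "\<dots> \<noteq> 0" using me by (simp add: dd_def)
      finally show ?thesis using mem unfolding S_def by blast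
    qed
    have wQ: "w * real Q \<ge> 1" using w1 Q mult_mono[of 1 w 1 "real Q"] by simp
    have "inner (h (k, j)) (signal J b h s) - inner (h (k, j)) (signal J b h s') =
        (\<Sum>x\<in>?W. real_of_int (dd x) * monomial (state_index J) (landing (k, j) x) h)"
      unfolding inner_signal[where J = J and k = k and j = j, OF k]
        by (simp add: dd_def left_diff_distrib sum_subtractf)
    also have "\<dots> = (\<Sum>a\<in>S. \<Sum>x\<in>{x\<in>?W. landing (k, j) x =
      a}. real_of_int (dd x) * monomial (state_index J) (landing (k, j) x) h)"
      unfolding S_def by (rule sum.image_gen[OF finW])
    also have "\<dots> = (\<Sum>a\<in>S. real_of_int (q a) * monomial (state_index J) a h)"
      unfolding q_def by (intro sum.cong refl) (simp add: sum_distrib_right)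
    finally have eq: "inner (h (k, j)) (signal J b h s) - inner (h (k, j)) (signal J b h s') =
      (\<Sum>a\<in>S. real_of_int (q a) * monomial (state_index J) a h)" .
    have "c * w powr (- real D) * real Q powr (- real D) = c * (w * real Q) powr (- real D)"
      using w1 by (simp add: powr_mult)
    also have "\<dots> \<le> c * (w * real Q) powr (- (real (card S) - 1) - 1)"
      using c(1) wQ cardS by (intro mult_left_mono powr_mono) auto
    also have "\<dots> \<le> \<bar>\<Sum>a\<in>S. real_of_int (q a) * monomial (state_index J) a h\<bar>"
      by (rule c(2)[OF wQ qne qb])
    finally show ?thesis unfolding eq .
  qed
  have "c * w powr (- real D) > 0" using c w1 by simp
  with main show ?thesis by blast
qed

lemma signal_separation:
  fixes J :: "'n::finite \<Rightarrow> nat" and h :: "'n \<times> nat \<Rightarrow> real ^ 'm::finite"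
  assumes h: "generic J h" and b: "b \<ge> 1"
  defines "D \<equiv> CARD('m) * b ^ card (coords J :: ('n, 'm) coeff set) +
    (CARD('n) - 1) * (b + 1) ^ card (coords J :: ('n, 'm) coeff set)"
  shows "\<exists>c>0. \<forall>k. \<forall>j\<in>{1..J k}. \<forall>Q\<ge>1. \<forall>s\<in>Pi\<^sub>E UNIV (symbols J b Q). \<forall>s'\<in>Pi\<^sub>E UNIV (symbols J b Q). s k \<noteq> s' k \<longrightarrow>
     c * real Q powr (- real D) \<le> \<bar>inner (h (k, j)) (signal J b h s) - inner (h (k, j)) (signal J b h s')\<bar>"
proof -
  define good where "good c i \<longleftrightarrow> c > 0 \<and> (\<forall>Q\<ge>1. \<forall>s\<in>Pi\<^sub>E UNIV (symbols J b Q). \<forall>s'\<in>Pi\<^sub>E UNIV (symbols J b Q). s (fst i) \<noteq> s' (fst i) \<longrightarrow>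
     c * real Q powr (- real D) \<le> \<bar>inner (h i) (signal J b h s) - inner (h i) (signal J b h s')\<bar>)" for c i
  have ex: "\<exists>c. good c i" if i: "i \<in> state_index J" for i
  proof -
    obtain k j where kj: "i = (k, j)" "j \<in> {1..J k}" using i by (auto simp: state_index_def)
    from signal_separation_at[OF h b kj(2)] show ?thesis unfolding good_def kj(1) D_def fst_conv by blast
  qed
  define c where "c i = (SOME c. good c i)" for i
  have c: "good (c i) i" if "i \<in> state_index J" for i unfolding c_def by (rule someI_ex[OF ex[OF that]])
  \<comment> \<open>The inserted 1 keeps the set nonempty for every \<open>J\<close>.\<close>
  define c0 where "c0 = Min (insert 1 (c ` state_index J))"
  have fin: "finite (insert 1 (c ` state_index J))" by (simp add: finite_state_index)
  have c0: "c0 > 0" unfolding c0_def using fin c by (subst Min_gr_iff) (auto simp: good_def)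
  show ?thesis
  proof (intro exI[of _ c0] conjI c0 allI ballI impI)
    fix k j Q and s s' :: "'n \<Rightarrow> 'm \<times> ('n, 'm) expo \<Rightarrow> int"
    assume j: "j \<in> {1..J k}" and Q: "1 \<le> (Q::nat)" and s: "s \<in> Pi\<^sub>E UNIV (symbols J b Q)"
      "s' \<in> Pi\<^sub>E UNIV (symbols J b Q)" "s k \<noteq> s' k"
    have i: "(k, j) \<in> state_index J" using j by (simp add: state_index_def)
    have "c0 \<le> c (k, j)" unfolding c0_def using fin i by (intro Min_le) auto
    then have "c0 * real Q powr (- real D) \<le> c (k, j) * real Q powr (- real D)"
      by (intro mult_right_mono) auto
    also have "\<dots> \<le> \<bar>inner (h (k, j)) (signal J b h s) - inner (h (k, j)) (signal J b h s')\<bar>"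
      using c[OF i] Q s unfolding good_def fst_conv by blast
    finally show "c0 * real Q powr (- real D) \<le>
      \<bar>inner (h (k, j)) (signal J b h s) - inner (h (k, j)) (signal J b h s')\<bar>" .
  qed
qed

lemma symbols_finite: "finite (symbols J b Q l :: ('m::finite \<times> ('n::finite, 'm) expo \<Rightarrow> int) set)"
  unfolding symbols_def by (intro finite_PiE) (simp_all add: finite_exps)

lemma card_symbols:
  "card (symbols J b Q l :: ('m::finite \<times> ('n::finite, 'm) expo \<Rightarrow> int) set) =
     (Q + 1) ^ (CARD('m) * b ^ card (coords J :: ('n, 'm) coeff set))"
  unfolding symbols_def using finite_exps(1)[of J b l, where 'm = 'm]
  by (subst card_PiE) (simp_all add: card_cartesian_product card_exps nat_add_distrib)

text \<open>Integers up to \<open>Q P\<close>, about \<open>P powr \<theta>\<close>, are scaled to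
  meet the power constraint. The minimum distance is then at least of order
  \<open>sqrt P * Q powr (- D - 1)\<close>, which still grows with \<open>P\<close>, while each of
  the \<open>T\<close> streams of a user carries about \<open>\<theta> * log 2 P\<close>
  bits.\<close>

lemma sum_capacity_lower:
  fixes J :: "'n::finite \<Rightarrow> nat" and h :: "'n \<times> nat \<Rightarrow> real ^ 'm::finite"
  assumes h: "generic J h" and b: "b \<ge> 1" and \<tau>: "0 < \<tau>" "\<tau> < 1 / 2"
  defines "T \<equiv> CARD('m) * b ^ card (coords J :: ('n, 'm) coeff set)"
  defines "D \<equiv> T + (CARD('n) - 1) * (b + 1) ^ card (coords J :: ('n, 'm) coeff set)"
  shows "\<forall>\<^sub>F P in at_top. ereal (real CARD('n) * ((1 - 2 * \<tau>) * real T / (real D +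
    2) * (1 / 2 * log 2 P) - 2)) \<le> sum_capacity J h P"
proof -
  \<comment> \<open>Chosen so that \<open>\<theta> * (D + 2) = 1 / 2\<close>: scaling consumes one
    factor \<open>Q\<close> and separation \<open>D\<close> more, which leaves a distance of order
    \<open>P powr \<theta>\<close>.\<close>
  define \<theta> where "\<theta> = 1 / (2 * (real D + 2))"
  have \<theta>: "\<theta> > 0" by (simp add: \<theta>_def)
  obtain c where c: "c > 0" and sep:
    "\<And>k j Q s s'. j \<in> {1..J k} \<Longrightarrow> Q \<ge> 1 \<Longrightarrow> s \<in> Pi\<^sub>E UNIV (symbols J b Q) \<Longrightarrow> s' \<in> Pi\<^sub>E UNIV (symbols J b Q) \<Longrightarrow>
     s k \<noteq> s' k \<Longrightarrow> c * real Q powr (- real D) \<le>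
       \<bar>inner (h (k, j)) (signal J b h s) - inner (h (k, j)) (signal J b h s')\<bar>"
    using signal_separation[OF h b] unfolding D_def T_def by blast
  define B where "B = (\<Sum>(l, m, e)\<in>(stream_labels J b :: ('n \<times> 'm \<times> ('n, 'm) expo) set). \<bar>monomial (state_index J) e h\<bar>) + 1"
  have B: "B > 0" unfolding B_def by (intro add_nonneg_pos sum_nonneg) auto
  define Q where "Q P = nat \<lfloor>P powr \<theta>\<rfloor>" for P
  define a where "a P = sqrt P / (B * real (Q P))" for P
  define \<delta> where "\<delta> P = a P * (c * real (Q P) powr (- real D)) / 2" for P
  \<comment> \<open>\<open>1 / K\<^sup>2\<close> raised to the power \<open>\<tau>\<close> is
    \<open>1 / 4\<close>, the tail that the block code tolerates.\<close>
  define K where "K = 4 powr (1 / (2 * \<tau>))"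
  have K: "K > 0" by (simp add: K_def)
  define R where "R P = (1 - 2 * \<tau>) * real T / (real D + 2) * (1 / 2 * log 2 P) - 2" for P
  have \<delta>_ge: "c / (2 * B) * P powr \<theta> \<le> \<delta> P" and Q1: "Q P \<ge> 1" if P: "P \<ge> 1" for P
  proof -
    have P\<theta>: "1 \<le> P powr \<theta>" using P \<theta> by (simp add: ge_one_powr_ge_zero)
    then show Q1: "Q P \<ge> 1" by (simp add: Q_def le_nat_iff)
    have Qle: "real (Q P) \<le> P powr \<theta>" using P\<theta> by (simp add: Q_def)
    have "real (Q P) powr (real D + 1) \<le> (P powr \<theta>) powr (real D + 1)"
      using Qle by (intro powr_mono2) auto
    also have "\<dots> = P powr (1 / 2 - \<theta>)"
    proof -
      have "\<theta> * (real D + 1) = 1 / 2 - \<theta>" by (simp add: \<theta>_def field_simps)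
      then show ?thesis by (simp add: powr_powr)
    qed
    finally have "real (Q P) powr (real D + 1) * P powr \<theta> \<le> P powr (1 / 2 - \<theta>) * P powr \<theta>"
      by (intro mult_right_mono) auto
    also have "\<dots> = sqrt P" using P by (simp add: powr_half_sqrt flip: powr_add)
    finally have 1: "real (Q P) powr (real D + 1) * P powr \<theta> \<le> sqrt P" .
    have "real (Q P) powr (real D + 1) = real (Q P) * real (Q P) powr real D"
      using Q1 by (simp add: powr_add)
    then have "real (Q P) * real (Q P) powr real D * P powr \<theta> \<le> sqrt P" using 1 by simp
    then have "c / (2 * B) * (real (Q P) * real (Q P) powr real D * P powr \<theta>) \<le> c / (2 * B) * sqrt P"
      using c B by (intro mult_left_mono) auto
    then have "c / (2 * B) * P powr \<theta> * (real (Q P) * real (Q P) powr real D) \<le> c / (2 * B) * sqrt P"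
      by (simp only: mult_ac)
    then have "c / (2 * B) * P powr \<theta> \<le> c / (2 * B) * sqrt P / (real (Q P) * real (Q P) powr real D)"
      using Q1 by (subst pos_le_divide_eq) auto
    also have "\<dots> = \<delta> P" using Q1 B by (simp add: \<delta>_def a_def powr_minus field_simps)
    finally show "c / (2 * B) * P powr \<theta> \<le> \<delta> P" .
  qed
  have "filterlim (\<lambda>P. c / (2 * B) * P powr \<theta>) at_top at_top"
    using \<theta> c B by real_asymp
  then have ev1: "\<forall>\<^sub>F P in at_top. K \<le> c / (2 * B) * P powr \<theta>" by (simp add: filterlim_at_top)
  have T1: "T > 0" unfolding T_def using b by simp
  have "filterlim R at_top at_top"
  proof -
    define q where "q = (1 - 2 * \<tau>) * real T / (real D + 2)"
    have "q > 0" using \<tau> T1 unfolding q_def by (intro divide_pos_pos mult_pos_pos) auto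
    then show ?thesis unfolding R_def q_def[symmetric] by real_asymp
  qed
  then have ev2: "\<forall>\<^sub>F P in at_top. 0 \<le> R P" by (simp add: filterlim_at_top)
  show ?thesis using ev1 ev2 eventually_ge_at_top[of 1]
  proof eventually_elim
    case (elim P)
    note P = elim(3)
    have \<delta>K: "K \<le> \<delta> P" using elim(1) \<delta>_ge[OF P] by linarith
    have \<delta>0: "\<delta> P > 0" using \<delta>K K by linarith
    have q1: "real (Q P) > 0" using Q1[OF P] by simp
    have a0: "a P > 0" using P B q1 by (simp add: a_def)
    have "achievable J h P (\<lambda>_. R P)"
    proof (rule achievable_from_separation[where A = "symbols J b (Q P)" and X = "\<lambda>s. a P *\<^sub>R signal J b h s"
      and \<delta> = "\<delta> P" and \<tau> = \<tau>])
      show "finite (symbols J b (Q P) k :: ('m \<times> ('n, 'm) expo \<Rightarrow> int) set)" for k by (rule symbols_finite)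
      show "symbols J b (Q P) k \<noteq> ({} :: ('m \<times> ('n, 'm) expo \<Rightarrow> int) set)" for k
      proof
        assume "symbols J b (Q P) k = ({} :: ('m \<times> ('n, 'm) expo \<Rightarrow> int) set)"
        then have "card (symbols J b (Q P) k :: ('m \<times> ('n, 'm) expo \<Rightarrow> int) set) = 0" by simp
        then show False unfolding card_symbols by simp
      qed
      show "\<delta> P > 0" by (rule \<delta>0)
      show "(norm (a P *\<^sub>R signal J b h s))\<^sup>2 \<le> P" if s: "s \<in> Pi\<^sub>E UNIV (symbols J b (Q P))" for s
      proof -
        have "norm (signal J b h s) \<le> real (Q P) * (B - 1)"
          using signal_norm_le[OF s, of h] by (simp add: B_def)
        also have "\<dots> \<le> real (Q P) * B" by (intro mult_left_mono) auto
        finally have "norm (a P *\<^sub>R signal J b h s) \<le> a P * (real (Q P) * B)"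
          using a0 by (simp add: mult_left_mono)
        also have "\<dots> = sqrt P" using B q1 by (simp add: a_def)
        finally have "(norm (a P *\<^sub>R signal J b h s))\<^sup>2 \<le> (sqrt P)\<^sup>2" by (intro power_mono) auto
        then show ?thesis using P by simp
      qed
      show "2 * \<delta> P \<le> \<bar>inner (h (k, j)) (a P *\<^sub>R signal J b h s) - inner (h (k, j)) (a P *\<^sub>R signal J b h s')\<bar>"
        if "j \<in> {1..J k}" "s \<in> Pi\<^sub>E UNIV (symbols J b (Q P))" "s' \<in> Pi\<^sub>E UNIV (symbols J b (Q P))"
          "s k \<noteq> s' k" for k j s s'
      proof -
        have "2 * \<delta> P = a P * (c * real (Q P) powr (- real D))" by (simp add: \<delta>_def)
        also have "\<dots> \<le> a P * \<bar>inner (h (k, j)) (signal J b h s) - inner (h (k, j)) (signal J b h s')\<bar>"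
          using a0 sep[OF that(1) Q1[OF P] that(2-4)] by (intro mult_left_mono) auto
        also have "\<dots> = \<bar>inner (h (k, j)) (a P *\<^sub>R signal J b h s) - inner (h (k, j)) (a P *\<^sub>R signal J b h s')\<bar>"
          using a0 by (simp add: right_diff_distrib[symmetric] abs_mult)
        finally show ?thesis .
      qed
      show "0 < \<tau>" by (rule \<tau>)
      show "2 * measure (gauss 1) {z. \<delta> P \<le> \<bar>z\<bar>} powr \<tau> \<le> 1 / 2"
      proof -
        have "measure (gauss 1) {z. \<delta> P \<le> \<bar>z\<bar>} \<le> 1 / (\<delta> P)\<^sup>2" by (rule Gaussian_tail[OF \<delta>0])
        also have "\<dots> \<le> 1 / K\<^sup>2" using \<delta>K K
          by (intro divide_left_mono power_mono mult_pos_pos zero_less_power \<delta>0) auto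
        also have "\<dots> = 4 powr (- (1 / \<tau>))"
        proof -
          have "K\<^sup>2 = 4 powr (1 / \<tau>)" using \<tau> by (simp add: K_def power2_eq_square flip: powr_add)
          then show ?thesis by (simp add: powr_minus inverse_eq_divide)
        qed
        finally have "measure (gauss 1) {z. \<delta> P \<le> \<bar>z\<bar>} powr \<tau> \<le> (4 powr (- (1 / \<tau>))) powr \<tau>"
          using \<tau> by (intro powr_mono2) auto
        also have "\<dots> = 4 powr (- 1)" using \<tau> by (subst powr_powr) simp
        also have "\<dots> = 1 / 4" by (simp add: powr_minus)
        finally show ?thesis by simp
      qed
      show "0 \<le> R P" by (rule elim(2))
      show "R P + 2 \<le> (1 - 2 * \<tau>) * log 2 (card (symbols J b (Q P) k :: ('m \<times> ('n, 'm) expo \<Rightarrow> int) set))"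
        for k
      proof -
        have "P powr \<theta> \<le> real (Q P) + 1"
          unfolding Q_def using P by (simp add: le_nat_iff)
        then have "log 2 (P powr \<theta>) \<le> log 2 (real (Q P) + 1)" using P q1 by (subst log_le_cancel_iff) auto
        then have "\<theta> * log 2 P \<le> log 2 (real (Q P) + 1)" using P by (simp add: log_powr)
        then have "(1 - 2 * \<tau>) * (real T * (\<theta> * log 2 P)) \<le> (1 - 2 * \<tau>) * (real T * log 2 (real (Q P) + 1))"
          using \<tau> by (intro mult_left_mono) auto
        moreover have "R P + 2 = (1 - 2 * \<tau>) * (real T * (\<theta> * log 2 P))"
          by (simp add: R_def \<theta>_def mult_ac)
        moreover have "log 2 (card (symbols J b (Q P) k :: ('m \<times> ('n, 'm) expo \<Rightarrow> int) set)) =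
          real T * log 2 (real (Q P) + 1)"
          unfolding card_symbols T_def[symmetric] by (simp add: log_nat_power add.commute)
        ultimately show ?thesis by simp
      qed
    qed
    then have "ereal (\<Sum>k\<in>(UNIV :: 'n set). R P) \<le> sum_capacity J h P"
      unfolding sum_capacity_def by (intro SUP_upper2[where i = "\<lambda>_. R P"]) auto
    then show ?case by (simp add: R_def)
  qed
qed

section \<open>Bases of channel vectors and the limit\<close>

text \<open>The Leibniz formula is a combination of distinct monomials with coefficients 1 and -1,
  and bad approximability with coefficient bound 1 excludes the value 0. Genericity thus also
  supplies the bases that the outer bound requires.\<close>

lemma generic_det_nonzero:
  fixes J :: "'n::finite \<Rightarrow> nat" and h :: "'n \<times> nat \<Rightarrow> real ^ 'm::finite"
  assumes h: "generic J h" and \<iota>: "inj (\<iota> :: 'm \<Rightarrow> nat)" "\<And>j. \<iota> j \<in> {1..J k}"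
  shows "Determinants.det (\<chi> j. h (k, \<iota> j)) \<noteq> 0"
proof -
  let ?C = "coords J :: ('n, 'm) coeff set" and ?I = "state_index J"
  define \<P> where "\<P> = {p :: 'm \<Rightarrow> 'm. p permutes UNIV}"
  define a where "a p = (\<lambda>q\<in>?C. if q \<in> (\<lambda>i. ((k, \<iota> i), p i)) ` UNIV then 1 else 0 :: nat)" for p :: "'m \<Rightarrow> 'm"
  have mem: "((k, \<iota> i), m) \<in> ?C" for i m using \<iota>(2) by (simp add: coords_def state_index_def)
  have inj: "inj_on a \<P>"
  proof (rule inj_onI)
    fix p p' assume eq: "a p = a p'"
    have "p i = p' i" for i
    proof -
      have "a p ((k, \<iota> i), p i) = 1" using mem by (simp add: a_def image_iff) blast
      then have "a p' ((k, \<iota> i), p i) = 1" by (simp add: eq)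
      then have "((k, \<iota> i), p i) \<in> (\<lambda>i. ((k, \<iota> i), p' i)) ` UNIV"
        using mem by (simp add: a_def split: if_splits)
      then obtain i' where "\<iota> i = \<iota> i'" "p i = p' i'" by auto
      then show ?thesis using \<iota>(1) by (simp add: inj_eq)
    qed
    then show "p = p'" by auto
  qed
  have mono: "monomial ?I (a p) h = (\<Prod>i\<in>UNIV. h (k, \<iota> i) $ p i)" for p
  proof -
    let ?im = "(\<lambda>i. ((k, \<iota> i), p i)) ` UNIV"
    have "monomial ?I (a p) h = (\<Prod>q\<in>?C. if q \<in> ?im then h (fst q) $ snd q else 1)"
      unfolding monomial_def coords_def[symmetric] by (intro prod.cong) (auto simp: a_def)
    also have "\<dots> = (\<Prod>q\<in>?im. h (fst q) $ snd q)"
      using mem by (intro prod.mono_neutral_cong_right finite_coords) auto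
    also have "\<dots> = (\<Prod>i\<in>UNIV. h (k, \<iota> i) $ p i)"
      using \<iota>(1) by (subst prod.reindex) (auto simp: inj_on_def)
    finally show ?thesis .
  qed
  define q where "q s = sign (the_inv_into \<P> a s)" for s
  have qa: "q (a p) = sign p" if "p \<in> \<P>" for p using the_inv_into_f_f[OF inj that] by (simp add: q_def)
  have id: "id \<in> \<P>" by (simp add: \<P>_def permutes_id)
  have sub: "a ` \<P> \<subseteq> (\<Pi>\<^sub>E p\<in>?C. {..1})" by (auto simp: a_def)
  have "badly_approximable (a ` \<P>) (\<lambda>s. monomial ?I s h) 1"
  proof -
    have "a ` \<P> \<noteq> {}" using id by blast
    from h[unfolded generic_def, rule_format, OF this sub] show ?thesis .
  qed
  from this[unfolded badly_approximable_def] obtain c where c: "c > 0"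
    "\<And>X q. X \<ge> 1 \<Longrightarrow> (\<exists>s\<in>a ` \<P>. (q::_\<Rightarrow>int) s \<noteq> 0) \<Longrightarrow> (\<forall>s\<in>a ` \<P>. real_of_int \<bar>q s\<bar> \<le> X) \<Longrightarrow>
     c * X powr (- (real (card (a ` \<P>)) - 1) - 1) \<le> \<bar>\<Sum>s\<in>a ` \<P>. real_of_int (q s) * monomial ?I s h\<bar>"
    by (elim exE conjE) (rule that, assumption, elim allE impE, assumption+)
  have "c * 1 powr (- (real (card (a ` \<P>)) - 1) - 1) \<le> \<bar>\<Sum>s\<in>a ` \<P>. real_of_int (q s) * monomial ?I s h\<bar>"
  proof (rule c(2))
    show "\<exists>s\<in>a ` \<P>. q s \<noteq> 0" using id qa[OF id] by (intro bexI[of _ "a id"]) (auto simp: sign_id)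
    show "\<forall>s\<in>a ` \<P>. real_of_int \<bar>q s\<bar> \<le> 1" using qa by (auto simp: sign_def)
  qed simp
  also have "(\<Sum>s\<in>a ` \<P>. real_of_int (q s) * monomial ?I s h) =
    (\<Sum>p\<in>\<P>. real_of_int (sign p) * (\<Prod>i\<in>UNIV. h (k, \<iota> i) $ p i))"
    by (subst sum.reindex[OF inj]) (auto simp: qa mono)
  also have "\<dots> = Determinants.det (\<chi> j. h (k, \<iota> j))"
    by (simp add: Determinants.det_def \<P>_def)
  finally show ?thesis using c(1) by auto
qed

lemma generic_spanning:
  fixes J :: "'n::finite \<Rightarrow> nat" and h :: "'n \<times> nat \<Rightarrow> real ^ 'm::finite"
  assumes h: "generic J h" and \<iota>: "inj (\<iota> :: 'm \<Rightarrow> nat)" "\<And>j. \<iota> j \<in> {1..J k}"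
  shows "\<exists>b. x = (\<Sum>j\<in>UNIV. b j *\<^sub>R h (k, \<iota> j))"
proof -
  define A where "A = (\<chi> j. h (k, \<iota> j))"
  have "Determinants.det (Finite_Cartesian_Product.transpose A) \<noteq> 0"
    using generic_det_nonzero[OF h \<iota>] by (simp add: A_def Determinants.det_transpose)
  then obtain B where "Finite_Cartesian_Product.transpose A ** B = Finite_Cartesian_Product.mat 1"
    by (metis invertible_det_nz invertible_def)
  then have "x = Finite_Cartesian_Product.transpose A *v (B *v x)"
    by (simp add: matrix_vector_mul_assoc)
  also have "\<dots> = (\<Sum>j\<in>UNIV. (B *v x) $ j *\<^sub>R h (k, \<iota> j))"
    by (simp add: matrix_mult_sum column_def Finite_Cartesian_Product.transpose_def A_def vec_lambda_eta scalar_mult_eq_scaleR)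
  finally show ?thesis by blast
qed

text \<open>Division by \<open>b ^ G\<close>. The coding fraction \<open>1 / (4 * b)\<close> is tied
  to \<open>b\<close>, so one limit removes the coding loss together with the boundary effects of
  the alignment.\<close>

lemma dof_sequence_limit:
  fixes M N :: real
  assumes M: "M \<ge> 1" and N: "N \<ge> 1" and G: "G > 0"
  shows "(\<lambda>b. N * ((1 - 2 * (1 / (4 * real b))) * (M * real b ^ G) / (M * real b ^ G +
    (N - 1) * (real b + 1) ^ G + 2)))
     \<longlonglongrightarrow> M * N / (M + N - 1)"
proof -
  have i: "(\<lambda>b. 1 / real b) \<longlonglongrightarrow> 0" by (rule lim_1_over_n)
  have "(\<lambda>b. N * ((1 - 1 / 2 * (1 / real b)) * M / (M + (N - 1) * (1 + 1 / real b) ^ G +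
    2 * (1 / real b) ^ G)))
      \<longlonglongrightarrow> N * ((1 - 1 / 2 * 0) * M / (M + (N - 1) * (1 + 0) ^ G + 2 * 0 ^ G))"
    using M N G by (intro tendsto_intros i) (auto simp: zero_power)
  also have "N * ((1 - 1 / 2 * 0) * M / (M + (N - 1) * (1 + 0) ^ G + 2 * 0 ^ G)) = M * N / (M + N - 1)"
    using G by (simp add: zero_power mult.commute)
  finally show ?thesis
  proof (rule Lim_transform_eventually)
    show "\<forall>\<^sub>F b in sequentially. N * ((1 - 1 / 2 * (1 / real b)) * M / (M +
      (N - 1) * (1 + 1 / real b) ^ G + 2 * (1 / real b) ^ G)) =
      N * ((1 - 2 * (1 / (4 * real b))) * (M * real b ^ G) / (M * real b ^ G +
        (N - 1) * (real b + 1) ^ G + 2))"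
      using eventually_gt_at_top[of 0]
    proof eventually_elim
      case (elim b)
      define x where "x = real b ^ G"
      have x: "x > 0" using elim by (simp add: x_def)
      have 1: "(1 + 1 / real b) ^ G = (real b + 1) ^ G / x"
      proof -
        have "1 + 1 / real b = (real b + 1) / real b" using elim by (simp add: field_simps)
        then show ?thesis by (simp add: power_divide x_def)
      qed
      have 2: "(1 / real b) ^ G = 1 / x" by (simp add: power_divide x_def)
      have "M + (N - 1) * (1 + 1 / real b) ^ G + 2 * (1 / real b) ^ G =
        (M * x + (N - 1) * (real b + 1) ^ G + 2) / x"
        unfolding 1 2 using x by (simp add: field_simps)
      then show ?case unfolding x_def[symmetric] using x by simp
    qed
  qed
qed

theorem theorem4:
  fixes J :: "'n::finite \<Rightarrow> nat"
    and D :: "('n \<times> nat \<Rightarrow> real ^ 'm::finite) measure"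
  assumes "CARD('m) \<ge> 2" and "CARD('n) \<ge> 2"
    and "\<And>k. J k \<ge> CARD('m)"
    and "continuous_draw J D"
  shows "AE h in D. has_dof J h
           (real CARD('m) * real CARD('n) / (real CARD('m) + real CARD('n) - 1))"
proof -
  let ?M = "real CARD('m)" and ?N = "real CARD('n)"
  define d where "d = ?M * ?N / (?M + ?N - 1)"
  have M2: "?M \<ge> 2" and N2: "?N \<ge> 2" using assms(1,2) by (simp_all add: numeral_le_real_of_nat_iff)
  have J1: "J k \<ge> 1" for k using assms(1) assms(3)[of k] by linarith
  obtain f :: "'m \<Rightarrow> nat" where f: "bij_betw f UNIV {0..<CARD('m)}"
    using ex_bij_betw_finite_nat[of "UNIV :: 'm set"] by auto
  \<comment> \<open>The states from 1 to \<open>CARD('m)\<close> of each user provide its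
    basis.\<close>
  define \<iota> where "\<iota> j = Suc (f j)" for j
  have \<iota>: "inj \<iota>" using f by (auto simp: \<iota>_def inj_on_def bij_betw_def)
  have \<iota>J: "\<iota> j \<in> {1..J k}" for j k
  proof -
    have "f j < CARD('m)" using f by (auto simp: bij_betw_def)
    then show ?thesis using assms(3)[of k] by (simp add: \<iota>_def)
  qed
  have dof: "has_dof J h d" if h: "generic J h" for h :: "'n \<times> nat \<Rightarrow> real ^ 'm"
  proof -
    define S where "S P = sum_capacity J h P" for P
    let ?x = "\<lambda>P::real. 1 / 2 * log 2 P"
    have "\<exists>C. \<forall>P\<ge>1. S P \<le> ereal (d * ?x P + C)"
      unfolding S_def d_def
      by (rule sum_capacity_upper[where \<iota> = "\<lambda>_. \<iota>", OF J1 \<iota>J generic_spanning[OF h \<iota> \<iota>J]])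
    then obtain C where "\<forall>P\<ge>1. S P \<le> ereal (d * ?x P + C)" by (elim exE)
    then have C: "S P \<le> ereal (d * ?x P + C)" if "P \<ge> 1" for P using that by simp
    have xpos: "?x P > 0" if "P > 1" for P using that by simp
    have small: "((\<lambda>P. c / ?x P) \<longlongrightarrow> 0) at_top" for c :: real by real_asymp
    show ?thesis unfolding has_dof_def S_def[symmetric]
    proof (rule order_tendstoI)
      fix y assume "ereal d < y"
      then obtain z where z: "ereal d < ereal z" "ereal z < y" using ereal_dense2 by blast
      have "((\<lambda>P. d + C / ?x P) \<longlongrightarrow> d + 0) at_top" by (intro tendsto_add tendsto_const small)
      then have "\<forall>\<^sub>F P in at_top. d + C / ?x P < z" using z(1) by (intro order_tendstoD) auto
      then show "\<forall>\<^sub>F P in at_top. S P / ereal (?x P) < y" using eventually_gt_at_top[of 1]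
      proof eventually_elim
        case (elim P)
        have "S P / ereal (?x P) \<le> ereal (d * ?x P + C) / ereal (?x P)"
          using C[of P] elim(2) xpos[OF elim(2)] by (intro ereal_divide_right_mono) auto
        also have "\<dots> = ereal (d + C / ?x P)"
          using xpos[OF elim(2)] by (simp add: add_divide_distrib)
        also have "\<dots> < y" using elim(1) z(2)
          by (meson ereal_less_eq(3) le_less_trans less_ereal.simps(1) less_trans)
        finally show ?case .
      qed
    next
      fix y assume "y < ereal d"
      then obtain z where z: "y < ereal z" "ereal z < ereal d" using ereal_dense2 by blast
      define G where "G = card (coords J :: ('n, 'm) coeff set)"
      have G: "G > 0"
      proof -
        obtain k :: 'n where True by simp
        have "((k, 1), m) \<in> (coords J :: ('n, 'm) coeff set)" for m
          using J1 by (simp add: coords_def state_index_def)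
        then show ?thesis unfolding G_def using finite_coords by (auto simp: card_gt_0_iff)
      qed
      define F where "F b = ?N * ((1 - 2 * (1 / (4 * real b))) * (?M * real b ^ G) / (?M * real b ^ G +
        (?N - 1) * (real b + 1) ^ G + 2))" for b
      have "F \<longlonglongrightarrow> d" unfolding F_def d_def using M2 N2 G by (intro dof_sequence_limit) auto
      then have "\<forall>\<^sub>F b in sequentially. z < F b" using z(2) by (intro order_tendstoD) auto
      \<comment> \<open>\<open>b\<close> is fixed by the accuracy \<open>z\<close> before
        \<open>P\<close> grows; the lower bound holds for all \<open>P\<close> beyond a threshold
        that depends on \<open>b\<close>.\<close>
      then obtain b where b: "b \<ge> 1" "z < F b"
        using eventually_ge_at_top[of 1]
          by (metis (mono_tags, lifting) eventually_conj eventually_happens trivial_limit_sequentially)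
      define \<tau> where "\<tau> = 1 / (4 * real b)"
      have \<tau>: "0 < \<tau>" "\<tau> < 1 / 2" using b(1) by (auto simp: \<tau>_def field_simps)
      have low: "\<forall>\<^sub>F P in at_top. ereal (F b * ?x P - 2 * ?N) \<le> S P"
      proof -
        have c: "real (CARD('n) - 1) = ?N - 1" using N2 by simp
        have "?N * ((1 - 2 * \<tau>) * real (CARD('m) * b ^ G) / (real (CARD('m) * b ^ G +
          (CARD('n) - 1) * (b + 1) ^ G) + 2) * (?x P) - 2) =
           F b * ?x P - 2 * ?N" for P
          unfolding F_def \<tau>_def by (simp add: c right_diff_distrib ac_simps)
        then show ?thesis using sum_capacity_lower[OF h b(1) \<tau>] unfolding S_def G_def[symmetric] by simp
      qed
      have "((\<lambda>P. F b - 2 * ?N / ?x P) \<longlongrightarrow> F b - 0) at_top" by (intro tendsto_diff tendsto_const small)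
      then have "\<forall>\<^sub>F P in at_top. z < F b - 2 * ?N / ?x P" using b(2) by (intro order_tendstoD) auto
      then show "\<forall>\<^sub>F P in at_top. y < S P / ereal (?x P)" using low eventually_gt_at_top[of 1]
      proof eventually_elim
        case (elim P)
        have "y < ereal (F b - 2 * ?N / ?x P)" using elim(1) z(1) by (meson less_ereal.simps(1) less_trans)
        also have "ereal (F b - 2 * ?N / ?x P) = ereal (F b * ?x P - 2 * ?N) / ereal (?x P)"
          using xpos[OF elim(3)] by (simp add: diff_divide_distrib)
        also have "\<dots> \<le> S P / ereal (?x P)"
          using elim(2) xpos[OF elim(3)] by (intro ereal_divide_right_mono) auto
        finally show ?case .
      qed
    qed
  qed
  have "AE h in state_lebesgue J. generic J (h :: 'n \<times> nat \<Rightarrow> real ^ 'm)" by (rule AE_generic)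
  then have "AE h in D. generic J h"
    using assms(4) unfolding continuous_draw_def by (auto intro: absolutely_continuous_AE[rotated 2])
  then show ?thesis by (rule AE_mp) (auto intro!: AE_I2 dof simp flip: d_def)
qed

end
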